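(* Let $\mathcal R_0$ be an indecomposable admissible fully reflectable component of the root groupoid and let $\mathfrak g$ be a root Lie superalgebra supported on $\mathcal R_0$, with set of roots $\Delta$. Assume that $\mathcal R_0$ is of type (Fin). Then: (1) $\Delta^{im}=\emptyset$. (2) $\mathfrak g=\mathfrak g^{\mathtt C}$, except for the case $\mathfrak g^{\mathtt C}=\mathfrak{gl}(1|1)$ (i.e. $|X|=1$, $p(x)=1$, $a_{xx}=0$). (3) $\mathfrak g$ is finite-dimensional.
   Context: Root groupoid. Fix a finite set $X$. A root datum is a quadruple $v=(\mathfrak h,a,b,p)$ with $\mathfrak h$ a finite-dimensional complex vector space, $a:X\to\mathfrak h$, $b:X\to\mathfrak h^*$ such that the families $(a(x))_{x\in X}$ and $(b(x))_{x\in X}$ are linearly independent, and $p:X\to\mathbb Z_2$; we write $\mathfrak h(v),a_v,b_v,p_v$. Its Cartan matrix is $a_{xy}=\langle a(x),b(y)\rangle$. An element $x\in X$ is reflectable at $v$ if: $a_{xx}=0$ implies $p(x)=1$; if $a_{xx}\ne 0$ and $p(x)=0$ then $2a_{xy}/a_{xx}\in\mathbb Z_{\le 0}$ for all $y\ne x$; if $a_{xx}\neq 0$ and $p(x)=1$ then $a_{xy}/a_{xx}\in\mathbb Z_{\le 0}$ for all $y\ne x$. For $x$ reflectable at $v$ the reflexion $r_x:v\to v'=(\mathfrak h,a',b',p')$ is defined as follows. Anisotropic case $a_{xx}\ne0$: $p'=p$, $a'(y)=a(y)-2\frac{a_{yx}}{a_{xx}}a(x)$, $b'(y)=b(y)-2\frac{a_{xy}}{a_{xx}}b(x)$.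 Isotropic case $a_{xx}=0$: $(a'(x),b'(x),p'(x))=(-a(x),-b(x),p(x))$; for $y\neq x$ with $a_{xy}=0$, $(a'(y),b'(y),p'(y))=(a(y),b(y),p(y))$; for $y$ with $a_{xy}\ne0$, $(a'(y),b'(y),p'(y))=(a(y)+\frac{a_{yx}}{a_{xy}}a(x),\,b(y)+b(x),\,1+p(y))$. The root groupoid $\mathcal R$ has the root data as objects; its arrows are generated by reflexions, tautological arrows $t_\theta:(\mathfrak h,a,b,p)\to(\mathfrak h',\theta\circ a,(\theta^* )^{-1}\circ b,p)$ for linear isomorphisms $\theta:\mathfrak h\to\mathfrak h'$, and homotheties $h_\lambda:(\mathfrak h,a,b,p)\to(\mathfrak h,\lambda a,b,p)$ for $\lambda:X\to\mathbb C^*$. Each generator induces a linear isomorphism of the spaces $\mathfrak h$ (the identity for reflexions and homotheties, $\theta$ for $t_\theta$), and two compositions of generators $v\to v'$ are identified iff they induce the same isomorphism $\mathfrak h(v)\to\mathfrak h(v')$. A component is a connected component of $\mathcal R$. $\mathrm{Sk}(v)$ denotes the set of objects obtained from $v$ by chains of reflexions. Root algebras. The half-baked Lie superalgebra $\tilde{\mathfrak g}(v)$ is generated by $\mathfrak h(v)$ (even) and $\tilde e_x,\tilde f_x$ ($x\in X$, of parity $p(x)$) with relations $[\mathfrak h,\mathfrak h]=0$, $[h,\tilde e_x]=\langle b(x),h\rangle\tilde e_x$, $[h,\tilde f_x]=-\langle b(x),h\rangle\tilde f_x$, $[\tilde e_x,\tilde f_y]=0$ for $x\ne y$, $[\tilde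 e_x,\tilde f_x]=a(x)$. A root Lie superalgebra supported on a component $\mathcal R_0$ is a collection of quotients $\mathfrak g(v)=\tilde{\mathfrak g}(v)/I(v)$, $v\in\mathcal R_0$, with $I(v)\cap\mathfrak h(v)=0$, such that for each arrow $v\to v'$ in $\mathcal R_0$ the induced isomorphism $\mathfrak h(v)\to\mathfrak h(v')$ extends to an isomorphism $\mathfrak g(v)\to\mathfrak g(v')$. $\mathcal R_0$ is admissible if one exists. In that case $\mathfrak g^{\mathtt C}(v)=\tilde{\mathfrak g}(v)/\mathfrak r(v)$, with $\mathfrak r(v)$ the maximal ideal having zero intersection with $\mathfrak h(v)$. Roots and types. Fix $v\in\mathcal R_0$ and write $\mathfrak g=\mathfrak g(v)$. $\Delta\subset\mathfrak h^*\setminus\{0\}$ is the set of nonzero $\mathfrak h$-weights of $\mathfrak g$; $\Delta^{re}=\{b_u(x):u\in\mathrm{Sk}(v),x\in X\}$; $\Delta^{im}=\{\alpha\in\Delta:\mathbb Q\alpha\cap\Delta^{re}=\emptyset\}$. $\mathcal R_0$ is indecomposable if there is no partition $X=X_1\sqcup X_2$ into nonempty subsets with $a_{xy}=a_{yx}=0$ for $x\in X_1,y\in X_2$; fully reflectable if every $x\in X$ is reflectable at every $v\in\mathcal R_0$; of type (Fin) if $\bigcap_{v'\in\mathrm{Sk}(v)}\sum_x\mathbb Z_{\ge0}b_{v'}(x)=\{0\}$. *)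

theory Defs
  imports Complex_Main "HOL-Library.Z2" "HOL-Library.Nonpos_Ints"
begin

section \<open>Superalgebras, ideals and quotients\<close>

text \<open>
  The data of a complex vector space with a bracket and homogeneous components indexed by
  the two-element field \<^typ>\<open>bit\<close>. Only the elements of \<open>elems\<close> are meaningful.
\<close>

record 'g superalgebra =
  elems :: "'g set"
  zero_el :: 'g
  add_el :: "'g \<Rightarrow> 'g \<Rightarrow> 'g"
  scale_el :: "complex \<Rightarrow> 'g \<Rightarrow> 'g"
  bracket :: "'g \<Rightarrow> 'g \<Rightarrow> 'g"
  homog :: "bit \<Rightarrow> 'g set"

definition lin_subspace :: "'g superalgebra \<Rightarrow> 'g set \<Rightarrow> bool" where
  "lin_subspace L S \<longleftrightarrow>
     S \<subseteq> elems L \<and> zero_el L \<in> S \<and>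
     (\<forall>g\<in>S. \<forall>k\<in>S. add_el L g k \<in> S) \<and>
     (\<forall>c. \<forall>g\<in>S. scale_el L c g \<in> S)"

definition finite_dim :: "'g superalgebra \<Rightarrow> bool" where
  "finite_dim L \<longleftrightarrow>
     (\<exists>B. finite B \<and> B \<subseteq> elems L \<and>
        (\<forall>S. lin_subspace L S \<and> B \<subseteq> S \<longrightarrow> S = elems L))"

definition super_ideal :: "'g superalgebra \<Rightarrow> 'g set \<Rightarrow> bool" where
  "super_ideal L I \<longleftrightarrow>
     lin_subspace L I \<and>
     (\<forall>g\<in>elems L. \<forall>i\<in>I. bracket L g i \<in> I \<and> bracket L i g \<in> I) \<and>
     (\<forall>i\<in>I. \<exists>j\<in>I \<inter> homog L 0. \<exists>k\<in>I \<inter> homog L 1. i = add_el L j k)"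

definition coset :: "'g superalgebra \<Rightarrow> 'g set \<Rightarrow> 'g \<Rightarrow> 'g set" where
  "coset L I g = add_el L g ` I"

definition quotient_alg :: "'g superalgebra \<Rightarrow> 'g set \<Rightarrow> 'g set superalgebra" where
  "quotient_alg L I =
     \<lparr> elems = coset L I ` elems L,
       zero_el = coset L I (zero_el L),
       add_el = (\<lambda>A B. \<Union>g\<in>A. \<Union>k\<in>B. coset L I (add_el L g k)),
       scale_el = (\<lambda>c A. \<Union>g\<in>A. coset L I (scale_el L c g)),
       bracket = (\<lambda>A B. \<Union>g\<in>A. \<Union>k\<in>B. coset L I (bracket L g k)),
       homog = (\<lambda>i. coset L I ` homog L i) \<rparr>"

definition superalgebra_iso ::
    "'g superalgebra \<Rightarrow> 'k superalgebra \<Rightarrow> ('g \<Rightarrow> 'k) \<Rightarrow> bool" where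
  "superalgebra_iso L M \<phi> \<longleftrightarrow>
     bij_betw \<phi> (elems L) (elems M) \<and>
     (\<forall>g\<in>elems L. \<forall>k\<in>elems L. \<phi> (add_el L g k) = add_el M (\<phi> g) (\<phi> k)) \<and>
     (\<forall>c. \<forall>g\<in>elems L. \<phi> (scale_el L c g) = scale_el M c (\<phi> g)) \<and>
     (\<forall>g\<in>elems L. \<forall>k\<in>elems L. \<phi> (bracket L g k) = bracket M (\<phi> g) (\<phi> k)) \<and>
     (\<forall>i. \<phi> ` homog L i = homog M i)"


section \<open>Lie superalgebras given by generators and relations\<close>

datatype (gens: 'g) lie_term =
    Gen 'g
  | Zero
  | Plus "'g lie_term" "'g lie_term"
  | Scale complex "'g lie_term"
  | Brack "'g lie_term" "'g lie_term"

inductive has_parity :: "('g \<Rightarrow> bit) \<Rightarrow> 'g lie_term \<Rightarrow> bit \<Rightarrow> bool" for par where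
  "has_parity par (Gen g) (par g)"
| "has_parity par Zero i"
| "has_parity par t i \<Longrightarrow> has_parity par u i \<Longrightarrow> has_parity par (Plus t u) i"
| "has_parity par t i \<Longrightarrow> has_parity par (Scale c t) i"
| "has_parity par t i \<Longrightarrow> has_parity par u j \<Longrightarrow> has_parity par (Brack t u) (i + j)"

definition koszul_sign :: "bit \<Rightarrow> bit \<Rightarrow> complex" where
  "koszul_sign i j = (if i = 1 \<and> j = 1 then -1 else 1)"

definition lie_terms :: "'g set \<Rightarrow> 'g lie_term set" where
  "lie_terms G = {t. gens t \<subseteq> G}"

text \<open>
  The least congruence on the terms over \<open>G\<close> that contains the relations \<open>Rel\<close> and
  the axioms of a Lie superalgebra (vector space, bilinearity, super skew-symmetry, super
  Jacobi identity), where \<open>par\<close> gives the parities of the generators.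
\<close>

inductive lie_eq ::
    "'g set \<Rightarrow> ('g \<Rightarrow> bit) \<Rightarrow> ('g lie_term \<times> 'g lie_term) set \<Rightarrow>
     'g lie_term \<Rightarrow> 'g lie_term \<Rightarrow> bool"
  for G par Rel where
  relation: "(t, u) \<in> Rel \<Longrightarrow> t \<in> lie_terms G \<Longrightarrow> u \<in> lie_terms G \<Longrightarrow>
     lie_eq G par Rel t u"
| refl: "t \<in> lie_terms G \<Longrightarrow> lie_eq G par Rel t t"
| sym: "lie_eq G par Rel t u \<Longrightarrow> lie_eq G par Rel u t"
| trans: "lie_eq G par Rel t u \<Longrightarrow> lie_eq G par Rel u w \<Longrightarrow> lie_eq G par Rel t w"
| plus_cong: "lie_eq G par Rel t t' \<Longrightarrow> lie_eq G par Rel u u' \<Longrightarrow>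
     lie_eq G par Rel (Plus t u) (Plus t' u')"
| scale_cong: "lie_eq G par Rel t t' \<Longrightarrow>
     lie_eq G par Rel (Scale c t) (Scale c t')"
| brack_cong: "lie_eq G par Rel t t' \<Longrightarrow> lie_eq G par Rel u u' \<Longrightarrow>
     lie_eq G par Rel (Brack t u) (Brack t' u')"
| plus_assoc: "t \<in> lie_terms G \<Longrightarrow> u \<in> lie_terms G \<Longrightarrow> w \<in> lie_terms G \<Longrightarrow>
     lie_eq G par Rel (Plus (Plus t u) w) (Plus t (Plus u w))"
| plus_comm: "t \<in> lie_terms G \<Longrightarrow> u \<in> lie_terms G \<Longrightarrow>
     lie_eq G par Rel (Plus t u) (Plus u t)"
| plus_zero: "t \<in> lie_terms G \<Longrightarrow> lie_eq G par Rel (Plus t Zero) t"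
| plus_inverse: "t \<in> lie_terms G \<Longrightarrow>
     lie_eq G par Rel (Plus t (Scale (-1) t)) Zero"
| scale_plus: "t \<in> lie_terms G \<Longrightarrow> u \<in> lie_terms G \<Longrightarrow>
     lie_eq G par Rel (Scale c (Plus t u)) (Plus (Scale c t) (Scale c u))"
| scale_add: "t \<in> lie_terms G \<Longrightarrow>
     lie_eq G par Rel (Scale (c + d) t) (Plus (Scale c t) (Scale d t))"
| scale_scale: "t \<in> lie_terms G \<Longrightarrow>
     lie_eq G par Rel (Scale c (Scale d t)) (Scale (c * d) t)"
| scale_one: "t \<in> lie_terms G \<Longrightarrow> lie_eq G par Rel (Scale 1 t) t"
| brack_plus_left: "t \<in> lie_terms G \<Longrightarrow> u \<in> lie_terms G \<Longrightarrow> w \<in> lie_terms G \<Longrightarrow>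
     lie_eq G par Rel (Brack (Plus t u) w) (Plus (Brack t w) (Brack u w))"
| brack_plus_right: "t \<in> lie_terms G \<Longrightarrow> u \<in> lie_terms G \<Longrightarrow> w \<in> lie_terms G \<Longrightarrow>
     lie_eq G par Rel (Brack t (Plus u w)) (Plus (Brack t u) (Brack t w))"
| brack_scale_left: "t \<in> lie_terms G \<Longrightarrow> u \<in> lie_terms G \<Longrightarrow>
     lie_eq G par Rel (Brack (Scale c t) u) (Scale c (Brack t u))"
| brack_scale_right: "t \<in> lie_terms G \<Longrightarrow> u \<in> lie_terms G \<Longrightarrow>
     lie_eq G par Rel (Brack t (Scale c u)) (Scale c (Brack t u))"
| skew: "t \<in> lie_terms G \<Longrightarrow> u \<in> lie_terms G \<Longrightarrow>
     has_parity par t i \<Longrightarrow> has_parity par u j \<Longrightarrow>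
     lie_eq G par Rel (Brack t u) (Scale (- koszul_sign i j) (Brack u t))"
| jacobi: "t \<in> lie_terms G \<Longrightarrow> u \<in> lie_terms G \<Longrightarrow> w \<in> lie_terms G \<Longrightarrow>
     has_parity par t i \<Longrightarrow> has_parity par u j \<Longrightarrow> has_parity par w k \<Longrightarrow>
     lie_eq G par Rel (Brack t (Brack u w))
       (Plus (Brack (Brack t u) w) (Scale (koszul_sign i j) (Brack u (Brack t w))))"

definition lie_class ::
    "'g set \<Rightarrow> ('g \<Rightarrow> bit) \<Rightarrow> ('g lie_term \<times> 'g lie_term) set \<Rightarrow>
     'g lie_term \<Rightarrow> 'g lie_term set" where
  "lie_class G par Rel t = {u. lie_eq G par Rel t u}"

definition presented_alg ::
    "'g set \<Rightarrow> ('g \<Rightarrow> bit) \<Rightarrow> ('g lie_term \<times> 'g lie_term) set \<Rightarrow>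
     'g lie_term set superalgebra" where
  "presented_alg G par Rel =
     \<lparr> elems = lie_class G par Rel ` lie_terms G,
       zero_el = lie_class G par Rel Zero,
       add_el = (\<lambda>A B. \<Union>t\<in>A. \<Union>u\<in>B. lie_class G par Rel (Plus t u)),
       scale_el = (\<lambda>c A. \<Union>t\<in>A. lie_class G par Rel (Scale c t)),
       bracket = (\<lambda>A B. \<Union>t\<in>A. \<Union>u\<in>B. lie_class G par Rel (Brack t u)),
       homog = (\<lambda>i. lie_class G par Rel ` {t \<in> lie_terms G. has_parity par t i}) \<rparr>"


section \<open>Root data and the root groupoid\<close>

text \<open>
  The spaces \<open>h(v)\<close> range over the finite-dimensional subspaces of an arbitrary complex
  vector space \<open>'u\<close> with scalar multiplication \<open>s\<close>. The functions \<open>a\<close>, \<open>b\<close>, \<open>p\<close> on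
  \<open>X\<close> are extended by zero to the whole type, and so is a functional on a subspace;
  reflexions, tautological arrows and homotheties respect these conventions, so that equality
  of records is equality of root data.
\<close>

record ('u, 'x) root_datum =
  cartan :: "'u set"
  coroot_of :: "'x \<Rightarrow> 'u"
  root_of :: "'x \<Rightarrow> 'u \<Rightarrow> complex"
  parity_of :: "'x \<Rightarrow> bit"

definition dual_space ::
    "(complex \<Rightarrow> 'u::ab_group_add \<Rightarrow> 'u) \<Rightarrow> 'u set \<Rightarrow> ('u \<Rightarrow> complex) set" where
  "dual_space s H =
     {f. (\<forall>h\<in>H. \<forall>k\<in>H. f (h + k) = f h + f k) \<and>
         (\<forall>c. \<forall>h\<in>H. f (s c h) = c * f h) \<and>
         (\<forall>h. h \<notin> H \<longrightarrow> f h = 0)}"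

definition linear_iso ::
    "(complex \<Rightarrow> 'u::ab_group_add \<Rightarrow> 'u) \<Rightarrow> 'u set \<Rightarrow> 'u set \<Rightarrow> ('u \<Rightarrow> 'u) \<Rightarrow> bool" where
  "linear_iso s H H' \<theta> \<longleftrightarrow>
     bij_betw \<theta> H H' \<and>
     (\<forall>h\<in>H. \<forall>k\<in>H. \<theta> (h + k) = \<theta> h + \<theta> k) \<and>
     (\<forall>c. \<forall>h\<in>H. \<theta> (s c h) = s c (\<theta> h))"

definition is_root_datum ::
    "(complex \<Rightarrow> 'u::ab_group_add \<Rightarrow> 'u) \<Rightarrow> 'x set \<Rightarrow> ('u, 'x) root_datum \<Rightarrow> bool" where
  "is_root_datum s X v \<longleftrightarrow>
     (\<exists>B. finite B \<and> cartan v = module.span s B) \<and>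
     (\<forall>x\<in>X. coroot_of v x \<in> cartan v) \<and>
     (\<forall>x\<in>X. root_of v x \<in> dual_space s (cartan v)) \<and>
     (\<forall>c. (\<Sum>x\<in>X. s (c x) (coroot_of v x)) = 0 \<longrightarrow> (\<forall>x\<in>X. c x = 0)) \<and>
     (\<forall>c. (\<forall>h\<in>cartan v. (\<Sum>x\<in>X. c x * root_of v x h) = 0) \<longrightarrow> (\<forall>x\<in>X. c x = 0)) \<and>
     (\<forall>x. x \<notin> X \<longrightarrow> coroot_of v x = 0 \<and> root_of v x = (\<lambda>_. 0) \<and> parity_of v x = 0)"

definition cartan_matrix :: "('u, 'x) root_datum \<Rightarrow> 'x \<Rightarrow> 'x \<Rightarrow> complex" where
  "cartan_matrix v x y = root_of v y (coroot_of v x)"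

definition reflectable :: "'x set \<Rightarrow> ('u, 'x) root_datum \<Rightarrow> 'x \<Rightarrow> bool" where
  "reflectable X v x \<longleftrightarrow>
     (let A = cartan_matrix v in
       (A x x = 0 \<longrightarrow> parity_of v x = 1) \<and>
       (A x x \<noteq> 0 \<and> parity_of v x = 0 \<longrightarrow>
          (\<forall>y\<in>X. y \<noteq> x \<longrightarrow> 2 * A x y / A x x \<in> \<int>\<^sub>\<le>\<^sub>0)) \<and>
       (A x x \<noteq> 0 \<and> parity_of v x = 1 \<longrightarrow>
          (\<forall>y\<in>X. y \<noteq> x \<longrightarrow> A x y / A x x \<in> \<int>\<^sub>\<le>\<^sub>0)))"

definition reflexion ::
    "(complex \<Rightarrow> 'u::ab_group_add \<Rightarrow> 'u) \<Rightarrow> ('u, 'x) root_datum \<Rightarrow> 'x \<Rightarrow>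
     ('u, 'x) root_datum" where
  "reflexion s v x =
     (let A = cartan_matrix v; a = coroot_of v; b = root_of v; p = parity_of v in
      if A x x \<noteq> 0 then
        \<lparr> cartan = cartan v,
          coroot_of = (\<lambda>y. a y - s (2 * A y x / A x x) (a x)),
          root_of = (\<lambda>y h. b y h - 2 * A x y / A x x * b x h),
          parity_of = p \<rparr>
      else
        \<lparr> cartan = cartan v,
          coroot_of = (\<lambda>y. if y = x then - a x
                           else if A x y = 0 then a y
                           else a y + s (A y x / A x y) (a x)),
          root_of = (\<lambda>y h. if y = x then - b x h
                           else if A x y = 0 then b y h
                           else b y h + b x h),
          parity_of = (\<lambda>y. if y = x then p x
                           else if A x y = 0 then p y
                           else 1 + p y) \<rparr>)"

definition tautological ::
    "('u \<Rightarrow> 'u) \<Rightarrow> 'u set \<Rightarrow> ('u, 'x) root_datum \<Rightarrow> ('u, 'x) root_datum" where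
  "tautological \<theta> H' v =
     \<lparr> cartan = H',
       coroot_of = \<theta> \<circ> coroot_of v,
       root_of = (\<lambda>x h. if h \<in> H' then root_of v x (inv_into (cartan v) \<theta> h) else 0),
       parity_of = parity_of v \<rparr>"

definition homothety ::
    "(complex \<Rightarrow> 'u \<Rightarrow> 'u) \<Rightarrow> ('x \<Rightarrow> complex) \<Rightarrow> ('u, 'x) root_datum \<Rightarrow>
     ('u, 'x) root_datum" where
  "homothety s l v = v\<lparr>coroot_of := (\<lambda>x. s (l x) (coroot_of v x))\<rparr>"

text \<open>
  An arrow is determined by its source, its target and the isomorphism \<open>\<theta>\<close> of Cartan spaces
  it induces; the values of \<open>\<theta>\<close> outside \<open>cartan v\<close> are irrelevant. The inverse of a
  generator is again a generator, so composition suffices.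
\<close>

inductive arrow ::
    "(complex \<Rightarrow> 'u::ab_group_add \<Rightarrow> 'u) \<Rightarrow> 'x set \<Rightarrow>
     ('u, 'x) root_datum \<Rightarrow> ('u \<Rightarrow> 'u) \<Rightarrow> ('u, 'x) root_datum \<Rightarrow> bool"
  for s X where
  reflexion: "is_root_datum s X v \<Longrightarrow> x \<in> X \<Longrightarrow> reflectable X v x \<Longrightarrow>
     arrow s X v id (reflexion s v x)"
| tautological: "is_root_datum s X v \<Longrightarrow> linear_iso s (cartan v) H' \<theta> \<Longrightarrow>
     arrow s X v \<theta> (tautological \<theta> H' v)"
| homothety: "is_root_datum s X v \<Longrightarrow> (\<And>x. x \<in> X \<Longrightarrow> l x \<noteq> 0) \<Longrightarrow>
     arrow s X v id (homothety s l v)"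
| compose: "arrow s X v \<theta> v' \<Longrightarrow> arrow s X v' \<theta>' v'' \<Longrightarrow> arrow s X v (\<theta>' \<circ> \<theta>) v''"

definition is_component ::
    "(complex \<Rightarrow> 'u::ab_group_add \<Rightarrow> 'u) \<Rightarrow> 'x set \<Rightarrow> ('u, 'x) root_datum set \<Rightarrow> bool" where
  "is_component s X R \<longleftrightarrow> (\<exists>v. is_root_datum s X v \<and> R = {v'. \<exists>\<theta>. arrow s X v \<theta> v'})"

inductive_set skeleton ::
    "(complex \<Rightarrow> 'u::ab_group_add \<Rightarrow> 'u) \<Rightarrow> 'x set \<Rightarrow> ('u, 'x) root_datum \<Rightarrow>
     ('u, 'x) root_datum set"
  for s X v where
  "v \<in> skeleton s X v"
| "u \<in> skeleton s X v \<Longrightarrow> x \<in> X \<Longrightarrow> reflectable X u x \<Longrightarrow>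
     reflexion s u x \<in> skeleton s X v"

definition indecomposable :: "'x set \<Rightarrow> ('u, 'x) root_datum \<Rightarrow> bool" where
  "indecomposable X v \<longleftrightarrow>
     \<not> (\<exists>X1 X2. X1 \<union> X2 = X \<and> X1 \<inter> X2 = {} \<and> X1 \<noteq> {} \<and> X2 \<noteq> {} \<and>
          (\<forall>x\<in>X1. \<forall>y\<in>X2. cartan_matrix v x y = 0 \<and> cartan_matrix v y x = 0))"

definition fully_reflectable :: "'x set \<Rightarrow> ('u, 'x) root_datum set \<Rightarrow> bool" where
  "fully_reflectable X R \<longleftrightarrow> (\<forall>v\<in>R. \<forall>x\<in>X. reflectable X v x)"

definition positive_cone :: "'x set \<Rightarrow> ('u, 'x) root_datum \<Rightarrow> ('u \<Rightarrow> complex) set" where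
  "positive_cone X v = {(\<lambda>h. \<Sum>x\<in>X. of_nat (n x) * root_of v x h) | n :: 'x \<Rightarrow> nat. True}"

definition type_Fin ::
    "(complex \<Rightarrow> 'u::ab_group_add \<Rightarrow> 'u) \<Rightarrow> 'x set \<Rightarrow> ('u, 'x) root_datum \<Rightarrow> bool" where
  "type_Fin s X v \<longleftrightarrow> (\<Inter>u\<in>skeleton s X v. positive_cone X u) = {\<lambda>_. 0}"


section \<open>Root Lie superalgebras\<close>

datatype ('u, 'x) generator = H 'u | E 'x | F 'x

fun generator_parity :: "('u, 'x) root_datum \<Rightarrow> ('u, 'x) generator \<Rightarrow> bit" where
  "generator_parity v (H h) = 0"
| "generator_parity v (E x) = parity_of v x"
| "generator_parity v (F x) = parity_of v x"

definition generators :: "'x set \<Rightarrow> ('u, 'x) root_datum \<Rightarrow> ('u, 'x) generator set" where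
  "generators X v = H ` cartan v \<union> E ` X \<union> F ` X"

text \<open>The first two families say that \<open>h(v)\<close> is included as a vector space.\<close>

definition relations ::
    "(complex \<Rightarrow> 'u::ab_group_add \<Rightarrow> 'u) \<Rightarrow> 'x set \<Rightarrow> ('u, 'x) root_datum \<Rightarrow>
     (('u, 'x) generator lie_term \<times> ('u, 'x) generator lie_term) set" where
  "relations s X v =
     {(Gen (H (h + k)), Plus (Gen (H h)) (Gen (H k))) | h k. h \<in> cartan v \<and> k \<in> cartan v} \<union>
     {(Gen (H (s c h)), Scale c (Gen (H h))) | c h. h \<in> cartan v} \<union>
     {(Brack (Gen (H h)) (Gen (H k)), Zero) | h k. h \<in> cartan v \<and> k \<in> cartan v} \<union>
     {(Brack (Gen (H h)) (Gen (E x)), Scale (root_of v x h) (Gen (E x))) | h x.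
        h \<in> cartan v \<and> x \<in> X} \<union>
     {(Brack (Gen (H h)) (Gen (F x)), Scale (- root_of v x h) (Gen (F x))) | h x.
        h \<in> cartan v \<and> x \<in> X} \<union>
     {(Brack (Gen (E x)) (Gen (F y)), Zero) | x y. x \<in> X \<and> y \<in> X \<and> x \<noteq> y} \<union>
     {(Brack (Gen (E x)) (Gen (F x)), Gen (H (coroot_of v x))) | x. x \<in> X}"

type_synonym ('u, 'x) half_baked_el = "('u, 'x) generator lie_term set"

definition half_baked ::
    "(complex \<Rightarrow> 'u::ab_group_add \<Rightarrow> 'u) \<Rightarrow> 'x set \<Rightarrow> ('u, 'x) root_datum \<Rightarrow>
     ('u, 'x) half_baked_el superalgebra" where
  "half_baked s X v = presented_alg (generators X v) (generator_parity v) (relations s X v)"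

definition half_baked_cartan ::
    "(complex \<Rightarrow> 'u::ab_group_add \<Rightarrow> 'u) \<Rightarrow> 'x set \<Rightarrow> ('u, 'x) root_datum \<Rightarrow>
     'u \<Rightarrow> ('u, 'x) half_baked_el" where
  "half_baked_cartan s X v h =
     lie_class (generators X v) (generator_parity v) (relations s X v) (Gen (H h))"

definition cartan_free_ideal ::
    "(complex \<Rightarrow> 'u::ab_group_add \<Rightarrow> 'u) \<Rightarrow> 'x set \<Rightarrow> ('u, 'x) root_datum \<Rightarrow>
     ('u, 'x) half_baked_el set \<Rightarrow> bool" where
  "cartan_free_ideal s X v J \<longleftrightarrow>
     super_ideal (half_baked s X v) J \<and>
     J \<inter> half_baked_cartan s X v ` cartan v = {zero_el (half_baked s X v)}"

text \<open>In what follows \<open>J\<close> is an ideal of \<open>half_baked s X v\<close>, the algebra is the quotient by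
  it, and \<open>cartan_embedding\<close> is the map from \<open>h(v)\<close> to this quotient.\<close>

definition root_algebra ::
    "(complex \<Rightarrow> 'u::ab_group_add \<Rightarrow> 'u) \<Rightarrow> 'x set \<Rightarrow> ('u, 'x) root_datum \<Rightarrow>
     ('u, 'x) half_baked_el set \<Rightarrow> ('u, 'x) half_baked_el set superalgebra" where
  "root_algebra s X v J = quotient_alg (half_baked s X v) J"

definition cartan_embedding ::
    "(complex \<Rightarrow> 'u::ab_group_add \<Rightarrow> 'u) \<Rightarrow> 'x set \<Rightarrow> ('u, 'x) root_datum \<Rightarrow>
     ('u, 'x) half_baked_el set \<Rightarrow> 'u \<Rightarrow> ('u, 'x) half_baked_el set" where
  "cartan_embedding s X v J h = coset (half_baked s X v) J (half_baked_cartan s X v h)"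

definition root_lie_superalgebra ::
    "(complex \<Rightarrow> 'u::ab_group_add \<Rightarrow> 'u) \<Rightarrow> 'x set \<Rightarrow> ('u, 'x) root_datum set \<Rightarrow>
     (('u, 'x) root_datum \<Rightarrow> ('u, 'x) half_baked_el set) \<Rightarrow> bool" where
  "root_lie_superalgebra s X R I \<longleftrightarrow>
     (\<forall>v\<in>R. cartan_free_ideal s X v (I v)) \<and>
     (\<forall>v\<in>R. \<forall>v'\<in>R. \<forall>\<theta>. arrow s X v \<theta> v' \<longrightarrow>
        (\<exists>\<phi>. superalgebra_iso (root_algebra s X v (I v)) (root_algebra s X v' (I v')) \<phi> \<and>
             (\<forall>h\<in>cartan v.
                \<phi> (cartan_embedding s X v (I v) h) = cartan_embedding s X v' (I v') (\<theta> h))))"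

definition admissible ::
    "(complex \<Rightarrow> 'u::ab_group_add \<Rightarrow> 'u) \<Rightarrow> 'x set \<Rightarrow> ('u, 'x) root_datum set \<Rightarrow> bool" where
  "admissible s X R \<longleftrightarrow> (\<exists>I. root_lie_superalgebra s X R I)"

definition max_ideal ::
    "(complex \<Rightarrow> 'u::ab_group_add \<Rightarrow> 'u) \<Rightarrow> 'x set \<Rightarrow> ('u, 'x) root_datum \<Rightarrow>
     ('u, 'x) half_baked_el set" where
  "max_ideal s X v = (GREATEST J. cartan_free_ideal s X v J)"

definition contragredient_algebra ::
    "(complex \<Rightarrow> 'u::ab_group_add \<Rightarrow> 'u) \<Rightarrow> 'x set \<Rightarrow> ('u, 'x) root_datum \<Rightarrow>
     ('u, 'x) half_baked_el set superalgebra" where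
  "contragredient_algebra s X v = quotient_alg (half_baked s X v) (max_ideal s X v)"

definition roots ::
    "(complex \<Rightarrow> 'u::ab_group_add \<Rightarrow> 'u) \<Rightarrow> 'x set \<Rightarrow> ('u, 'x) root_datum \<Rightarrow>
     ('u, 'x) half_baked_el set \<Rightarrow> ('u \<Rightarrow> complex) set" where
  "roots s X v J =
     (let L = root_algebra s X v J in
      {\<alpha> \<in> dual_space s (cartan v). \<alpha> \<noteq> (\<lambda>_. 0) \<and>
         (\<exists>g\<in>elems L. g \<noteq> zero_el L \<and>
            (\<forall>h\<in>cartan v.
               bracket L (cartan_embedding s X v J h) g = scale_el L (\<alpha> h) g))})"

definition real_roots ::
    "(complex \<Rightarrow> 'u::ab_group_add \<Rightarrow> 'u) \<Rightarrow> 'x set \<Rightarrow> ('u, 'x) root_datum \<Rightarrow>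
     ('u \<Rightarrow> complex) set" where
  "real_roots s X v = {root_of u x | u x. u \<in> skeleton s X v \<and> x \<in> X}"

definition imaginary_roots ::
    "(complex \<Rightarrow> 'u::ab_group_add \<Rightarrow> 'u) \<Rightarrow> 'x set \<Rightarrow> ('u, 'x) root_datum \<Rightarrow>
     ('u, 'x) half_baked_el set \<Rightarrow> ('u \<Rightarrow> complex) set" where
  "imaginary_roots s X v J =
     {\<alpha> \<in> roots s X v J. {(\<lambda>h. of_rat q * \<alpha> h) | q :: rat. True} \<inter> real_roots s X v = {}}"

end

theory Submission
  imports Defs "HOL-Library.Function_Algebras" "HOL-Library.FuncSet"
begin

text \<open>
  Every root in \<open>\<Delta>\<close> is positive or negative for every
  base \<open>(b\<^sub>u(x))\<^sub>x\<close> with \<open>u\<close> in the skeleton, and two adjacent bases separate only the multiples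
  \<open>b\<^sub>u(x), 2 b\<^sub>u(x)\<close> of one simple root. In type (Fin) a nonzero root cannot be positive for all bases, so on
  some chain of reflexions it changes its sign and is such a multiple; hence there are no imaginary roots.
  The anisotropic reflections permute the bases. A pair of them generating an infinite dihedral
  group would produce a vector positive for all bases, so the products of the two pairings are at most 3 and there
  are finitely many anisotropic roots. Averaging over the Weyl group then reduces the intersection of the positive
  cones over the skeleton to an intersection over finitely many chambers; as two chambers separate finitely many
  roots, \<open>\<Delta>\<close> is finite, and since weight spaces are spanned by iterated brackets, \<open>g\<close> is finite-dimensional.
  Finally, an ideal of \<open>g\<close> that meets the Cartan subspace trivially is spanned by root vectors. Each
  root space is spanned by \<open>e\<^sub>x\<close> or \<open>[e\<^sub>x, e\<^sub>x]\<close> at some \<open>u\<close>; the former cannot lie in the ideal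
  because \<open>[e\<^sub>x, f\<^sub>x] = a(x) \<noteq> 0\<close>, and the latter either generates \<open>e\<^sub>x\<close> or vanishes, unless
  \<open>g = gl(1|1)\<close>.
\<close>

section \<open>Reflexions of root data\<close>

text \<open>Type (Fin) intersects possibly infinitely many cones: each root is excluded from some of
  them, but nothing bounds these chambers a priori. Averaging provides finitely many because
  indecomposability makes the image of the averaging map cyclic: it kills anisotropic roots and
  agrees up to sign, or vanishes, on isotropic simple roots, so every average is an integer multiple
  of one \<open>\<delta>\<close>, and two chambers control both signs of \<open>\<delta>\<close>. No
  invariant form is used. Symmetric zeros of the Cartan matrix, uniqueness of coroots and the bounds
  on pairings are all drawn from the fact that no root has coordinates of mixed sign. The
  combinatorial half therefore works with an abstract set \<open>\<Phi>\<close> having this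
  property. In the algebraic half, different data of a skeleton have different presentations.
  Everything is pulled back to one free Lie superalgebra, where the algebra at \<open>v\<close> is
  the quotient by an ideal \<open>N\<close> and the generators at \<open>u\<close> are merely other
  elements. That the Cartan subspace embeds into the half-baked algebra is not part of the
  definitions; a Verma module proves it.\<close>

text \<open>The isotropic and the anisotropic reflexion at \<open>x\<close> both add a multiple of the coroot of \<open>x\<close> to
  every coroot and a multiple of the root of \<open>x\<close> to every root, which allows uniform proofs.\<close>

definition coroot_coeff :: "('u, 'x) root_datum \<Rightarrow> 'x \<Rightarrow> 'x \<Rightarrow> complex" where
  "coroot_coeff u x y =
     (let A = cartan_matrix u in
      if y = x then -2 else if A x x \<noteq> 0 then - 2 * A y x / A x x
      else if A x y = 0 then 0 else A y x / A x y)"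

definition root_coeff :: "('u, 'x) root_datum \<Rightarrow> 'x \<Rightarrow> 'x \<Rightarrow> complex" where
  "root_coeff u x y =
     (let A = cartan_matrix u in
      if y = x then -2 else if A x x \<noteq> 0 then - 2 * A x y / A x x
      else if A x y = 0 then 0 else 1)"

lemma root_datum_ext:
  assumes "cartan u = cartan w" "coroot_of u = coroot_of w" "root_of u = root_of w"
    "parity_of u = parity_of w"
  shows "(u :: ('u, 'x) root_datum) = w"
  using assms by (cases u, cases w) auto

context
  fixes s :: "complex \<Rightarrow> 'u::ab_group_add \<Rightarrow> 'u"
  assumes vs: "vector_space s"
begin

interpretation vector_space s by (rule vs)

lemma coroot_of_reflexion:
  "coroot_of (reflexion s u x) y = coroot_of u y + s (coroot_coeff u x y) (coroot_of u x)"
proof -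
  have "- c = c + s (- 2) c" for c
    using scale_left_distrib[of 1 "-2" c] by simp
  then show ?thesis
    by (auto simp: reflexion_def coroot_coeff_def Let_def scale_minus_left)
qed

lemma root_of_reflexion:
  "root_of (reflexion s u x) y h = root_of u y h + root_coeff u x y * root_of u x h"
  by (auto simp: reflexion_def root_coeff_def Let_def)

lemma cartan_reflexion [simp]: "cartan (reflexion s u x) = cartan u"
  by (simp add: reflexion_def Let_def)

lemma parity_of_reflexion:
  "parity_of (reflexion s u x) y =
     (if cartan_matrix u x x \<noteq> 0 \<or> y = x \<or> cartan_matrix u x y = 0 then parity_of u y
      else 1 + parity_of u y)"
  by (auto simp: reflexion_def Let_def)

lemma cartan_subspace: "is_root_datum s X u \<Longrightarrow> subspace (cartan u)"
  by (auto simp: is_root_datum_def)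

lemma coroot_in_cartan: "is_root_datum s X u \<Longrightarrow> coroot_of u x \<in> cartan u"
  using cartan_subspace[of X u] subspace_0 by (cases "x \<in> X") (auto simp: is_root_datum_def)

lemma root_in_dual: "is_root_datum s X u \<Longrightarrow> root_of u x \<in> dual_space s (cartan u)"
  by (cases "x \<in> X") (auto simp: is_root_datum_def dual_space_def)

lemma coroots_independent:
  assumes "is_root_datum s X u" "(\<Sum>x\<in>X. s (c x) (coroot_of u x)) = 0" "x \<in> X"
  shows "c x = 0"
proof -
  have "\<forall>c. (\<Sum>x\<in>X. s (c x) (coroot_of u x)) = 0 \<longrightarrow> (\<forall>x\<in>X. c x = 0)"
    using assms(1) by (simp add: is_root_datum_def)
  from this[rule_format, OF assms(2,3)] show ?thesis .
qed

lemma roots_independent: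
  assumes "is_root_datum s X u" "\<And>h. h \<in> cartan u \<Longrightarrow> (\<Sum>x\<in>X. c x * root_of u x h) = 0" "x \<in> X"
  shows "c x = 0"
proof -
  have "\<forall>c. (\<forall>h\<in>cartan u. (\<Sum>x\<in>X. c x * root_of u x h) = 0) \<longrightarrow> (\<forall>x\<in>X. c x = 0)"
    using assms(1) by (simp add: is_root_datum_def)
  with assms(2,3) show ?thesis by blast
qed

lemma dual_space_add: "f \<in> dual_space s C \<Longrightarrow> h \<in> C \<Longrightarrow> k \<in> C \<Longrightarrow> f (h + k) = f h + f k"
  and dual_space_scale: "f \<in> dual_space s C \<Longrightarrow> h \<in> C \<Longrightarrow> f (s c h) = c * f h"
  and dual_space_outside: "f \<in> dual_space s C \<Longrightarrow> h \<notin> C \<Longrightarrow> f h = 0"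
  by (auto simp: dual_space_def)

lemma cartan_matrix_reflexion:
  assumes "is_root_datum s X u"
  shows "cartan_matrix (reflexion s u x) y z =
    cartan_matrix u y z + root_coeff u x z * cartan_matrix u y x
    + coroot_coeff u x y * (cartan_matrix u x z + root_coeff u x z * cartan_matrix u x x)"
proof -
  note c = coroot_in_cartan[OF assms] and sub = subspace_scale[OF cartan_subspace[OF assms]]
  have "root_of u z (coroot_of u y + s k (coroot_of u x)) = cartan_matrix u y z + k * cartan_matrix u x z" for z k
    using root_in_dual[OF assms, of z] c sub
    by (simp add: dual_space_add dual_space_scale cartan_matrix_def)
  then show ?thesis
    by (simp add: cartan_matrix_def coroot_of_reflexion root_of_reflexion algebra_simps)
qed

lemma coeff_self [simp]: "root_coeff u x x = -2" "coroot_coeff u x x = -2"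
  by (simp_all add: root_coeff_def coroot_coeff_def)

lemma coeff_outside:
  assumes "is_root_datum s X u" "y \<notin> X" "x \<in> X"
  shows "root_coeff u x y = 0" "coroot_coeff u x y = 0"
proof -
  have "cartan_matrix u x y = 0" using assms by (simp add: cartan_matrix_def is_root_datum_def)
  moreover have "cartan_matrix u y x = 0"
  proof -
    have "root_of u x (s 0 0) = 0"
      using root_in_dual[OF assms(1), of x] subspace_0[OF cartan_subspace[OF assms(1)]]
      by (subst dual_space_scale) auto
    then show ?thesis using assms by (auto simp: cartan_matrix_def is_root_datum_def)
  qed
  moreover have "y \<noteq> x" using assms by auto
  ultimately show "root_coeff u x y = 0" "coroot_coeff u x y = 0"
    by (simp_all add: root_coeff_def coroot_coeff_def Let_def)
qed

text \<open>Off the diagonal, row and column \<open>x\<close> of the Cartan matrix are kept in the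
  anisotropic case and negated in the isotropic one. The coefficients are ratios, or depend only on
  the vanishing of an entry, and do not notice this. Hence a reflexion is an involution.\<close>

lemma coeff_reflexion:
  assumes "is_root_datum s X u"
  shows "root_coeff (reflexion s u x) x y = root_coeff u x y"
    and "coroot_coeff (reflexion s u x) x y = coroot_coeff u x y"
proof -
  let ?A = "cartan_matrix u" and ?B = "cartan_matrix (reflexion s u x)"
  have xx: "?B x x = ?A x x"
    unfolding cartan_matrix_reflexion[OF assms] coeff_self by (simp add: algebra_simps)
  have xy: "?B x y = - ?A x y - root_coeff u x y * ?A x x"
    unfolding cartan_matrix_reflexion[OF assms] coeff_self by (simp add: algebra_simps)
  have yx: "?B y x = - ?A y x - coroot_coeff u x y * ?A x x"
    unfolding cartan_matrix_reflexion[OF assms] coeff_self by (simp add: algebra_simps)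
  consider "y = x" | "y \<noteq> x" "?A x x \<noteq> 0" | "y \<noteq> x" "?A x x = 0" by blast
  then have "root_coeff (reflexion s u x) x y = root_coeff u x y \<and>
    coroot_coeff (reflexion s u x) x y = coroot_coeff u x y"
  proof cases
    case 2
    then have "?A x x * root_coeff u x y = - 2 * ?A x y" "?A x x * coroot_coeff u x y = - 2 * ?A y x"
      by (simp_all add: root_coeff_def coroot_coeff_def Let_def)
    then have "?B x y = ?A x y" "?B y x = ?A y x" using xy yx by (simp_all add: mult.commute)
    then show ?thesis using 2 xx by (simp add: root_coeff_def coroot_coeff_def Let_def)
  next
    case 3
    then have "?B x y = - ?A x y" "?B y x = - ?A y x" using xy yx by auto
    then show ?thesis using xx 3 by (auto simp: root_coeff_def coroot_coeff_def Let_def)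
  qed simp
  then show "root_coeff (reflexion s u x) x y = root_coeff u x y"
    and "coroot_coeff (reflexion s u x) x y = coroot_coeff u x y" by auto
qed

lemma reflexion_reflexion:
  assumes "is_root_datum s X u"
  shows "reflexion s (reflexion s u x) x = u"
proof (rule root_datum_ext)
  let ?w = "reflexion s u x"
  show "coroot_of (reflexion s ?w x) = coroot_of u"
  proof
    fix y
    have "coroot_of ?w x = - coroot_of u x"
      using scale_left_distrib[of 1 "-2" "coroot_of u x"] by (simp add: coroot_of_reflexion)
    then show "coroot_of (reflexion s ?w x) y = coroot_of u y"
      by (simp add: coroot_of_reflexion[of ?w] coeff_reflexion[OF assms] coroot_of_reflexion[of u x y])
  qed
  show "root_of (reflexion s ?w x) = root_of u"
    by (intro ext) (simp add: root_of_reflexion coeff_reflexion[OF assms] algebra_simps)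
  show "parity_of (reflexion s ?w x) = parity_of u"
  proof
    fix y
    have xx: "cartan_matrix ?w x x = cartan_matrix u x x"
      unfolding cartan_matrix_reflexion[OF assms] coeff_self by (simp add: algebra_simps)
    have "cartan_matrix u x x = 0 \<Longrightarrow> cartan_matrix ?w x y = - cartan_matrix u x y"
      unfolding cartan_matrix_reflexion[OF assms] coeff_self by (simp add: algebra_simps)
    then show "parity_of (reflexion s ?w x) y = parity_of u y"
      using xx by (auto simp: parity_of_reflexion simp flip: add.assoc)
  qed
qed simp

section \<open>Root data are preserved along arrows\<close>

lemma is_root_datum_reflexion:
  assumes u: "is_root_datum s X u" and x: "x \<in> X" and fin: "finite X"
  shows "is_root_datum s X (reflexion s u x)"
proof -
  note sub = cartan_subspace[OF u] and c = coroot_in_cartan[OF u] and d = root_in_dual[OF u]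
  let ?w = "reflexion s u x"
  \<comment> \<open>Both independence claims reduce to this: the change of coordinates is the
    identity except at \<open>x\<close>, where its diagonal factor is 1 + \<open>k x\<close> =
    -1.\<close>
  have key: "\<forall>y\<in>X. g y = 0"
    if k: "k x = -2" and g0: "\<forall>y\<in>X. g y + (if y = x then (\<Sum>z\<in>X. g z * k z) else 0) = 0"
    for g k :: "_ \<Rightarrow> complex"
  proof -
    have g: "y \<in> X \<Longrightarrow> y \<noteq> x \<Longrightarrow> g y = 0" for y using g0 by auto
    have "(\<Sum>z\<in>X. g z * k z) = g x * k x"
      using g x fin by (subst sum.remove[of _ x]) (auto intro!: sum.neutral)
    then have "g x = 0" using g0[rule_format, OF x] k by simp
    with g show ?thesis by auto
  qed
  have a: "\<forall>y\<in>X. g y = 0" if g: "(\<Sum>y\<in>X. s (g y) (coroot_of ?w y)) = 0" for g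
  proof -
    let ?K = "\<Sum>z\<in>X. g z * coroot_coeff u x z"
    have "(\<Sum>y\<in>X. s (g y) (coroot_of ?w y)) =
        (\<Sum>y\<in>X. s (g y) (coroot_of u y)) + s ?K (coroot_of u x)"
      by (simp add: coroot_of_reflexion scale_right_distrib sum.distrib scale_sum_left)
    also have "s ?K (coroot_of u x) = (\<Sum>y\<in>X. s (if y = x then ?K else 0) (coroot_of u y))"
      using fin x by (simp add: if_distrib[of "\<lambda>k. s k _"] sum.delta cong: if_cong)
    finally have "(\<Sum>y\<in>X. s (g y + (if y = x then ?K else 0)) (coroot_of u y)) = 0"
      using g by (simp add: scale_left_distrib sum.distrib)
    then have "\<forall>y\<in>X. g y + (if y = x then ?K else 0) = 0"
      using coroots_independent[OF u, of "\<lambda>y. g y + (if y = x then ?K else 0)"] by blast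
    then show ?thesis by (rule key[rotated]) simp
  qed
  have b: "\<forall>y\<in>X. g y = 0" if g: "\<forall>h\<in>cartan u. (\<Sum>y\<in>X. g y * root_of ?w y h) = 0" for g
  proof -
    let ?K = "\<Sum>z\<in>X. g z * root_coeff u x z"
    have "(\<Sum>y\<in>X. (g y + (if y = x then ?K else 0)) * root_of u y h) = (\<Sum>y\<in>X. g y * root_of ?w y h)" for h
    proof -
      have "(\<Sum>y\<in>X. (if y = x then ?K else 0) * root_of u y h) = ?K * root_of u x h"
        using fin x by (simp add: if_distrib[of "\<lambda>k. k * _"] sum.delta cong: if_cong)
      also have "\<dots> = (\<Sum>y\<in>X. g y * (root_coeff u x y * root_of u x h))"
        by (simp add: sum_distrib_right mult.assoc)
      finally show ?thesis
        by (simp add: root_of_reflexion distrib_left distrib_right sum.distrib)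
    qed
    with g have "\<forall>h\<in>cartan u. (\<Sum>y\<in>X. (g y + (if y = x then ?K else 0)) * root_of u y h) = 0" by simp
    then have "\<forall>y\<in>X. g y + (if y = x then ?K else 0) = 0"
      using roots_independent[OF u, of "\<lambda>y. g y + (if y = x then ?K else 0)"] by blast
    then show ?thesis by (rule key[rotated]) simp
  qed
  show ?thesis
    unfolding is_root_datum_def cartan_reflexion
  proof (intro conjI allI impI ballI)
    show "\<exists>B. finite B \<and> cartan u = span B" using u by (simp add: is_root_datum_def)
    show "coroot_of ?w y \<in> cartan u" for y
      using c sub by (simp add: coroot_of_reflexion subspace_add subspace_scale)
    show "root_of ?w y \<in> dual_space s (cartan u)" for y
      using d[of x] d[of y] by (auto simp: dual_space_def root_of_reflexion algebra_simps)
    fix y assume y: "y \<notin> X"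
    show "coroot_of ?w y = 0" "root_of ?w y = (\<lambda>_. 0)" "parity_of ?w y = 0"
      using u x y coeff_outside[OF u y x]
      by (auto simp: is_root_datum_def coroot_of_reflexion root_of_reflexion parity_of_reflexion cartan_matrix_def)
  qed (use a b in blast)+
qed

lemma is_root_datum_homothety:
  assumes u: "is_root_datum s X u" and l: "\<And>x. x \<in> X \<Longrightarrow> l x \<noteq> 0"
  shows "is_root_datum s X (homothety s l u)"
proof -
  have "\<forall>x\<in>X. c x = 0" if "(\<Sum>x\<in>X. s (c x) (s (l x) (coroot_of u x))) = 0" for c
  proof -
    have "(\<Sum>x\<in>X. s (c x * l x) (coroot_of u x)) = 0" using that by (simp add: scale_scale)
    then have "\<forall>x\<in>X. c x * l x = 0" by (auto dest: coroots_independent[OF u])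
    then show ?thesis using l by auto
  qed
  then show ?thesis
    using u subspace_scale[OF cartan_subspace[OF u]]
    by (simp add: is_root_datum_def homothety_def)
qed

lemma is_root_datum_tautological:
  assumes u: "is_root_datum s X u" and \<theta>: "linear_iso s (cartan u) C \<theta>"
  shows "is_root_datum s X (tautological \<theta> C u)"
proof -
  let ?g = "inv_into (cartan u) \<theta>"
  note sub = cartan_subspace[OF u] and c = coroot_in_cartan[OF u] and d = root_in_dual[OF u]
  have bij: "bij_betw \<theta> (cartan u) C" and add: "\<And>h k. h \<in> cartan u \<Longrightarrow> k \<in> cartan u \<Longrightarrow> \<theta> (h + k) = \<theta> h + \<theta> k"
    and sc: "\<And>k h. h \<in> cartan u \<Longrightarrow> \<theta> (s k h) = s k (\<theta> h)"
    using \<theta> by (auto simp: linear_iso_def)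
  have inj: "inj_on \<theta> (cartan u)" and C: "C = \<theta> ` cartan u" using bij by (auto simp: bij_betw_def)
  have zero: "\<theta> 0 = 0" using sc[of 0 0] subspace_0[OF sub] by simp
  have gin: "?g h \<in> cartan u" if "h \<in> C" for h using that C by (simp add: inv_into_into)
  have g: "?g (\<theta> h) = h" if "h \<in> cartan u" for h using inj that by simp
  have sum: "\<theta> (\<Sum>x\<in>X. s (k x) (coroot_of u x)) = (\<Sum>x\<in>X. s (k x) (\<theta> (coroot_of u x)))" for k
  proof (cases "finite X")
    case True
    have "\<theta> (\<Sum>x\<in>Y. s (k x) (coroot_of u x)) = (\<Sum>x\<in>Y. s (k x) (\<theta> (coroot_of u x)))
        \<and> (\<Sum>x\<in>Y. s (k x) (coroot_of u x)) \<in> cartan u" if "finite Y" for Y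
      using that
      by induction (use zero sub c add sc in \<open>auto simp: subspace_0 subspace_add subspace_scale\<close>)
    with True show ?thesis by blast
  qed (simp add: zero)
  obtain B where B: "finite B" "cartan u = span B" using u by (auto simp: is_root_datum_def)
  have comb: "\<theta> (\<Sum>x\<in>B'. s (k x) x) = (\<Sum>x\<in>B'. s (k x) (\<theta> x)) \<and> (\<Sum>x\<in>B'. s (k x) x) \<in> cartan u"
    if "finite B'" "B' \<subseteq> B" for k B'
    using that
  proof (induction B')
    case (insert x F)
    then have "x \<in> cartan u" using B by (auto simp: span_base)
    then show ?case using insert add sc sub by (auto simp: subspace_add subspace_scale)
  qed (use zero sub in \<open>auto simp: subspace_0\<close>)
  have subC: "subspace C"
    unfolding C subspace_def
  proof (intro conjI ballI allI)
    show "0 \<in> \<theta> ` cartan u" using zero subspace_0[OF sub] by (metis image_eqI)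
    fix h assume h: "h \<in> \<theta> ` cartan u"
    then obtain h' where h': "h = \<theta> h'" "h' \<in> cartan u" by auto
    show "s k h \<in> \<theta> ` cartan u" for k
      using h' sc[of h' k] subspace_scale[OF sub, of h' k] by (metis image_eqI)
    fix k assume "k \<in> \<theta> ` cartan u"
    then obtain k' where k': "k = \<theta> k'" "k' \<in> cartan u" by auto
    show "h + k \<in> \<theta> ` cartan u"
      using h' k' add[of h' k'] subspace_add[OF sub, of h' k'] by (metis image_eqI)
  qed
  have spanC: "C = span (\<theta> ` B)"
  proof
    show "span (\<theta> ` B) \<subseteq> C"
      by (rule span_minimal[OF _ subC]) (use B C in \<open>auto simp: span_base\<close>)
    show "C \<subseteq> span (\<theta> ` B)"
    proof
      fix h assume "h \<in> C"
      then obtain h' where h': "h = \<theta> h'" "h' \<in> span B" using B C by auto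
      then obtain k where "h' = (\<Sum>x\<in>B. s (k x) x)" using B(1) by (auto simp: span_finite)
      then have "h = (\<Sum>x\<in>B. s (k x) (\<theta> x))" using comb[OF B(1)] h' by auto
      then show "h \<in> span (\<theta> ` B)" by (simp add: span_sum span_scale span_base)
    qed
  qed
  show ?thesis
    unfolding is_root_datum_def tautological_def root_datum.simps
  proof (intro conjI allI impI ballI)
    show "\<exists>B. finite B \<and> C = span B" using spanC B by blast
    show "(\<theta> \<circ> coroot_of u) x \<in> C" for x using c C by auto
    show "(\<lambda>h. if h \<in> C then root_of u x (?g h) else 0) \<in> dual_space s C" for x
    proof -
      have "root_of u x (?g (h + k)) = root_of u x (?g h) + root_of u x (?g k)" if hk: "h \<in> C" "k \<in> C" for h k
      proof -
        obtain h' k' where "h = \<theta> h'" "h' \<in> cartan u" "k = \<theta> k'" "k' \<in> cartan u" using hk C by auto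
        moreover from this have "?g (h + k) = h' + k'"
          using add[of h' k'] g[of "h' + k'"] subspace_add[OF sub] by auto
        ultimately show ?thesis using g d[of x] by (simp add: dual_space_add)
      qed
      moreover have "root_of u x (?g (s k h)) = k * root_of u x (?g h)" if h: "h \<in> C" for h k
      proof -
        obtain h' where "h = \<theta> h'" "h' \<in> cartan u" using h C by auto
        moreover from this have "?g (s k h) = s k h'"
          using sc[of h' k] g[of "s k h'"] subspace_scale[OF sub] by auto
        ultimately show ?thesis using g d[of x] by (simp add: dual_space_scale)
      qed
      ultimately show ?thesis using subC by (auto simp: dual_space_def subspace_add subspace_scale)
    qed
    fix k x assume k: "(\<Sum>x\<in>X. s (k x) ((\<theta> \<circ> coroot_of u) x)) = 0" and x: "x \<in> X"
    have "\<theta> (\<Sum>x\<in>X. s (k x) (coroot_of u x)) = \<theta> 0" using k sum zero by simp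
    moreover have "(\<Sum>x\<in>X. s (k x) (coroot_of u x)) \<in> cartan u"
      using sub c by (auto intro!: subspace_sum subspace_scale)
    ultimately have "(\<Sum>x\<in>X. s (k x) (coroot_of u x)) = 0"
      using inj subspace_0[OF sub] by (auto dest: inj_onD)
    then show "k x = 0" using coroots_independent[OF u _ x] by blast
  next
    fix k x assume k: "\<forall>h\<in>C. (\<Sum>x\<in>X. k x * (if h \<in> C then root_of u x (?g h) else 0)) = 0" and x: "x \<in> X"
    have "(\<Sum>x\<in>X. k x * root_of u x h) = 0" if "h \<in> cartan u" for h
      using k[rule_format, of "\<theta> h"] that C g by auto
    then show "k x = 0" using roots_independent[OF u _ x] by blast
  qed (use u zero in \<open>auto simp: is_root_datum_def\<close>)
qed

lemma is_root_datum_arrow: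
  assumes "finite X" "arrow s X v \<theta> w"
  shows "is_root_datum s X w"
  using assms(2)
proof induction
  case (reflexion v x)
  then show ?case using assms(1) by (intro is_root_datum_reflexion)
next
  case (tautological v C \<theta>)
  then show ?case by (rule is_root_datum_tautological)
next
  case (homothety v l)
  then show ?case by (rule is_root_datum_homothety)
qed

lemma is_root_datum_skeleton:
  assumes "finite X" "is_root_datum s X v" "u \<in> skeleton s X v"
  shows "is_root_datum s X u"
  using assms(3) by induction (auto intro: is_root_datum_reflexion assms)

lemma arrow_skeleton:
  assumes "finite X" "is_root_datum s X v" "u \<in> skeleton s X v"
  shows "arrow s X v id u"
  using assms(3)
proof induction
  case 1
  \<comment> \<open>The relation \<open>arrow\<close> has no rule for identities; the homothety with
    all factors 1 serves as one.\<close>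
  have "homothety s (\<lambda>_. 1) v = v" by (simp add: homothety_def)
  moreover have "arrow s X v id (homothety s (\<lambda>_. 1) v)"
    by (rule arrow.homothety[OF assms(2)]) (rule one_neq_zero)
  ultimately show ?case by (simp only:)
next
  case (2 u x)
  from 2(1) have "is_root_datum s X u" by (rule is_root_datum_skeleton[OF assms(1,2)])
  from arrow.compose[OF 2(4) arrow.reflexion[OF this 2(2,3)]] show ?case by simp
qed

end

section \<open>The root lattice\<close>

definition int_comb :: "'x set \<Rightarrow> ('u, 'x) root_datum \<Rightarrow> ('x \<Rightarrow> int) \<Rightarrow> 'u \<Rightarrow> complex" where
  "int_comb X u n = (\<lambda>h. \<Sum>x\<in>X. of_int (n x) * root_of u x h)"

definition refl_map :: "('u \<Rightarrow> complex) \<Rightarrow> 'u \<Rightarrow> ('u \<Rightarrow> complex) \<Rightarrow> 'u \<Rightarrow> complex" where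
  "refl_map \<beta> c \<nu> = (\<lambda>h. \<nu> h - \<nu> c * \<beta> h)"

lemma int_comb_add: "int_comb X u n + int_comb X u m = int_comb X u (\<lambda>x. n x + m x)"
  by (auto simp: int_comb_def algebra_simps sum.distrib)

lemma int_comb_diff: "int_comb X u n - int_comb X u m = int_comb X u (\<lambda>x. n x - m x)"
  by (auto simp: int_comb_def algebra_simps sum_subtractf)

lemma int_comb_uminus: "- int_comb X u n = int_comb X u (\<lambda>x. - n x)"
  by (auto simp: int_comb_def sum_negf)

lemma int_comb_scale: "(\<lambda>h. of_int k * int_comb X u n h) = int_comb X u (\<lambda>x. k * n x)"
  by (auto simp: int_comb_def sum_distrib_left mult.assoc)

lemma int_comb_zero: "int_comb X u (\<lambda>_. 0) = 0"
  by (auto simp: int_comb_def)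

lemma int_comb_single:
  assumes "finite X" "x \<in> X"
  shows "int_comb X u (\<lambda>z. if z = x then k else 0) = (\<lambda>h. of_int k * root_of u x h)"
  using assms by (auto simp: int_comb_def if_distrib[of "\<lambda>k. of_int k * _"] cong: if_cong)

lemma positive_cone_iff:
  "\<nu> \<in> positive_cone X u \<longleftrightarrow> (\<exists>n. \<nu> = int_comb X u n \<and> (\<forall>x\<in>X. 0 \<le> n x))"
proof
  assume "\<nu> \<in> positive_cone X u"
  then obtain n :: "_ \<Rightarrow> nat" where "\<nu> = (\<lambda>h. \<Sum>x\<in>X. of_nat (n x) * root_of u x h)"
    by (auto simp: positive_cone_def)
  then have "\<nu> = int_comb X u (\<lambda>x. int (n x))" by (simp add: int_comb_def)
  then show "\<exists>n. \<nu> = int_comb X u n \<and> (\<forall>x\<in>X. 0 \<le> n x)" by auto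
next
  assume "\<exists>n. \<nu> = int_comb X u n \<and> (\<forall>x\<in>X. 0 \<le> n x)"
  then obtain n where n: "\<nu> = int_comb X u n" "\<forall>x\<in>X. 0 \<le> n x" by auto
  then have "\<nu> = (\<lambda>h. \<Sum>x\<in>X. of_nat (nat (n x)) * root_of u x h)"
    by (simp add: int_comb_def)
  then show "\<nu> \<in> positive_cone X u"
    unfolding positive_cone_def by (intro CollectI exI[of _ "\<lambda>x. nat (n x)"]) simp
qed

text \<open>Of the roots of a superalgebra only sign coherence and a bound on multiples of simple
  roots are kept; \<open>\<Phi>\<close> will be the set of roots. The bound 2 comes from [e,[e,e]] =
  0.\<close>

locale root_chambers =
  fixes s :: "complex \<Rightarrow> 'u::ab_group_add \<Rightarrow> 'u" and X :: "'x set"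
    and v :: "('u, 'x) root_datum" and \<Phi> :: "('u \<Rightarrow> complex) set"
  assumes vs: "vector_space s" and finX: "finite X" and rdv: "is_root_datum s X v"
    and reflectable: "\<And>u x. u \<in> skeleton s X v \<Longrightarrow> x \<in> X \<Longrightarrow> reflectable X u x"
    and root_mem: "\<And>u x. u \<in> skeleton s X v \<Longrightarrow> x \<in> X \<Longrightarrow> root_of u x \<in> \<Phi>"
    and coherent: "\<And>u \<beta>. u \<in> skeleton s X v \<Longrightarrow> \<beta> \<in> \<Phi> \<Longrightarrow>
        \<beta> \<in> positive_cone X u \<or> - \<beta> \<in> positive_cone X u"
    and multiple_bound: "\<And>u x k. u \<in> skeleton s X v \<Longrightarrow> x \<in> X \<Longrightarrow>
        (\<lambda>h. of_nat k * root_of u x h) \<in> \<Phi> \<Longrightarrow> k \<le> 2"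
begin

interpretation vector_space s by (rule vs)

abbreviation "Sk \<equiv> skeleton s X v"
abbreviation "A \<equiv> cartan_matrix"
abbreviation "comb \<equiv> int_comb X"
abbreviation "pos u \<nu> \<equiv> \<nu> \<in> positive_cone X u"

lemma rd: "u \<in> Sk \<Longrightarrow> is_root_datum s X u"
  by (rule is_root_datum_skeleton[OF vs finX rdv])

lemma cartan_Sk: "u \<in> Sk \<Longrightarrow> cartan u = cartan v"
  by (induction rule: skeleton.induct) (auto simp: cartan_reflexion[OF vs])

lemma refl_Sk: "u \<in> Sk \<Longrightarrow> x \<in> X \<Longrightarrow> reflexion s u x \<in> Sk"
  by (rule skeleton.intros(2)) (auto intro: reflectable)

lemma reflexion_twice: "u \<in> Sk \<Longrightarrow> reflexion s (reflexion s u x) x = u"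
  by (rule reflexion_reflexion[OF vs rd])

lemma skeleton_trans: "u \<in> Sk \<Longrightarrow> w \<in> skeleton s X u \<Longrightarrow> w \<in> Sk"
  by (rotate_tac, induction rule: skeleton.induct) (auto intro: skeleton.intros)

lemma skeleton_sym: "u \<in> Sk \<Longrightarrow> v \<in> skeleton s X u"
proof (induction rule: skeleton.induct)
  case (2 u x)
  let ?w = "reflexion s u x"
  have w: "?w \<in> Sk" using 2 by (intro refl_Sk)
  have "u \<in> skeleton s X ?w"
    using skeleton.intros(2)[OF skeleton.intros(1) 2(2) reflectable[OF w 2(2)], of s] reflexion_twice[OF 2(1)]
    by simp
  moreover have "w' \<in> skeleton s X ?w" if "w' \<in> skeleton s X u" for w'
    using that by induction (use calculation in \<open>auto intro: skeleton.intros\<close>)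
  ultimately show ?case using 2 by blast
qed (rule skeleton.intros)

text \<open>Reflexions being involutions, an induction over the skeleton may start at any of its
  members; \<open>transport\<close> starts at a datum where the given root is simple.\<close>

lemma skeleton_eq:
  assumes "u \<in> Sk"
  shows "skeleton s X u = Sk"
proof -
  have "w \<in> skeleton s X u" if "w \<in> Sk" for w
    using that by induction (use skeleton_sym[OF assms] in \<open>auto intro: skeleton.intros\<close>)
  then show ?thesis using skeleton_trans[OF assms] by blast
qed

section \<open>Integer coordinates and heights with respect to each base\<close>

definition "lattice = range (comb v)"

lemma comb_inject:
  assumes "u \<in> Sk" "comb u n = comb u m" "x \<in> X"
  shows "n x = m x"
proof -
  have "(\<Sum>x\<in>X. of_int (n x - m x) * root_of u x h) = 0" for h
    using fun_cong[OF assms(2), of h] by (simp add: int_comb_def algebra_simps sum_subtractf)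
  then have "of_int (n x - m x) = (0::complex)"
    using roots_independent[OF vs rd[OF assms(1)], of "\<lambda>x. of_int (n x - m x)"] assms(3) by blast
  then show ?thesis by (simp del: of_int_diff)
qed

lemma lattice_zero: "0 \<in> lattice"
  by (metis lattice_def int_comb_zero rangeI)

lemma lattice_add: "\<nu> \<in> lattice \<Longrightarrow> \<mu> \<in> lattice \<Longrightarrow> \<nu> + \<mu> \<in> lattice"
  by (auto simp: lattice_def int_comb_add)

lemma lattice_diff: "\<nu> \<in> lattice \<Longrightarrow> \<mu> \<in> lattice \<Longrightarrow> \<nu> - \<mu> \<in> lattice"
  by (auto simp: lattice_def int_comb_diff)

lemma lattice_uminus: "\<nu> \<in> lattice \<Longrightarrow> - \<nu> \<in> lattice"
  by (auto simp: lattice_def int_comb_uminus)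

lemma lattice_scale: "\<nu> \<in> lattice \<Longrightarrow> (\<lambda>h. of_int k * \<nu> h) \<in> lattice"
  by (auto simp: lattice_def int_comb_scale)

lemma lattice_sum: "(\<And>i. i \<in> S \<Longrightarrow> f i \<in> lattice) \<Longrightarrow> sum f S \<in> lattice"
  by (induction S rule: infinite_finite_induct) (auto simp: lattice_zero lattice_add)

lemma root_mem_lattice: 
  assumes "\<beta> \<in> \<Phi>" shows "\<beta> \<in> lattice"
proof -
  have "v \<in> Sk" by (rule skeleton.intros)
  from coherent[OF this assms] show ?thesis
  proof
    assume "- \<beta> \<in> positive_cone X v"
    then have "- \<beta> \<in> lattice" unfolding lattice_def positive_cone_iff by blast
    from lattice_uminus[OF this] show ?thesis by simp
  qed (auto simp: positive_cone_iff lattice_def)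
qed

lemma int_comb_sum: "comb u n = (\<Sum>x\<in>X. (\<lambda>h. of_int (n x) * root_of u x h))"
proof -
  have "(\<Sum>x\<in>S. (\<lambda>h. of_int (n x) * root_of u x h)) = (\<lambda>h. \<Sum>x\<in>S. of_int (n x) * root_of u x h)" for S
    by (induction S rule: infinite_finite_induct) auto
  then show ?thesis by (simp add: int_comb_def)
qed

lemma comb_in_lattice: "u \<in> Sk \<Longrightarrow> comb u n \<in> lattice"
  unfolding int_comb_sum
  by (intro lattice_sum lattice_scale root_mem_lattice root_mem)

text \<open>Coherence at \<open>u\<close> expresses the simple roots of \<open>v\<close> integrally
  in the base at \<open>u\<close>, and coherence at \<open>v\<close> does the reverse. Integer
  coordinates therefore make sense for every base at once.\<close>

lemma lattice_eq:
  assumes u: "u \<in> Sk" shows "lattice = range (comb u)"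
proof
  show "range (comb u) \<subseteq> lattice" using comb_in_lattice[OF u] by auto
  have root: "root_of v x \<in> range (comb u)" if "x \<in> X" for x
    using coherent[OF u root_mem[OF skeleton.intros(1) that]]
  proof
    assume "- root_of v x \<in> positive_cone X u"
    then obtain n where "- root_of v x = comb u n" by (auto simp: positive_cone_iff)
    then have "root_of v x = - comb u n" by (metis minus_minus)
    then show ?thesis by (simp add: int_comb_uminus)
  qed (auto simp: positive_cone_iff)
  have sum: "sum f S \<in> range (comb u)" if "\<And>i. i \<in> S \<Longrightarrow> f i \<in> range (comb u)" for f S
    using that
  proof (induction S rule: infinite_finite_induct)
    case (insert i S)
    then obtain n m where "f i = comb u n" "sum f S = comb u m" by (metis imageE insertCI)
    then show ?case using insert by (auto simp: int_comb_add)
  qed (metis int_comb_zero rangeI sum.infinite sum.empty)+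
  have "comb v n \<in> range (comb u)" for n
    unfolding int_comb_sum[of v]
  proof (rule sum)
    fix x assume "x \<in> X"
    from root[OF this] obtain m where m: "root_of v x = comb u m" by auto
    show "(\<lambda>h. of_int (n x) * root_of v x h) \<in> range (comb u)" unfolding m int_comb_scale by auto
  qed
  then show "lattice \<subseteq> range (comb u)" by (auto simp: lattice_def)
qed

text \<open>Since \<open>int_comb\<close> ignores values outside \<open>X\<close>, the choice is
  determined on \<open>X\<close> only, and facts about \<open>co\<close> are stated for points of
  \<open>X\<close>.\<close>

definition "co u \<nu> = (SOME n. \<nu> = comb u n)"

lemma comb_co: "u \<in> Sk \<Longrightarrow> \<nu> \<in> lattice \<Longrightarrow> comb u (co u \<nu>) = \<nu>"
  unfolding co_def lattice_eq[of u] by (metis (mono_tags, lifting) imageE someI_ex)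

lemma co_comb: "u \<in> Sk \<Longrightarrow> x \<in> X \<Longrightarrow> co u (comb u n) x = n x"
  using comb_inject comb_co comb_in_lattice by metis

lemma co_eqI: "u \<in> Sk \<Longrightarrow> \<nu> = comb u n \<Longrightarrow> x \<in> X \<Longrightarrow> co u \<nu> x = n x"
  by (simp add: co_comb)

lemma co_root:
  assumes "u \<in> Sk" "x \<in> X" "y \<in> X"
  shows "co u (root_of u x) y = (if y = x then 1 else 0)"
  using co_comb[OF assms(1,3), of "\<lambda>z. if z = x then 1 else 0"] int_comb_single[OF finX assms(2), of u 1]
  by simp

lemma co_add: "u \<in> Sk \<Longrightarrow> \<nu> \<in> lattice \<Longrightarrow> \<mu> \<in> lattice \<Longrightarrow> x \<in> X \<Longrightarrow>
    co u (\<nu> + \<mu>) x = co u \<nu> x + co u \<mu> x"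
  by (rule co_eqI) (simp_all flip: int_comb_add add: comb_co plus_fun_def)

lemma co_diff: "u \<in> Sk \<Longrightarrow> \<nu> \<in> lattice \<Longrightarrow> \<mu> \<in> lattice \<Longrightarrow> x \<in> X \<Longrightarrow>
    co u (\<nu> - \<mu>) x = co u \<nu> x - co u \<mu> x"
  by (rule co_eqI) (simp_all flip: int_comb_diff add: comb_co fun_diff_def)

lemma co_uminus: "u \<in> Sk \<Longrightarrow> \<nu> \<in> lattice \<Longrightarrow> x \<in> X \<Longrightarrow> co u (- \<nu>) x = - co u \<nu> x"
  by (rule co_eqI) (simp_all flip: int_comb_uminus add: comb_co fun_Compl_def)

lemma co_scale: "u \<in> Sk \<Longrightarrow> \<nu> \<in> lattice \<Longrightarrow> x \<in> X \<Longrightarrow>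
    co u (\<lambda>h. of_int k * \<nu> h) x = k * co u \<nu> x"
  by (rule co_eqI) (simp_all flip: int_comb_scale add: comb_co)

lemma pos_iff: "u \<in> Sk \<Longrightarrow> \<nu> \<in> lattice \<Longrightarrow> pos u \<nu> \<longleftrightarrow> (\<forall>x\<in>X. 0 \<le> co u \<nu> x)"
  unfolding positive_cone_iff by (metis comb_co co_comb)

lemma pos_lattice: "u \<in> Sk \<Longrightarrow> pos u \<nu> \<Longrightarrow> \<nu> \<in> lattice"
  by (auto simp: positive_cone_iff comb_in_lattice)

lemma co_zero_imp: "u \<in> Sk \<Longrightarrow> \<nu> \<in> lattice \<Longrightarrow> (\<And>x. x \<in> X \<Longrightarrow> co u \<nu> x = 0) \<Longrightarrow> \<nu> = 0"
proof -
  assume "u \<in> Sk" "\<nu> \<in> lattice" "\<And>x. x \<in> X \<Longrightarrow> co u \<nu> x = 0"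
  then have "comb u (co u \<nu>) = comb u (\<lambda>_. 0)" by (simp add: int_comb_def)
  then show ?thesis using \<open>u \<in> Sk\<close> \<open>\<nu> \<in> lattice\<close> by (simp add: comb_co int_comb_zero)
qed

definition "ht u \<nu> = (\<Sum>x\<in>X. co u \<nu> x)"

lemma ht_add: "u \<in> Sk \<Longrightarrow> \<nu> \<in> lattice \<Longrightarrow> \<mu> \<in> lattice \<Longrightarrow> ht u (\<nu> + \<mu>) = ht u \<nu> + ht u \<mu>"
  by (simp add: ht_def co_add sum.distrib)

lemma ht_diff: "u \<in> Sk \<Longrightarrow> \<nu> \<in> lattice \<Longrightarrow> \<mu> \<in> lattice \<Longrightarrow> ht u (\<nu> - \<mu>) = ht u \<nu> - ht u \<mu>"
  by (simp add: ht_def co_diff sum_subtractf)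

lemma ht_uminus: "u \<in> Sk \<Longrightarrow> \<nu> \<in> lattice \<Longrightarrow> ht u (- \<nu>) = - ht u \<nu>"
  by (simp add: ht_def co_uminus sum_negf)

lemma ht_scale: "u \<in> Sk \<Longrightarrow> \<nu> \<in> lattice \<Longrightarrow> ht u (\<lambda>h. of_int k * \<nu> h) = k * ht u \<nu>"
  by (simp add: ht_def co_scale sum_distrib_left)

lemma ht_root: "u \<in> Sk \<Longrightarrow> x \<in> X \<Longrightarrow> ht u (root_of u x) = 1"
  by (simp add: ht_def co_root finX)

lemma ht_nonneg: "u \<in> Sk \<Longrightarrow> pos u \<nu> \<Longrightarrow> 0 \<le> ht u \<nu>"
  unfolding ht_def by (rule sum_nonneg) (use pos_iff pos_lattice in blast)

lemma ht_pos:
  assumes "u \<in> Sk" "pos u \<nu>" "\<nu> \<noteq> 0" shows "0 < ht u \<nu>"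
proof (rule ccontr)
  note l = pos_lattice[OF assms(1,2)]
  have nn: "\<forall>x\<in>X. 0 \<le> co u \<nu> x" using assms(2) pos_iff[OF assms(1) l] by simp
  assume "\<not> 0 < ht u \<nu>"
  then have "ht u \<nu> = 0" using ht_nonneg[OF assms(1,2)] by simp
  then have "\<forall>x\<in>X. co u \<nu> x = 0" using nn finX by (simp add: ht_def sum_nonneg_eq_0_iff)
  then show False using co_zero_imp[OF assms(1) l] assms(3) by blast
qed

lemma root_nonzero: "u \<in> Sk \<Longrightarrow> x \<in> X \<Longrightarrow> root_of u x \<noteq> 0"
  using ht_root[of u x] ht_scale[of u 0 0] lattice_zero by (auto simp: zero_fun_def)

text \<open>Coherence leaves only two cases for a nonzero root, and the height, being strictly
  positive on nonzero elements of the cone, distinguishes them.\<close>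

lemma coherent_ht:
  assumes "u \<in> Sk" "\<beta> \<in> \<Phi>" "\<beta> \<noteq> 0"
  shows "pos u \<beta> \<longleftrightarrow> 0 < ht u \<beta>" "\<not> pos u \<beta> \<longleftrightarrow> ht u \<beta> < 0" "pos u (- \<beta>) \<longleftrightarrow> ht u \<beta> < 0"
proof -
  have l: "\<beta> \<in> lattice" by (rule root_mem_lattice[OF assms(2)])
  have "pos u \<beta> \<Longrightarrow> 0 < ht u \<beta>" using ht_pos assms by blast
  moreover have "pos u (- \<beta>) \<Longrightarrow> ht u \<beta> < 0" 
    using ht_pos[OF assms(1), of "- \<beta>"] assms ht_uminus[OF assms(1) l] by simp
  ultimately show "pos u \<beta> \<longleftrightarrow> 0 < ht u \<beta>" "\<not> pos u \<beta> \<longleftrightarrow> ht u \<beta> < 0" "pos u (- \<beta>) \<longleftrightarrow> ht u \<beta> < 0"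
    using coherent[OF assms(1,2)] by auto
qed

text \<open>Coherence in the form that yields symmetric zeros of the Cartan matrix and uniqueness of
  coroots: in both cases a root violating it is exhibited.\<close>

lemma no_mixed_signs:
  assumes u: "u \<in> Sk" and "comb u n \<in> \<Phi>" "x \<in> X" "y \<in> X" "n x < 0" "0 < n y"
  shows False
  using coherent[OF u assms(2)]
proof
  assume "pos u (comb u n)"
  then show False using assms by (auto simp: pos_iff comb_in_lattice co_comb)
next
  assume "pos u (- comb u n)"
  then show False using assms by (auto simp: pos_iff int_comb_uminus comb_in_lattice co_comb)
qed

text \<open>In the anisotropic case this is reflectability, whose condition for odd \<open>x\<close>
  is stronger by a factor 2; in the isotropic case the coefficient is 0 or 1.\<close>

lemma root_coeff_nat:
  assumes u: "u \<in> Sk" and x: "x \<in> X" and y: "y \<in> X" "y \<noteq> x"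
  shows "\<exists>k::nat. root_coeff u x y = of_nat k"
proof (cases "A u x x = 0")
  case True
  then show ?thesis using y by (auto simp: root_coeff_def Let_def intro: exI[of _ 0] exI[of _ 1])
next
  case False
  have "2 * A u x y / A u x x \<in> \<int>\<^sub>\<le>\<^sub>0"
  proof (cases "parity_of u x = 0")
    case True
    then show ?thesis using reflectable[OF u x] False y by (auto simp: reflectable_def Let_def)
  next
    case False
    then have "parity_of u x = 1" by (simp add: bit_not_zero_iff)
    then have "A u x y / A u x x \<in> \<int>\<^sub>\<le>\<^sub>0"
      using reflectable[OF u x] \<open>A u x x \<noteq> 0\<close> y by (auto simp: reflectable_def Let_def)
    then obtain k :: nat where "A u x y / A u x x = - of_nat k" by (auto elim: nonpos_Ints_cases')
    then have "2 * A u x y / A u x x = - of_nat (2 * k)" by (metis mult_minus_right of_nat_mult of_nat_numeral times_divide_eq_right)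
    then show ?thesis by (metis minus_of_nat_in_nonpos_Ints)
  qed
  then obtain k :: nat where "2 * A u x y / A u x x = - of_nat k" by (auto elim: nonpos_Ints_cases')
  then have "root_coeff u x y = of_nat k" using False y by (simp add: root_coeff_def Let_def)
  then show ?thesis ..
qed

text \<open>Modulo the root at \<open>x\<close>, the new base has the same member at each
  \<open>y\<close> other than \<open>x\<close> as the old one.\<close>

lemma co_reflexion:
  assumes u: "u \<in> Sk" and x: "x \<in> X" and y: "y \<in> X" "y \<noteq> x" and l: "\<nu> \<in> lattice"
  shows "co (reflexion s u x) \<nu> y = co u \<nu> y"
proof -
  let ?w = "reflexion s u x"
  obtain k where k: "\<And>z. z \<in> X \<Longrightarrow> z \<noteq> x \<Longrightarrow> root_coeff u x z = of_nat (k z)"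
    using root_coeff_nat[OF u x] by metis
  define m where "m z = (if z = x then -2 else int (k z))" for z
  have m: "root_coeff u x z = of_int (m z)" if "z \<in> X" for z using k that by (auto simp: m_def coeff_self[OF vs])
  define n where "n = co ?w \<nu>"
  have "\<nu> = comb ?w n" using comb_co refl_Sk u x l by (simp add: n_def)
  also have "\<dots> = comb u n + (\<lambda>h. of_int (\<Sum>z\<in>X. n z * m z) * root_of u x h)"
    by (rule ext) (simp add: int_comb_def root_of_reflexion[OF vs] m distrib_left sum.distrib
        sum_distrib_left sum_distrib_right mult_ac)
  also have "\<dots> = comb u (\<lambda>z. n z + (if z = x then \<Sum>z\<in>X. n z * m z else 0))"
    unfolding int_comb_single[OF finX x, symmetric] int_comb_add ..
  finally have "co u \<nu> y = n y" using co_eqI[OF u _ y(1)] y(2) by fastforce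
  then show ?thesis by (simp add: n_def)
qed

text \<open>Coordinates other than the one at \<open>x\<close> agree for both bases, so for a
  separated root they are both nonnegative and nonpositive. Only a multiple of the simple root
  remains, and \<open>multiple_bound\<close> limits the factor.\<close>

lemma separated_step:
  assumes u: "u \<in> Sk" and x: "x \<in> X"
  shows "{\<beta> \<in> \<Phi>. pos u \<beta> \<and> \<not> pos (reflexion s u x) \<beta>} \<subseteq> (\<lambda>k h. of_nat k * root_of u x h) ` {0..2}"
proof
  let ?w = "reflexion s u x"
  fix \<beta> assume "\<beta> \<in> {\<beta> \<in> \<Phi>. pos u \<beta> \<and> \<not> pos ?w \<beta>}"
  then have \<beta>: "\<beta> \<in> \<Phi>" "pos u \<beta>" "pos ?w (- \<beta>)" using coherent[OF refl_Sk[OF u x]] by auto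
  note l = root_mem_lattice[OF \<beta>(1)] and w = refl_Sk[OF u x]
  have "co u \<beta> y = 0" if "y \<in> X" "y \<noteq> x" for y
  proof -
    have "0 \<le> co u \<beta> y" "0 \<le> - co ?w \<beta> y"
      using \<beta> l u w that lattice_uminus[OF l] by (auto simp: pos_iff co_uminus)
    then show ?thesis using co_reflexion[OF u x that l] by simp
  qed
  then have "comb u (co u \<beta>) = comb u (\<lambda>z. if z = x then co u \<beta> x else 0)"
    unfolding int_comb_def by (intro ext sum.cong) auto
  then have "\<beta> = (\<lambda>h. of_int (co u \<beta> x) * root_of u x h)"
    unfolding int_comb_single[OF finX x] by (simp add: comb_co u l)
  moreover have "0 \<le> co u \<beta> x" using \<beta>(2) l u x by (simp add: pos_iff)
  ultimately have eq: "\<beta> = (\<lambda>h. of_nat (nat (co u \<beta> x)) * root_of u x h)" by simp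
  with \<beta>(1) have "nat (co u \<beta> x) \<le> 2" using multiple_bound[OF u x] by metis
  with eq show "\<beta> \<in> (\<lambda>k h. of_nat k * root_of u x h) ` {0..2}" by (intro image_eqI) auto
qed

lemma finite_separated:
  assumes "u \<in> Sk" "w \<in> Sk"
  shows "finite {\<beta> \<in> \<Phi>. pos u \<beta> \<and> \<not> pos w \<beta>}"
proof -
  have step: "finite {\<beta> \<in> \<Phi>. pos u \<beta> \<and> \<not> pos (reflexion s u x) \<beta>}" if "u \<in> Sk" "x \<in> X" for u x
    by (rule finite_subset[OF separated_step[OF that]]) simp
  have "finite {\<beta> \<in> \<Phi>. pos u \<beta> \<and> \<not> pos v \<beta>} \<and> finite {\<beta> \<in> \<Phi>. pos v \<beta> \<and> \<not> pos u \<beta>}" if "u \<in> Sk" for u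
    using that
  proof induction
    case (2 u x)
    let ?w = "reflexion s u x"
    have "{\<beta> \<in> \<Phi>. pos ?w \<beta> \<and> \<not> pos v \<beta>} \<subseteq>
        {\<beta> \<in> \<Phi>. pos ?w \<beta> \<and> \<not> pos u \<beta>} \<union> {\<beta> \<in> \<Phi>. pos u \<beta> \<and> \<not> pos v \<beta>}"
      "{\<beta> \<in> \<Phi>. pos v \<beta> \<and> \<not> pos ?w \<beta>} \<subseteq>
        {\<beta> \<in> \<Phi>. pos v \<beta> \<and> \<not> pos u \<beta>} \<union> {\<beta> \<in> \<Phi>. pos u \<beta> \<and> \<not> pos ?w \<beta>}" by auto
    moreover have "finite {\<beta> \<in> \<Phi>. pos ?w \<beta> \<and> \<not> pos u \<beta>}"
      using step[OF refl_Sk[OF 2(1,2)] 2(2)] reflexion_twice[OF 2(1)] by simp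
    ultimately show ?case using 2 step[OF 2(1,2)] by (meson finite_UnI finite_subset)
  qed simp
  then have "finite ({\<beta> \<in> \<Phi>. pos u \<beta> \<and> \<not> pos v \<beta>} \<union> {\<beta> \<in> \<Phi>. pos v \<beta> \<and> \<not> pos w \<beta>})"
    using assms by simp
  then show ?thesis by (rule rev_finite_subset) auto
qed

text \<open>If the transposed entry were nonzero, reflexions at \<open>x\<close> and then at
  \<open>y\<close> would turn the root of \<open>x\<close> into -b(x) + k b(y) with k > 0, which has
  mixed signs.\<close>

lemma cartan_matrix_symmetric_zero:
  assumes u: "u \<in> Sk" and x: "x \<in> X" and y: "y \<in> X" "x \<noteq> y" and z: "A u x y = 0"
  shows "A u y x = 0"
proof (rule ccontr)
  assume nz: "A u y x \<noteq> 0"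
  let ?w = "reflexion s u x"
  note w = refl_Sk[OF u x] and m = cartan_matrix_reflexion[OF vs rd[OF u]]
  have ry: "root_coeff u x y = 0" using z y by (simp add: root_coeff_def Let_def)
  have "A ?w y x = (if A u x x = 0 then - A u y x else A u y x)"
    unfolding m coeff_self[OF vs] using y z by (auto simp: coroot_coeff_def Let_def algebra_simps)
  then have "A ?w y x \<noteq> 0" using nz by simp
  then have "root_coeff ?w y x \<noteq> 0" using y by (simp add: root_coeff_def Let_def)
  moreover obtain k :: nat where k: "root_coeff ?w y x = of_nat k" using root_coeff_nat[OF w y(1) x y(2)] by auto
  ultimately have "k > 0" by simp
  have "root_of (reflexion s ?w y) x = (\<lambda>h. root_of ?w x h + of_nat k * root_of ?w y h)"
    by (simp add: root_of_reflexion[OF vs] k fun_eq_iff)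
  also have "\<dots> = (\<lambda>h. of_int (- 1) * root_of u x h) + (\<lambda>h. of_int (int k) * root_of u y h)"
    by (simp add: root_of_reflexion[OF vs] ry coeff_self[OF vs] fun_eq_iff)
  also have "\<dots> = comb u (\<lambda>z. (if z = x then -1 else 0) + (if z = y then int k else 0))"
    unfolding int_comb_single[OF finX x, symmetric] int_comb_single[OF finX y(1), symmetric] int_comb_add ..
  finally have "comb u (\<lambda>z. (if z = x then -1 else 0) + (if z = y then int k else 0)) \<in> \<Phi>"
    using root_mem[OF refl_Sk[OF w y(1)] x] by simp
  from no_mixed_signs[OF u this x y(1)] show False using y(2) \<open>k > 0\<close> by auto
qed

section \<open>Anisotropic reflections\<close>

text \<open>Here \<open>c\<close> is the coroot normalised by \<beta>(c) = 2. It is a separate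
  argument because several data may exhibit the same simple root; \<open>coroot_unique\<close> shows
  afterwards that the lattice cannot tell the resulting coroots apart.\<close>

definition "anisotropic \<beta> c \<longleftrightarrow>
  (\<exists>u\<in>Sk. \<exists>x\<in>X. A u x x \<noteq> 0 \<and> \<beta> = root_of u x \<and> c = s (2 / A u x x) (coroot_of u x))"

abbreviation "RR \<equiv> real_roots s X v"

text \<open>Exact for \<open>\<nu>\<close> in the root lattice and \<open>c\<close> an anisotropic coroot, where \<open>\<nu> c\<close> is an integer.\<close>

definition pairing :: "('u \<Rightarrow> complex) \<Rightarrow> 'u \<Rightarrow> int" where
  "pairing \<nu> c = \<lfloor>Re (\<nu> c)\<rfloor>"

lemma lattice_dual: "\<nu> \<in> lattice \<Longrightarrow> \<nu> \<in> dual_space s (cartan v)"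
  using root_in_dual[OF vs rdv]
  by (auto simp: lattice_def int_comb_def dual_space_def sum.distrib sum_distrib_left algebra_simps)

lemma real_\<Phi>: "\<beta> \<in> RR \<Longrightarrow> \<beta> \<in> \<Phi>"
  by (auto simp: real_roots_def root_mem)

lemma real_lattice: "\<beta> \<in> RR \<Longrightarrow> \<beta> \<in> lattice"
  by (rule root_mem_lattice[OF real_\<Phi>])

lemma real_nonzero: "\<beta> \<in> RR \<Longrightarrow> \<beta> \<noteq> 0"
  using root_nonzero by (auto simp: real_roots_def)

lemma anisotropic_real: "anisotropic \<beta> c \<Longrightarrow> \<beta> \<in> RR"
  by (auto simp: anisotropic_def real_roots_def)

lemma anisotropic_cartan: "anisotropic \<beta> c \<Longrightarrow> c \<in> cartan v"
  using coroot_in_cartan[OF vs rd] subspace_scale[OF cartan_subspace[OF vs rdv]]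
  by (auto simp: anisotropic_def cartan_Sk)

lemma root_coroot_value:
  assumes "u \<in> Sk"
  shows "root_of u y (s k (coroot_of u x)) = k * A u x y"
  using dual_space_scale[OF vs root_in_dual[OF vs rd[OF assms]] coroot_in_cartan[OF vs rd[OF assms]]]
  by (simp add: cartan_matrix_def)

lemma anisotropic_self: "anisotropic \<beta> c \<Longrightarrow> \<beta> c = 2"
  by (auto simp: anisotropic_def root_coroot_value)

lemma anisotropic_root_coeff:
  assumes u: "u \<in> Sk" and "A u x x \<noteq> 0" "c = s (2 / A u x x) (coroot_of u x)"
  shows "root_of u y c = - root_coeff u x y"
  using assms by (simp add: root_coroot_value root_coeff_def Let_def)

lemma pairing_unique: "\<nu> c = of_int k \<Longrightarrow> pairing \<nu> c = k"
  by (simp add: pairing_def)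

lemma pairing_eq:
  assumes "anisotropic \<beta> c" "\<nu> \<in> lattice"
  shows "\<nu> c = of_int (pairing \<nu> c)"
proof -
  obtain u x where u: "u \<in> Sk" "x \<in> X" "A u x x \<noteq> 0" "\<beta> = root_of u x"
    and c: "c = s (2 / A u x x) (coroot_of u x)" using assms(1) by (auto simp: anisotropic_def)
  have "\<exists>k::int. root_of u y c = of_int k" if "y \<in> X" for y
    using root_coeff_nat[OF u(1,2) that] coeff_self(1)[OF vs, of u x] anisotropic_root_coeff[OF u(1,3) c]
    by (cases "y = x") (force intro: exI[of _ "- int _"])+
  then obtain k :: "'x \<Rightarrow> int" where k: "\<And>y. y \<in> X \<Longrightarrow> root_of u y c = of_int (k y)" by metis
  obtain n where "\<nu> = comb u n" using assms(2) lattice_eq[OF u(1)] by auto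
  then have m: "\<nu> c = of_int (\<Sum>y\<in>X. n y * k y)" by (simp add: int_comb_def k)
  show ?thesis using m pairing_unique[of \<nu> c, OF m] by simp
qed

lemma pairing_uminus: "anisotropic \<beta> c \<Longrightarrow> \<nu> \<in> lattice \<Longrightarrow> pairing (- \<nu>) c = - pairing \<nu> c"
  by (rule pairing_unique) (simp add: pairing_eq[of \<beta> c])

lemma refl_map_eq:
  assumes "anisotropic \<beta> c" "\<nu> \<in> lattice"
  shows "refl_map \<beta> c \<nu> = \<nu> - (\<lambda>h. of_int (pairing \<nu> c) * \<beta> h)"
  using pairing_eq[OF assms] by (simp add: refl_map_def fun_eq_iff)

lemma refl_map_lattice: "anisotropic \<beta> c \<Longrightarrow> \<nu> \<in> lattice \<Longrightarrow> refl_map \<beta> c \<nu> \<in> lattice"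
  by (simp add: refl_map_eq lattice_diff lattice_scale real_lattice anisotropic_real)

lemma refl_map_add: "refl_map \<beta> c (\<nu> + \<mu>) = refl_map \<beta> c \<nu> + refl_map \<beta> c \<mu>"
  by (simp add: refl_map_def fun_eq_iff algebra_simps)

lemma refl_map_diff: "refl_map \<beta> c (\<nu> - \<mu>) = refl_map \<beta> c \<nu> - refl_map \<beta> c \<mu>"
  by (simp add: refl_map_def fun_eq_iff algebra_simps)

lemma refl_map_scale: "refl_map \<beta> c (\<lambda>h. k * \<nu> h) = (\<lambda>h. k * refl_map \<beta> c \<nu> h)"
  by (simp add: refl_map_def fun_eq_iff algebra_simps)

lemma refl_map_self: "anisotropic \<beta> c \<Longrightarrow> refl_map \<beta> c \<beta> = - \<beta>"
  using anisotropic_self[of \<beta> c] by (simp add: refl_map_def fun_eq_iff)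

lemma refl_map_twice: "anisotropic \<beta> c \<Longrightarrow> refl_map \<beta> c (refl_map \<beta> c \<nu>) = \<nu>"
  using anisotropic_self[of \<beta> c] by (simp add: refl_map_def fun_eq_iff)

text \<open>The datum \<open>w\<close> is \<open>u\<close> moved by the linear reflection on roots
  and by the contragredient reflection on coroots.\<close>

definition "transported u \<beta> c w \<longleftrightarrow>
  root_of w = (\<lambda>y. refl_map \<beta> c (root_of u y)) \<and>
  coroot_of w = (\<lambda>y. coroot_of u y - s (\<beta> (coroot_of u y)) c)"

lemma transported_matrix:
  assumes "anisotropic \<beta> c" "u \<in> Sk" "transported u \<beta> c w"
  shows "A w = A u"
proof (intro ext)
  fix x y
  have c: "c \<in> cartan u" and a: "coroot_of u x \<in> cartan u"
    using anisotropic_cartan assms coroot_in_cartan[OF vs rd] by (auto simp: cartan_Sk)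
  have sub: "subspace (cartan u)" by (rule cartan_subspace[OF vs rd[OF assms(2)]])
  have lin: "f (coroot_of u x - s k c) = f (coroot_of u x) - k * f c"
    if "f \<in> dual_space s (cartan u)" for f k
  proof -
    have "f (coroot_of u x - s k c) = f (coroot_of u x + s (- k) c)" by (simp add: scale_minus_left)
    also have "\<dots> = f (coroot_of u x) + (- k) * f c"
      using that a c sub by (subst dual_space_add[OF vs that]) (auto simp: subspace_scale dual_space_scale[OF vs] simp del: scale_minus_left)
    finally show ?thesis by simp
  qed
  have "\<beta> \<in> dual_space s (cartan u)"
    using lattice_dual[OF real_lattice[OF anisotropic_real[OF assms(1)]]] assms(2) by (simp add: cartan_Sk)
  then show "A w x y = A u x y"
    using assms(3) root_in_dual[OF vs rd[OF assms(2)], of y] anisotropic_self[OF assms(1)]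
    by (simp add: cartan_matrix_def transported_def refl_map_def lin algebra_simps)
qed

text \<open>An anisotropic reflexion is a change of coordinates: it turns the datum where the root is
  simple into an isomorphic one, and isomorphic data have isomorphic skeleta.\<close>

lemma transport:
  assumes an: "anisotropic \<beta> c" and u: "u \<in> Sk"
  shows "\<exists>w\<in>Sk. transported u \<beta> c w"
proof -
  obtain u0 x where u0: "u0 \<in> Sk" "x \<in> X" "A u0 x x \<noteq> 0" "\<beta> = root_of u0 x"
    and c: "c = s (2 / A u0 x x) (coroot_of u0 x)" using an by (auto simp: anisotropic_def)
  have "u \<in> skeleton s X u0" using u skeleton_eq[OF u0(1)] by simp
  then show ?thesis
  proof induction
    \<comment> \<open>At \<open>u0\<close>, where \<beta> is simple and anisotropic, the reflexion
      of the groupoid is itself the linear reflection.\<close>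
    case 1
    have "coroot_coeff u0 x y = - (2 * \<beta> (coroot_of u0 y) / A u0 x x)" for y
      using u0 by (simp add: coroot_coeff_def Let_def cartan_matrix_def)
    then have "coroot_of (reflexion s u0 x) y = coroot_of u0 y - s (\<beta> (coroot_of u0 y)) c" for y
      using c by (simp add: coroot_of_reflexion[OF vs] scale_minus_left)
    moreover have "root_of (reflexion s u0 x) y = refl_map \<beta> c (root_of u0 y)" for y
      using u0 anisotropic_root_coeff[OF u0(1,3) c, of y]
      by (simp add: refl_map_def root_of_reflexion[OF vs] fun_eq_iff)
    ultimately have "transported u0 \<beta> c (reflexion s u0 x)" by (simp add: transported_def fun_eq_iff)
    then show ?case using refl_Sk[OF u0(1,2)] by blast
  next
    case (2 u y)
    then obtain w where w: "w \<in> Sk" "transported u \<beta> c w" by blast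
    have u: "u \<in> Sk" using 2(1) skeleton_eq[OF u0(1)] by simp
    \<comment> \<open>The coefficients of a reflexion depend on the Cartan matrix only, which
      \<open>u\<close> and \<open>w\<close> share, so reflexions at \<open>y\<close> correspond to
      each other.\<close>
    note m = transported_matrix[OF an u w(2)]
    have rc: "root_coeff w = root_coeff u" "coroot_coeff w = coroot_coeff u"
      by (simp_all add: fun_eq_iff root_coeff_def coroot_coeff_def m)
    have "\<beta> \<in> dual_space s (cartan u)"
      using lattice_dual[OF real_lattice[OF anisotropic_real[OF an]]] u by (simp add: cartan_Sk)
    then have b: "\<beta> (coroot_of u z + s k (coroot_of u y)) = \<beta> (coroot_of u z) + k * \<beta> (coroot_of u y)" for z k
      using coroot_in_cartan[OF vs rd[OF u]] subspace_scale[OF cartan_subspace[OF vs rd[OF u]]]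
      by (simp add: dual_space_add[OF vs] dual_space_scale[OF vs])
    have w': "root_of w z h = root_of u z h - root_of u z c * \<beta> h"
      "coroot_of w z = coroot_of u z - s (\<beta> (coroot_of u z)) c" for z h
      using w(2) by (simp_all add: transported_def refl_map_def)
    have "transported (reflexion s u y) \<beta> c (reflexion s w y)"
      unfolding transported_def fun_eq_iff root_of_reflexion[OF vs] coroot_of_reflexion[OF vs] rc b refl_map_def w'
      by (simp add: algebra_simps scale_right_diff_distrib scale_left_distrib)
    then show ?case using refl_Sk[OF w(1) 2(2)] by blast
  qed
qed

lemma refl_map_real:
  assumes "anisotropic \<beta> c" "\<gamma> \<in> RR"
  shows "refl_map \<beta> c \<gamma> \<in> RR"
proof -
  obtain u x where u: "u \<in> Sk" "x \<in> X" "\<gamma> = root_of u x" using assms(2) by (auto simp: real_roots_def)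
  obtain w where "w \<in> Sk" "transported u \<beta> c w" using transport[OF assms(1) u(1)] by blast
  then have "refl_map \<beta> c \<gamma> = root_of w x" using u by (simp add: transported_def)
  then show ?thesis using u \<open>w \<in> Sk\<close> unfolding real_roots_def by blast
qed

lemma anisotropic_refl:
  assumes "anisotropic \<beta> c" "anisotropic \<gamma> d"
  shows "anisotropic (refl_map \<beta> c \<gamma>) (d - s (\<beta> d) c)"
proof -
  obtain u x where u: "u \<in> Sk" "x \<in> X" "A u x x \<noteq> 0" "\<gamma> = root_of u x"
    and d: "d = s (2 / A u x x) (coroot_of u x)" using assms(2) by (auto simp: anisotropic_def)
  obtain w where w: "w \<in> Sk" "transported u \<beta> c w" using transport[OF assms(1) u(1)] by blast
  have "\<beta> \<in> dual_space s (cartan u)"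
    using lattice_dual[OF real_lattice[OF anisotropic_real[OF assms(1)]]] u by (simp add: cartan_Sk)
  then have "\<beta> d = 2 / A u x x * \<beta> (coroot_of u x)"
    using coroot_in_cartan[OF vs rd[OF u(1)]] by (simp add: d dual_space_scale[OF vs])
  then have "d - s (\<beta> d) c = s (2 / A w x x) (coroot_of w x)"
    using w(2) transported_matrix[OF assms(1) u(1) w(2)]
    by (simp add: d transported_def scale_right_diff_distrib)
  then show ?thesis
    unfolding anisotropic_def using w u transported_matrix[OF assms(1) u(1) w(2)]
    by (intro bexI[of _ w] bexI[of _ x]) (auto simp: transported_def)
qed

lemma anisotropic_uminus: "anisotropic \<beta> c \<Longrightarrow> anisotropic (- \<beta>) (- c)"
  using anisotropic_refl[of \<beta> c \<beta> c] anisotropic_self[of \<beta> c] refl_map_self[of \<beta> c]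
    scale_left_distrib[of 1 1 c] by simp

lemma real_uminus: "\<beta> \<in> RR \<Longrightarrow> - \<beta> \<in> RR"
proof -
  assume "\<beta> \<in> RR"
  then obtain u x where u: "u \<in> Sk" "x \<in> X" "\<beta> = root_of u x" by (auto simp: real_roots_def)
  then have "- \<beta> = root_of (reflexion s u x) x"
    by (simp add: root_of_reflexion[OF vs] coeff_self[OF vs] fun_eq_iff)
  then show ?thesis using u refl_Sk by (auto simp: real_roots_def)
qed

text \<open>A real root has coordinate 1 in some base, while the same coordinate of a
  \<open>k\<close>-fold lattice element is divisible by \<open>k\<close>.\<close>

lemma real_primitive:
  assumes "u \<in> Sk" "x \<in> X" "(\<lambda>h. of_int k * root_of u x h) \<in> RR"
  shows "k = 1 \<or> k = -1"
proof -
  obtain w y where w: "w \<in> Sk" "y \<in> X" "(\<lambda>h. of_int k * root_of u x h) = root_of w y"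
    using assms(3) by (auto simp: real_roots_def)
  have "1 = co w (\<lambda>h. of_int k * root_of u x h) y" using w by (simp add: co_root)
  also have "\<dots> = k * co w (root_of u x) y"
    by (rule co_scale[OF w(1) root_mem_lattice[OF root_mem[OF assms(1,2)]] w(2)])
  finally show ?thesis using zmult_eq_1_iff by metis
qed

text \<open>The two reflections with the same root \<beta> compose to a translation by k \<beta> on
  a simple root, and in the other order to the translation by -k \<beta>. Both translates are real
  roots, so the absence of mixed signs forces k = 0.\<close>

lemma coroot_unique:
  assumes "anisotropic \<beta> c" "anisotropic \<beta> d" "\<nu> \<in> lattice"
  shows "\<nu> c = \<nu> d"
proof -
  obtain u x where u: "u \<in> Sk" "x \<in> X" "\<beta> = root_of u x" using assms(1) by (auto simp: anisotropic_def)
  have eq: "root_of u y c = root_of u y d" if y: "y \<in> X" for y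
  proof (cases "y = x")
    case True
    then show ?thesis using u anisotropic_self assms by metis
  next
    case False
    let ?\<eta> = "root_of u y"
    define k where "k = pairing ?\<eta> d - pairing ?\<eta> c"
    have r: "?\<eta> \<in> RR" using u y by (auto simp: real_roots_def)
    have 1: "of_int k = ?\<eta> d - ?\<eta> c"
      using pairing_eq[OF assms(1) real_lattice[OF r]] pairing_eq[OF assms(2) real_lattice[OF r]]
      by (simp add: k_def)
    have self: "\<beta> c = 2" "\<beta> d = 2" using assms anisotropic_self by blast+
    have "refl_map \<beta> c (refl_map \<beta> d ?\<eta>) = (\<lambda>h. of_int 1 * ?\<eta> h) + (\<lambda>h. of_int k * root_of u x h)"
      "refl_map \<beta> d (refl_map \<beta> c ?\<eta>) = (\<lambda>h. of_int 1 * ?\<eta> h) + (\<lambda>h. of_int (- k) * root_of u x h)"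
      by (simp_all add: refl_map_def fun_eq_iff 1 self u(3)[symmetric] algebra_simps)
    then have mem: "comb u (\<lambda>z. (if z = y then 1 else 0) + (if z = x then k else 0)) \<in> \<Phi>"
        "comb u (\<lambda>z. (if z = y then 1 else 0) + (if z = x then - k else 0)) \<in> \<Phi>"
      unfolding int_comb_single[OF finX u(2), symmetric] int_comb_single[OF finX y, symmetric] int_comb_add
      using refl_map_real[OF assms(1) refl_map_real[OF assms(2) r]]
        refl_map_real[OF assms(2) refl_map_real[OF assms(1) r]] by (auto dest: real_\<Phi>)
    have "\<not> k < 0" "\<not> - k < 0"
      using no_mixed_signs[OF u(1) mem(1) u(2) y] no_mixed_signs[OF u(1) mem(2) u(2) y] False by auto
    then show ?thesis using 1 by simp
  qed
  obtain n where "\<nu> = comb u n" using assms(3) lattice_eq[OF u(1)] by auto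
  then show ?thesis by (simp add: int_comb_def eq)
qed

text \<open>The reflection at \<beta> fixes \<alpha>, so it carries \<open>c\<close> to another
  coroot of \<alpha>, on which \<beta> has the value -\<beta>(c). Uniqueness of coroots gives
  \<beta>(c) = 0.\<close>

lemma pairing_symmetric_zero:
  assumes "anisotropic \<alpha> c" "anisotropic \<beta> d" "pairing \<alpha> d = 0"
  shows "pairing \<beta> c = 0"
proof -
  have l: "\<alpha> \<in> lattice" "\<beta> \<in> lattice" using assms anisotropic_real real_lattice by blast+
  have "\<alpha> d = 0" using pairing_eq[OF assms(2) l(1)] assms(3) by simp
  then have "refl_map \<beta> d \<alpha> = \<alpha>" by (simp add: refl_map_def)
  then have "anisotropic \<alpha> (c - s (\<beta> c) d)" using anisotropic_refl[OF assms(2,1)] by simp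
  from coroot_unique[OF assms(1) this l(2)]
  have "\<beta> c = \<beta> (c - s (\<beta> c) d)" .
  also have "\<dots> = \<beta> (c + s (- \<beta> c) d)" by (simp add: scale_minus_left)
  also have "\<dots> = \<beta> c + (- \<beta> c) * \<beta> d"
    using lattice_dual[OF l(2)] anisotropic_cartan[OF assms(1)] anisotropic_cartan[OF assms(2)]
      subspace_scale[OF cartan_subspace[OF vs rdv]]
    by (simp add: dual_space_add[OF vs] dual_space_scale[OF vs] del: scale_minus_left)
  finally have "\<beta> c = 0" using anisotropic_self[OF assms(2)] by simp
  then show ?thesis by (simp add: pairing_def)
qed

text \<open>Bases are matched in both directions because no inverse of \<open>g\<close> is part of
  the data. Cartan matrices are preserved so that anisotropic roots go to anisotropic roots.\<close>

definition "symmetry g \<longleftrightarrow>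
  (\<forall>\<nu>\<in>lattice. \<forall>\<mu>\<in>lattice. g (\<nu> + \<mu>) = g \<nu> + g \<mu>) \<and>
  (\<forall>\<nu>\<in>lattice. g \<nu> \<in> lattice) \<and>
  (\<forall>u\<in>Sk. \<exists>w\<in>Sk. A w = A u \<and> (\<forall>x. root_of w x = g (root_of u x))) \<and>
  (\<forall>w\<in>Sk. \<exists>u\<in>Sk. A w = A u \<and> (\<forall>x. root_of w x = g (root_of u x)))"

lemma symmetry_refl_map:
  assumes "anisotropic \<beta> c"
  shows "symmetry (refl_map \<beta> c)"
proof -
  have 1: "\<exists>w\<in>Sk. A w = A u \<and> (\<forall>x. root_of w x = refl_map \<beta> c (root_of u x))" if u: "u \<in> Sk" for u
  proof -
    obtain w where w: "w \<in> Sk" "transported u \<beta> c w" using transport[OF assms u] by blast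
    then show ?thesis
      using transported_matrix[OF assms u w(2)] by (intro bexI[of _ w]) (auto simp: transported_def)
  qed
  show ?thesis
    unfolding symmetry_def
  proof (intro conjI ballI)
    fix w assume "w \<in> Sk"
    then show "\<exists>u\<in>Sk. A u = A w \<and> (\<forall>x. root_of u x = refl_map \<beta> c (root_of w x))" by (rule 1)
    from 1[OF \<open>w \<in> Sk\<close>] obtain u where u: "u \<in> Sk" "A u = A w"
      and w: "\<And>x. root_of u x = refl_map \<beta> c (root_of w x)" by blast
    have "root_of w x = refl_map \<beta> c (root_of u x)" for x
      unfolding w refl_map_twice[OF assms] ..
    with u show "\<exists>u\<in>Sk. A w = A u \<and> (\<forall>x. root_of w x = refl_map \<beta> c (root_of u x))"
      by (intro bexI[of _ u]) simp_all
  qed (use refl_map_add refl_map_lattice[OF assms] in auto)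
qed

lemma symmetry_add: "symmetry g \<Longrightarrow> \<nu> \<in> lattice \<Longrightarrow> \<mu> \<in> lattice \<Longrightarrow> g (\<nu> + \<mu>) = g \<nu> + g \<mu>"
  and symmetry_lattice: "symmetry g \<Longrightarrow> \<nu> \<in> lattice \<Longrightarrow> g \<nu> \<in> lattice"
  by (simp_all add: symmetry_def)

lemma symmetry_forward:
  assumes "symmetry g" "u \<in> Sk"
  obtains w where "w \<in> Sk" "A w = A u" "\<And>x. root_of w x = g (root_of u x)"
  using assms by (auto simp: symmetry_def)

lemma symmetry_backward:
  assumes "symmetry g" "w \<in> Sk"
  obtains u where "u \<in> Sk" "A w = A u" "\<And>x. root_of w x = g (root_of u x)"
  using assms by (auto simp: symmetry_def)

lemma symmetry_comp:
  assumes g: "symmetry g" and k: "symmetry k"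
  shows "symmetry (g \<circ> k)"
  unfolding symmetry_def
proof (intro conjI ballI)
  fix \<nu> assume l: "\<nu> \<in> lattice"
  then show "(g \<circ> k) \<nu> \<in> lattice" using g k by (simp add: symmetry_lattice)
  show "(g \<circ> k) (\<nu> + \<mu>) = (g \<circ> k) \<nu> + (g \<circ> k) \<mu>" if "\<mu> \<in> lattice" for \<mu>
    unfolding comp_def symmetry_add[OF k l that]
    by (rule symmetry_add[OF g]) (simp_all add: l that symmetry_lattice[OF k])
next
  fix u assume "u \<in> Sk"
  then obtain w where w: "w \<in> Sk" "A w = A u" "\<And>x. root_of w x = k (root_of u x)"
    by (rule symmetry_forward[OF k]) blast
  obtain w' where "w' \<in> Sk" "A w' = A w" "\<And>x. root_of w' x = g (root_of w x)"
    by (rule symmetry_forward[OF g w(1)]) blast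
  with w show "\<exists>w\<in>Sk. A w = A u \<and> (\<forall>x. root_of w x = (g \<circ> k) (root_of u x))"
    by (intro bexI[of _ w']) simp_all
next
  fix w assume "w \<in> Sk"
  then obtain u where u: "u \<in> Sk" "A w = A u" "\<And>x. root_of w x = g (root_of u x)"
    by (rule symmetry_backward[OF g]) blast
  obtain u' where "u' \<in> Sk" "A u = A u'" "\<And>x. root_of u x = k (root_of u' x)"
    by (rule symmetry_backward[OF k u(1)]) blast
  with u show "\<exists>u\<in>Sk. A w = A u \<and> (\<forall>x. root_of w x = (g \<circ> k) (root_of u x))"
    by (intro bexI[of _ u']) simp_all
qed

lemma symmetry_id: "symmetry id"
  by (auto simp: symmetry_def)

lemma symmetry_scale:
  assumes g: "symmetry g" and l: "\<nu> \<in> lattice"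
  shows "g (\<lambda>h. of_int k * \<nu> h) = (\<lambda>h. of_int k * g \<nu> h)"
proof -
  have add: "g (\<mu> + \<mu>') = g \<mu> + g \<mu>'" if "\<mu> \<in> lattice" "\<mu>' \<in> lattice" for \<mu> \<mu>'
    using g that by (simp add: symmetry_def)
  have z: "g 0 = 0" using add[of 0 0] lattice_zero by simp
  have n: "g (\<lambda>h. of_nat n * \<nu> h) = (\<lambda>h. of_nat n * g \<nu> h)" for n
  proof (induction n)
    case 0
    then show ?case using z by (simp add: zero_fun_def)
  next
    case (Suc n)
    have "(\<lambda>h. of_nat (Suc n) * \<nu> h) = \<nu> + (\<lambda>h. of_int (int n) * \<nu> h)"
      by (simp add: fun_eq_iff algebra_simps)
    then have "g (\<lambda>h. of_nat (Suc n) * \<nu> h) = g \<nu> + g (\<lambda>h. of_int (int n) * \<nu> h)"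
      using add[OF l lattice_scale[OF l]] by metis
    then show ?case using Suc by (simp add: fun_eq_iff algebra_simps)
  qed
  have m: "g (- \<mu>) = - g \<mu>" if "\<mu> \<in> lattice" for \<mu>
    using add[OF that lattice_uminus[OF that]] z by (simp add: eq_neg_iff_add_eq_0 add.commute)
  show ?thesis
  proof (cases k)
    case (nonneg n)
    then show ?thesis using n[of n] by simp
  next
    case (neg n)
    let ?M = "\<lambda>h. of_nat (Suc n) * \<nu> h"
    have 1: "(\<lambda>h. of_int k * \<nu> h) = - ?M" unfolding neg by (simp add: fun_eq_iff algebra_simps)
    have 2: "g (- ?M) = - g ?M"
      using m[OF lattice_scale[OF l, of "int (Suc n)"]] by (simp only: of_int_of_nat_eq)
    show ?thesis unfolding 1 2 n unfolding neg by (simp add: fun_eq_iff algebra_simps)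
  qed
qed

lemma symmetry_sum:
  assumes g: "symmetry g" and l: "\<And>i. i \<in> S \<Longrightarrow> f i \<in> lattice"
  shows "g (sum f S) = (\<Sum>i\<in>S. g (f i))"
proof -
  have z: "g 0 = 0" using symmetry_scale[OF g lattice_zero, of 0] by (simp add: zero_fun_def)
  show ?thesis using l
  proof (induction S rule: infinite_finite_induct)
    case (insert i S)
    have ih: "g (sum f S) = (\<Sum>i\<in>S. g (f i))" by (rule insert(3)) (use insert(4) in auto)
    have "g (f i + sum f S) = g (f i) + g (sum f S)"
      by (rule symmetry_add[OF g]) (use insert in \<open>auto intro: lattice_sum\<close>)
    then show ?case unfolding sum.insert[OF insert(1,2)] by (simp only: ih)
  qed (simp_all add: z)
qed

lemma symmetry_comb:
  assumes g: "symmetry g" and u: "u \<in> Sk" and w: "\<And>x. root_of w x = g (root_of u x)"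
  shows "g (comb u n) = comb w n"
proof -
  have l: "root_of u x \<in> lattice" if "x \<in> X" for x
    using root_mem_lattice root_mem[OF u that] by blast
  have "g (comb u n) = (\<Sum>x\<in>X. g (\<lambda>h. of_int (n x) * root_of u x h))"
    unfolding int_comb_sum[of u] by (rule symmetry_sum[OF g]) (simp add: l lattice_scale)
  also have "\<dots> = (\<Sum>x\<in>X. (\<lambda>h. of_int (n x) * root_of w x h))"
    unfolding w by (rule sum.cong[OF HOL.refl]) (rule symmetry_scale[OF g l])
  finally show ?thesis by (simp add: int_comb_sum)
qed

lemma symmetry_pos:
  assumes g: "symmetry g" and u: "u \<in> Sk" and w: "w \<in> Sk" "\<And>x. root_of w x = g (root_of u x)"
    and l: "\<nu> \<in> lattice"
  shows "pos w (g \<nu>) \<longleftrightarrow> pos u \<nu>"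
proof -
  have "g \<nu> = comb w (co u \<nu>)" using symmetry_comb[OF g u w(2)] comb_co[OF u l] by metis
  then show ?thesis using u w l
    by (simp add: pos_iff symmetry_lattice[OF g] co_comb comb_in_lattice)
qed

lemma symmetry_inject:
  assumes g: "symmetry g" and l: "\<nu> \<in> lattice" "g \<nu> = 0"
  shows "\<nu> = 0"
proof -
  have v: "v \<in> Sk" by (rule skeleton.intros)
  obtain w where w: "w \<in> Sk" "\<And>x. root_of w x = g (root_of v x)"
    by (rule symmetry_forward[OF g v]) blast
  have "comb w (co v \<nu>) = comb w (\<lambda>_. 0)"
    using symmetry_comb[OF g v, of w "co v \<nu>"] w(2) comb_co[OF v l(1)] l(2) by (simp add: int_comb_zero)
  then have "\<And>x. x \<in> X \<Longrightarrow> co v \<nu> x = 0" using comb_inject[OF w(1)] by blast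
  then show ?thesis using co_zero_imp[OF v l(1)] by blast
qed

lemma symmetry_real: "symmetry g \<Longrightarrow> \<beta> \<in> RR \<Longrightarrow> g \<beta> \<in> RR"
proof -
  assume g: "symmetry g" and "\<beta> \<in> RR"
  then obtain u x where u: "u \<in> Sk" "x \<in> X" "\<beta> = root_of u x" by (auto simp: real_roots_def)
  obtain w where "w \<in> Sk" "\<And>x. root_of w x = g (root_of u x)"
    by (rule symmetry_forward[OF g u(1)]) blast
  then have "g \<beta> = root_of w x" "w \<in> Sk" using u by auto
  then show ?thesis using u unfolding real_roots_def by blast
qed

text \<open>If \<open>g\<close> carries the base of \<open>w\<close> to that of \<open>u\<close>,
  then positivity of \<open>g \<beta>\<close> at \<open>u\<close> is positivity of \<beta> at
  \<open>w\<close>; a sign change means that \<beta> separates the two chambers.\<close>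

lemma finite_sign_change:
  assumes g: "symmetry g" and u: "u \<in> Sk"
  shows "finite {\<beta> \<in> RR. pos u (g \<beta>) \<noteq> pos u \<beta>}"
proof -
  obtain w where w: "w \<in> Sk" "\<And>x. root_of u x = g (root_of w x)"
    by (rule symmetry_backward[OF g u]) blast
  have "{\<beta> \<in> RR. pos u (g \<beta>) \<noteq> pos u \<beta>} \<subseteq>
      {\<beta> \<in> \<Phi>. pos u \<beta> \<and> \<not> pos w \<beta>} \<union> {\<beta> \<in> \<Phi>. pos w \<beta> \<and> \<not> pos u \<beta>}"
    using symmetry_pos[OF g w(1) u] w(2) real_\<Phi> real_lattice by blast
  then show ?thesis using finite_separated[OF u w(1)] finite_separated[OF w(1) u]
    by (meson finite_UnI finite_subset)
qed

text \<open>The rotation \<open>g\<close> has trace \<open>p q - 2 \<le> -3\<close> on the plane of the two roots, so heights along an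
  orbit of \<open>g\<close> grow in absolute value, whereas \<open>g\<close> changes the sign of finitely many roots only.\<close>

lemma anisotropic_product_nonneg:
  assumes \<alpha>: "anisotropic \<alpha> c" and \<beta>: "anisotropic \<beta> d"
  shows "0 \<le> pairing \<alpha> d * pairing \<beta> c"
proof (rule ccontr)
  define p q where "p = pairing \<alpha> d" and "q = pairing \<beta> c"
  define t where "t = p * q - 2"
  assume "\<not> 0 \<le> pairing \<alpha> d * pairing \<beta> c"
  then have t: "t \<le> - 3" by (simp add: p_def q_def t_def)
  obtain u x where u: "u \<in> Sk" "x \<in> X" "\<alpha> = root_of u x" using \<alpha> by (auto simp: anisotropic_def)
  have r: "\<alpha> \<in> RR" "\<beta> \<in> RR" using \<alpha> \<beta> anisotropic_real by auto
  note l = r[THEN real_lattice]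
  define g where "g = refl_map \<alpha> c \<circ> refl_map \<beta> d"
  have g: "symmetry g" unfolding g_def by (intro symmetry_comp symmetry_refl_map \<alpha> \<beta>)
  have val: "\<alpha> c = 2" "\<beta> d = 2" "\<alpha> d = of_int p" "\<beta> c = of_int q"
    using anisotropic_self[OF \<alpha>] anisotropic_self[OF \<beta>] pairing_eq[OF \<beta> l(1)] pairing_eq[OF \<alpha> l(2)]
    by (auto simp: p_def q_def)
  define \<zeta> where "\<zeta> k = (g ^^ k) \<alpha>" for k
  have \<zeta>Suc: "\<zeta> (Suc k) = g (\<zeta> k)" for k by (simp add: \<zeta>_def)
  have \<zeta>r: "\<zeta> k \<in> RR" for k
    by (induction k) (use symmetry_real[OF g] r(1) \<zeta>Suc in \<open>auto simp: \<zeta>_def\<close>)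
  note \<zeta>l = real_lattice[OF \<zeta>r]
  \<comment> \<open>This is Cayley-Hamilton for the rotation, of determinant 1 and trace
    \<open>t\<close>; by linearity the first instance implies the others.\<close>
  have rec: "\<zeta> (Suc (Suc k)) = (\<lambda>h. of_int t * \<zeta> (Suc k) h) - \<zeta> k" for k
  proof (induction k)
    case 0
    show ?case
      by (simp add: \<zeta>_def g_def refl_map_def fun_eq_iff val t_def algebra_simps)
  next
    case (Suc k)
    have "\<zeta> (Suc (Suc (Suc k))) = g ((\<lambda>h. of_int t * \<zeta> (Suc k) h) - \<zeta> k)"
      using Suc \<zeta>Suc by metis
    also have "\<dots> = (\<lambda>h. of_int t * g (\<zeta> (Suc k)) h) - g (\<zeta> k)"
      by (simp add: g_def refl_map_diff refl_map_scale)
    finally show ?case by (simp add: \<zeta>Suc)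
  qed
  define H where "H k = ht u (\<zeta> k)" for k
  have Hrec: "H (Suc (Suc k)) = t * H (Suc k) - H k" for k
    unfolding H_def rec using \<zeta>l by (simp add: ht_diff ht_scale lattice_scale u(1))
  have H0: "H 0 = 1" using u by (simp add: H_def \<zeta>_def ht_root)
  have nz: "H k \<noteq> 0" for k
  proof -
    have "0 < H k \<or> H k < 0"
      using coherent_ht(1,2)[OF u(1) real_\<Phi>[OF \<zeta>r] real_nonzero[OF \<zeta>r], of k] unfolding H_def by blast
    then show ?thesis by auto
  qed
  have step: "\<bar>H (Suc k)\<bar> < \<bar>H (Suc (Suc k))\<bar>" if "\<bar>H k\<bar> \<le> \<bar>H (Suc k)\<bar>" for k
  proof -
    have "3 * \<bar>H (Suc k)\<bar> \<le> \<bar>t * H (Suc k)\<bar>"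
      using t mult_right_mono[of 3 "\<bar>t\<bar>" "\<bar>H (Suc k)\<bar>"] by (simp add: abs_mult)
    then show ?thesis using that nz[of "Suc k"] Hrec[of k] by linarith
  qed
  have mono: "\<bar>H k\<bar> \<le> \<bar>H (Suc k)\<bar>" for k
  proof (induction k)
    case 0
    then show ?case using H0 nz[of 1] by simp
  qed (use step in force)
  have "strict_mono (\<lambda>k. \<bar>H (Suc k)\<bar>)" using step[OF mono] by (simp add: strict_mono_Suc_iff)
  then have "inj (\<lambda>k. \<zeta> (Suc k))"
    by (intro injI) (metis H_def strict_mono_eq)
  then have "finite {k. \<zeta> (Suc k) \<in> {\<beta> \<in> RR. pos u (g \<beta>) \<noteq> pos u \<beta>}}"
    using finite_vimageI[OF finite_sign_change[OF g u(1)], of "\<lambda>k. \<zeta> (Suc k)"] by (simp add: vimage_def)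
  then obtain K where K: "\<And>k. \<zeta> (Suc k) \<in> {\<beta> \<in> RR. pos u (g \<beta>) \<noteq> pos u \<beta>} \<Longrightarrow> k < K"
    using finite_nat_set_iff_bounded by auto
  then have same: "pos u (\<zeta> (Suc (Suc k))) = pos u (\<zeta> (Suc k))" if "K \<le> k" for k
  proof -
    have "\<not> k < K" using that by simp
    then have "\<zeta> (Suc k) \<notin> {\<beta> \<in> RR. pos u (g \<beta>) \<noteq> pos u \<beta>}" using K by blast
    then show ?thesis using \<zeta>r[of "Suc k"] \<zeta>Suc[of "Suc k"] by simp
  qed
  have sgn: "pos u (\<zeta> k) \<longleftrightarrow> 0 < H k" for k
    using coherent_ht[OF u(1) real_\<Phi>[OF \<zeta>r] real_nonzero[OF \<zeta>r]] by (simp add: H_def)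
  have "(0 < H (Suc (Suc K))) = (0 < H (Suc K))" "(0 < H (Suc (Suc (Suc K)))) = (0 < H (Suc (Suc K)))"
    using same[of K] same[of "Suc K"] by (auto simp: sgn)
  then have pn: "0 < H (Suc K) \<and> 0 < H (Suc (Suc K)) \<and> 0 < H (Suc (Suc (Suc K))) \<or>
      H (Suc K) < 0 \<and> H (Suc (Suc K)) < 0 \<and> H (Suc (Suc (Suc K))) < 0"
  proof (cases "0 < H (Suc (Suc K))")
    case False
    then have "\<not> 0 < H (Suc K)" "\<not> 0 < H (Suc (Suc (Suc K)))"
      using \<open>(0 < H (Suc (Suc K))) = (0 < H (Suc K))\<close>
        \<open>(0 < H (Suc (Suc (Suc K)))) = (0 < H (Suc (Suc K)))\<close> by blast+
    with False show ?thesis using nz by (simp add: not_less order_less_le)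
  qed blast
  \<comment> \<open>Three consecutive heights of the same sign are incompatible with the negative
    trace.\<close>
  have "H (Suc (Suc (Suc K))) + H (Suc K) = t * H (Suc (Suc K))" by (simp add: Hrec)
  moreover have "0 < H (Suc (Suc K)) \<Longrightarrow> t * H (Suc (Suc K)) < 0"
    "H (Suc (Suc K)) < 0 \<Longrightarrow> 0 < t * H (Suc (Suc K))"
    using t by (simp_all add: mult_less_0_iff zero_less_mult_iff)
  ultimately show False using pn by auto
qed

end

section \<open>Type Fin and the finiteness of the set of roots\<close>

text \<open>When two roots have pairings \<open>- a\<close> and \<open>- b\<close>, the coefficients
  of the roots obtained by alternating their reflections satisfy this three-term recursion, whose
  multiplier alternates with the reflection.\<close>

fun dihedral_seq :: "int \<Rightarrow> int \<Rightarrow> int \<Rightarrow> int \<Rightarrow> nat \<Rightarrow> int" where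
  "dihedral_seq a b x y 0 = x"
| "dihedral_seq a b x y (Suc 0) = y"
| "dihedral_seq a b x y (Suc (Suc n)) =
     (if even n then b else a) * dihedral_seq a b x y (Suc n) - dihedral_seq a b x y n"

text \<open>Each step of the recursion acts on consecutive pairs by a matrix of determinant
  1.\<close>

lemma dihedral_seq_wronskian:
  "dihedral_seq a b x y n * dihedral_seq a b x' y' (Suc n) -
   dihedral_seq a b x y (Suc n) * dihedral_seq a b x' y' n = x * y' - y * x'"
proof (induction n)
  case (Suc n)
  then show ?case by (simp add: algebra_simps)
qed simp

lemma dihedral_seq_linear:
  "dihedral_seq a b x y n * k + dihedral_seq a b x' y' n * l =
   dihedral_seq a b (x * k + x' * l) (y * k + y' * l) n"
proof (induction n rule: induct_nat_012)
  case (ge2 n)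
  have "dihedral_seq a b x y (Suc (Suc n)) * k + dihedral_seq a b x' y' (Suc (Suc n)) * l =
    (if even n then b else a) * (dihedral_seq a b x y (Suc n) * k + dihedral_seq a b x' y' (Suc n) * l) -
    (dihedral_seq a b x y n * k + dihedral_seq a b x' y' n * l)"
    by (simp add: algebra_simps)
  then show ?case unfolding ge2 by simp
qed simp_all

text \<open>The inequality between 2 X(n) and k(n) X(n+1) is an invariant. It is passed on because
  k(n+1) k(n) = a b is at least 4, the case of an infinite dihedral group.\<close>

lemma dihedral_seq_nonneg:
  assumes "0 < a" "0 < b" "4 \<le> a * b" "0 \<le> x" "0 \<le> y" "2 * x \<le> b * y"
  shows "0 \<le> dihedral_seq a b x y n"
proof -
  let ?X = "dihedral_seq a b x y"
  define k where "k n = (if even (n::nat) then b else a)" for n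
  have rec: "?X (Suc (Suc n)) = k n * ?X (Suc n) - ?X n" for n by (simp add: k_def)
  have "0 \<le> ?X (Suc n) \<and> 2 * ?X n \<le> k n * ?X (Suc n)" for n
  proof (induction n)
    case (Suc n)
    have c: "0 < k n" "0 < k (Suc n)" "k (Suc n) * k n = a * b" using assms by (auto simp: k_def)
    have 1: "k n * ?X (Suc n) \<le> 2 * ?X (Suc (Suc n))"
    proof -
      have *: "2 * q \<le> p \<Longrightarrow> p \<le> 2 * (p - q)" for p q :: int by simp
      show ?thesis unfolding rec by (rule *) (rule Suc[THEN conjunct2])
    qed
    moreover have "0 \<le> k n * ?X (Suc n)" using Suc c by simp
    moreover have "4 * ?X (Suc n) \<le> k (Suc n) * (k n * ?X (Suc n))"
      unfolding mult.assoc[symmetric] c(3) using Suc assms(3) by (intro mult_right_mono) auto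
    moreover have "k (Suc n) * (k n * ?X (Suc n)) \<le> k (Suc n) * (2 * ?X (Suc (Suc n)))"
      using 1 c by (intro mult_left_mono) auto
    ultimately show ?case by linarith
  qed (use assms in \<open>simp add: k_def\<close>)
  then show ?thesis by (cases n) (use assms in auto)
qed

text \<open>The invariant of \<open>dihedral_seq_nonneg\<close> in strict form; X(n+2) - X(n) = k(n)
  X(n+1) - 2 X(n) is then positive.\<close>

lemma dihedral_seq_growth:
  assumes "0 < a" "0 < b" "4 \<le> a * b" "x < 0" "0 < y"
  shows "dihedral_seq a b x y n < dihedral_seq a b x y (Suc (Suc n))"
proof -
  let ?X = "dihedral_seq a b x y"
  define k where "k n = (if even (n::nat) then b else a)" for n
  have rec: "?X (Suc (Suc n)) = k n * ?X (Suc n) - ?X n" for n by (simp add: k_def)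
  have "0 < ?X (Suc n) \<and> 2 * ?X n < k n * ?X (Suc n)" for n
  proof (induction n)
    case 0
    have "2 * x < 0" "0 < b * y" using assms by auto
    then have "2 * x < b * y" by linarith
    then show ?case using assms by (simp add: k_def)
  next
    case (Suc n)
    have c: "0 < k n" "0 < k (Suc n)" "k (Suc n) * k n = a * b" using assms by (auto simp: k_def)
    have 1: "k n * ?X (Suc n) < 2 * ?X (Suc (Suc n))"
    proof -
      have *: "2 * q < p \<Longrightarrow> p < 2 * (p - q)" for p q :: int by simp
      show ?thesis unfolding rec by (rule *) (rule Suc[THEN conjunct2])
    qed
    moreover have "0 < k n * ?X (Suc n)" using Suc c by simp
    moreover have "4 * ?X (Suc n) \<le> k (Suc n) * (k n * ?X (Suc n))"
      unfolding mult.assoc[symmetric] c(3) using Suc assms(3) by (intro mult_right_mono) auto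
    moreover have "k (Suc n) * (k n * ?X (Suc n)) < k (Suc n) * (2 * ?X (Suc (Suc n)))"
      using 1 c by (intro mult_strict_left_mono) auto
    ultimately show ?case by linarith
  qed
  from this[of n, THEN conjunct2] show ?thesis unfolding rec by linarith
qed

text \<open>In the coordinates given by the two sequences, two steps amount to one application of
  the product of both reflections. The induction goes by two because the multiplier
  alternates.\<close>

lemma dihedral_seq_rotation:
  "dihedral_seq a b 0 1 (Suc (Suc n)) =
     b * (a * dihedral_seq a b 0 1 n - dihedral_seq a b (-1) 0 n) - dihedral_seq a b 0 1 n \<and>
   dihedral_seq a b (-1) 0 (Suc (Suc n)) = a * dihedral_seq a b 0 1 n - dihedral_seq a b (-1) 0 n"
proof (induction n rule: less_induct)
  case (less n)
  consider "n = 0" | "n = 1" | m where "n = Suc (Suc m)" by (metis One_nat_def not0_implies_Suc)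
  then show ?case
  proof cases
    case 3
    then have IH: "dihedral_seq a b 0 1 (Suc (Suc m)) =
     b * (a * dihedral_seq a b 0 1 m - dihedral_seq a b (-1) 0 m) - dihedral_seq a b 0 1 m"
   "dihedral_seq a b (-1) 0 (Suc (Suc m)) = a * dihedral_seq a b 0 1 m - dihedral_seq a b (-1) 0 m"
    "dihedral_seq a b 0 1 (Suc (Suc (Suc m))) =
     b * (a * dihedral_seq a b 0 1 (Suc m) - dihedral_seq a b (-1) 0 (Suc m)) - dihedral_seq a b 0 1 (Suc m)"
   "dihedral_seq a b (-1) 0 (Suc (Suc (Suc m))) = a * dihedral_seq a b 0 1 (Suc m) - dihedral_seq a b (-1) 0 (Suc m)"
      using less[of m] less[of "Suc m"] by auto
    have rec: "dihedral_seq a b x y (Suc (Suc (Suc (Suc m)))) =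
     (if even m then b else a) * dihedral_seq a b x y (Suc (Suc (Suc m))) - dihedral_seq a b x y (Suc (Suc m))"
     "dihedral_seq a b x y (Suc (Suc m)) =
     (if even m then b else a) * dihedral_seq a b x y (Suc m) - dihedral_seq a b x y m" for x y by simp_all
    show ?thesis unfolding 3 rec(1) IH(3,4)
      unfolding IH(1,2) using IH(1,2) unfolding rec(2) by algebra
  qed simp_all
qed

locale root_chambers_fin = root_chambers +
  assumes fin: "(\<Inter>u\<in>skeleton s X v. positive_cone X u) = {\<lambda>_. 0}"
begin

interpretation vector_space s by (rule vs)

lemma fin_zero: "(\<And>u. u \<in> Sk \<Longrightarrow> pos u \<nu>) \<Longrightarrow> \<nu> = 0"
  using fin by (auto simp: zero_fun_def)

lemma pos_combination:
  assumes u: "u \<in> Sk" and \<nu>: "pos u \<nu>" and \<mu>: "pos u \<mu>" and "0 \<le> k" "0 \<le> l"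
  shows "pos u (\<lambda>h. of_int k * \<nu> h + of_int l * \<mu> h)"
proof -
  obtain n m where n: "\<nu> = comb u n" "\<forall>x\<in>X. 0 \<le> n x" "\<mu> = comb u m" "\<forall>x\<in>X. 0 \<le> m x"
    using \<nu> \<mu> by (auto simp: positive_cone_iff)
  have "(\<lambda>h. of_int k * \<nu> h + of_int l * \<mu> h) = comb u (\<lambda>x. k * n x + l * m x)"
    by (simp add: n fun_eq_iff int_comb_def sum_distrib_left sum.distrib algebra_simps)
  moreover have "\<forall>x\<in>X. 0 \<le> k * n x + l * m x" using n assms by simp
  ultimately show ?thesis unfolding positive_cone_iff by blast
qed

lemma ht_combination:
  assumes "u \<in> Sk" "\<nu> \<in> lattice" "\<mu> \<in> lattice"
  shows "ht u (\<lambda>h. of_int k * \<nu> h + of_int l * \<mu> h) = k * ht u \<nu> + l * ht u \<mu>"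
proof -
  have "(\<lambda>h. of_int k * \<nu> h + of_int l * \<mu> h) = (\<lambda>h. of_int k * \<nu> h) + (\<lambda>h. of_int l * \<mu> h)"
    by (simp add: fun_eq_iff)
  then show ?thesis using ht_add[OF assms(1) lattice_scale lattice_scale] assms by (simp add: ht_scale)
qed

text \<open>The real roots obtained from \<open>\<alpha>\<close> by alternating the two reflections are infinitely many and
  positive at \<open>u\<close>, so one of them is positive at \<open>w\<close>; the given combination lies in the cone of the
  first two consecutive ones between which the sign at \<open>w\<close> changes.\<close>

lemma dihedral_cone:
  assumes \<alpha>: "anisotropic \<alpha> c" and \<beta>: "anisotropic \<beta> d"
    and p: "pairing \<alpha> d = - a" "pairing \<beta> c = - b" and ab: "0 < a" "0 < b" "4 \<le> a * b"
    and u: "u \<in> Sk" "pos u \<alpha>" "pos u \<beta>" and w: "w \<in> Sk" "\<not> pos w \<alpha>"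
    and r: "0 \<le> r0" "0 \<le> r1" "2 * r0 \<le> b * r1"
  shows "pos w (\<lambda>h. of_int r0 * \<alpha> h + of_int r1 * \<beta> h)"
proof -
  have re: "\<alpha> \<in> RR" "\<beta> \<in> RR" using \<alpha> \<beta> anisotropic_real by auto
  note l = re[THEN real_lattice]
  have val: "\<alpha> c = 2" "\<beta> d = 2" "\<alpha> d = - of_int a" "\<beta> c = - of_int b"
    using anisotropic_self[OF \<alpha>] anisotropic_self[OF \<beta>] pairing_eq[OF \<beta> l(1)] pairing_eq[OF \<alpha> l(2)] p
    by auto
  \<comment> \<open>The initial values (0, -1) and (1, 0) of the coefficient pairs stand for
    -\<beta> and \<alpha>, from which the orbit starts.\<close>
  define P Q where "P = dihedral_seq a b 0 1" and "Q = dihedral_seq a b (-1) 0"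
  define \<eta> where "\<eta> n = (\<lambda>h. of_int (P n) * \<alpha> h + of_int (Q n) * \<beta> h)" for n
  define R where "R = dihedral_seq a b r0 r1"
  have rot: "\<eta> (Suc (Suc n)) = refl_map \<alpha> c (refl_map \<beta> d (\<eta> n))" for n
  proof -
    have 1: "P (Suc (Suc n)) = b * (a * P n - Q n) - P n" "Q (Suc (Suc n)) = a * P n - Q n"
      unfolding P_def Q_def using dihedral_seq_rotation by blast+
    show ?thesis unfolding \<eta>_def 1
      by (simp add: refl_map_def fun_eq_iff val algebra_simps)
  qed
  have \<eta>01: "\<eta> 0 = - \<beta>" "\<eta> (Suc 0) = \<alpha>" by (simp_all add: \<eta>_def P_def Q_def fun_eq_iff)
  have \<eta>r: "\<eta> n \<in> RR \<and> \<eta> (Suc n) \<in> RR" for n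
  proof (induction n)
    case 0
    show ?case unfolding \<eta>01 using re real_uminus by blast
  next
    case (Suc n)
    then show ?case unfolding rot using refl_map_real[OF \<alpha> refl_map_real[OF \<beta>]] by blast
  qed
  have sgn: "pos w' (\<eta> n) \<or> pos w' (- \<eta> n)" if "w' \<in> Sk" for w' n
    using coherent[OF that real_\<Phi>] \<eta>r by blast
  define H where "H n = ht u (\<eta> n)" for n
  have "H n = dihedral_seq a b (- ht u \<beta>) (ht u \<alpha>) n" for n
    unfolding H_def \<eta>_def ht_combination[OF u(1) l] P_def Q_def dihedral_seq_linear by simp
  moreover have "0 < ht u \<alpha>" "0 < ht u \<beta>" using ht_pos u re real_nonzero by auto
  ultimately have grow: "H n < H (Suc (Suc n))" for n using dihedral_seq_growth[OF ab] by simp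
  have "strict_mono (\<lambda>k. H (Suc (2 * k)))" using grow by (simp add: strict_mono_Suc_iff)
  then have inj: "inj (\<lambda>k. \<eta> (Suc (2 * k)))" by (intro injI) (metis H_def strict_mono_eq)
  have H1: "0 < H (Suc (2 * k))" for k
  proof (induction k)
    case 0
    show ?case using \<open>0 < ht u \<alpha>\<close> \<eta>01 by (simp add: H_def)
  next
    case (Suc k)
    then show ?case using grow[of "Suc (2 * k)"] by simp
  qed
  have upos: "pos u (\<eta> (Suc (2 * k)))" for k
    using coherent_ht(1)[OF u(1) real_\<Phi> real_nonzero] \<eta>r H1[of k] by (auto simp: H_def)
  have "\<exists>k. pos w (\<eta> (Suc (2 * k)))"
  proof (rule ccontr)
    assume "\<nexists>k. pos w (\<eta> (Suc (2 * k)))"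
    then have "range (\<lambda>k. \<eta> (Suc (2 * k))) \<subseteq> {\<beta> \<in> \<Phi>. pos u \<beta> \<and> \<not> pos w \<beta>}"
      using upos \<eta>r real_\<Phi> by blast
    then have "finite (range (\<lambda>k. \<eta> (Suc (2 * k))))" using finite_separated[OF u(1) w(1)] by (rule finite_subset)
    then show False using inj by (simp add: finite_image_iff)
  qed
  then obtain N where "pos w (\<eta> (Suc N))" by blast
  then have "pos w (\<eta> (Suc (LEAST n. pos w (\<eta> (Suc n)))))" by (rule LeastI)
  moreover have "(LEAST n. pos w (\<eta> (Suc n))) \<noteq> 0" using calculation \<eta>01 w(2) by (intro notI) simp
  ultimately obtain m where m: "pos w (\<eta> (Suc (Suc m)))" "m < (LEAST n. pos w (\<eta> (Suc n)))"
    by (metis lessI not0_implies_Suc)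
  then have "pos w (- \<eta> (Suc m))" using not_less_Least[OF m(2)] sgn[OF w(1)] by blast
  have R: "0 \<le> R n" for n unfolding R_def by (rule dihedral_seq_nonneg[OF ab r])
  \<comment> \<open>The constant determinants of \<open>R\<close> against \<open>P\<close> and
    \<open>Q\<close> are \<open>r0\<close> and \<open>r1\<close>. They rewrite the combination in
    terms of two consecutive roots, with the nonnegative terms of \<open>R\<close> as coefficients
    of the one positive at \<open>w\<close> and of the negative of the other.\<close>
  have "R (Suc m) * P (Suc (Suc m)) - R (Suc (Suc m)) * P (Suc m) = r0"
       "R (Suc m) * Q (Suc (Suc m)) - R (Suc (Suc m)) * Q (Suc m) = r1"
    unfolding R_def P_def Q_def dihedral_seq_wronskian by simp_all
  then have "(\<lambda>h. of_int r0 * \<alpha> h + of_int r1 * \<beta> h) =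
      (\<lambda>h. of_int (R (Suc m)) * \<eta> (Suc (Suc m)) h + of_int (R (Suc (Suc m))) * (- \<eta> (Suc m)) h)"
    unfolding \<eta>_def by (auto simp: fun_eq_iff algebra_simps simp flip: \<open>_ = r0\<close> \<open>_ = r1\<close>)
  then show ?thesis
    using pos_combination[OF w(1) m(1) \<open>pos w (- \<eta> (Suc m))\<close> R R] by simp
qed

lemma lattice_coroot_diff:
  assumes "\<nu> \<in> lattice" "anisotropic \<beta> c" "anisotropic \<gamma> d"
  shows "\<nu> (d - s k c) = \<nu> d - k * \<nu> c" "\<nu> (- d) = - \<nu> d"
proof -
  note D = lattice_dual[OF assms(1)] and cd = anisotropic_cartan[OF assms(2)] anisotropic_cartan[OF assms(3)]
    and sub = cartan_subspace[OF vs rdv]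
  have "\<nu> (d - s k c) = \<nu> (d + s (- k) c)" by (simp add: scale_minus_left)
  also have "\<dots> = \<nu> d + \<nu> (s (- k) c)"
    by (rule dual_space_add[OF vs D cd(2)]) (rule subspace_scale[OF sub cd(1)])
  also have "\<nu> (s (- k) c) = (- k) * \<nu> c" by (rule dual_space_scale[OF vs D cd(1)])
  finally show "\<nu> (d - s k c) = \<nu> d - k * \<nu> c" by simp
  have "\<nu> (- d) = \<nu> (s (- 1) d)" by simp
  also have "\<dots> = (- 1) * \<nu> d" by (rule dual_space_scale[OF vs D cd(2)])
  finally show "\<nu> (- d) = - \<nu> d" by simp
qed

text \<open>Since real multiples of a simple root are plus or minus that root, \<beta> has a
  positive coordinate at some \<open>y\<close> other than \<open>x\<close>; the reflection keeps
  it.\<close>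

lemma refl_map_pos:
  assumes u: "u \<in> Sk" "x \<in> X" and \<alpha>: "anisotropic (root_of u x) c" and \<beta>: "\<beta> \<in> RR" "pos u \<beta>"
    and ne: "\<beta> \<noteq> root_of u x" "\<beta> \<noteq> - root_of u x"
  shows "pos u (refl_map (root_of u x) c \<beta>)"
proof -
  note l = real_lattice[OF \<beta>(1)]
  let ?\<alpha> = "root_of u x"
  have la: "?\<alpha> \<in> lattice" using real_lattice anisotropic_real[OF \<alpha>] by blast
  obtain y where y: "y \<in> X" "y \<noteq> x" "co u \<beta> y \<noteq> 0"
  proof (rule ccontr)
    assume "\<not> thesis"
    then have "\<And>y. y \<in> X \<Longrightarrow> y \<noteq> x \<Longrightarrow> co u \<beta> y = 0" using that by blast
    then have "comb u (co u \<beta>) = comb u (\<lambda>z. if z = x then co u \<beta> x else 0)"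
      unfolding int_comb_def by (intro ext sum.cong) auto
    then have eq: "\<beta> = (\<lambda>h. of_int (co u \<beta> x) * ?\<alpha> h)"
      unfolding int_comb_single[OF finX u(2)] by (simp add: comb_co u l)
    then have "co u \<beta> x = 1 \<or> co u \<beta> x = -1" using real_primitive[OF u, of "co u \<beta> x"] \<beta>(1) by simp
    with eq ne show False by (auto simp: fun_eq_iff)
  qed
  have "0 < co u \<beta> y" using \<beta>(2) y pos_iff[OF u(1) l] by force
  moreover have "co u (refl_map ?\<alpha> c \<beta>) y = co u \<beta> y"
    using y u l la co_diff[OF u(1) l lattice_scale[OF la] y(1)]
    by (simp add: refl_map_eq[OF \<alpha> l] co_scale co_root)
  ultimately have "\<not> pos u (- refl_map ?\<alpha> c \<beta>)"
    using y(1) u refl_map_lattice[OF \<alpha> l]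
    by (simp add: pos_iff co_uminus lattice_uminus not_le) (metis (no_types, lifting))
  then show ?thesis using coherent[OF u(1) real_\<Phi>[OF refl_map_real[OF \<alpha> \<beta>(1)]]] by blast
qed

text \<open>Passing to -\<beta>, and then to its reflection in \<alpha>, changes the sign of both
  pairings and keeps their product. So one may take both pairings negative and both roots positive
  at a base that contains \<alpha>, as \<open>dihedral_cone\<close> requires.\<close>

lemma anisotropic_pairing_bound:
  assumes \<alpha>: "anisotropic \<alpha> c" and \<beta>: "anisotropic \<beta> d" and ne: "\<beta> \<noteq> \<alpha>" "\<beta> \<noteq> - \<alpha>"
  shows "pairing \<alpha> d * pairing \<beta> c \<le> 3"
proof (rule ccontr)
  assume "\<not> pairing \<alpha> d * pairing \<beta> c \<le> 3"
  then have big: "4 \<le> pairing \<alpha> d * pairing \<beta> c" by simp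
  obtain u x where u: "u \<in> Sk" "x \<in> X" "\<alpha> = root_of u x" using \<alpha> by (auto simp: anisotropic_def)
  have la: "\<alpha> \<in> lattice" using anisotropic_real[OF \<alpha>] real_lattice by blast
  have posa: "pos u \<alpha>" using coherent_ht(1)[OF u(1) root_mem root_nonzero] u by (simp add: ht_root)
  obtain \<beta>1 d1 where 1: "anisotropic \<beta>1 d1" "pos u \<beta>1" "4 \<le> pairing \<alpha> d1 * pairing \<beta>1 c"
      "\<beta>1 \<noteq> \<alpha>" "\<beta>1 \<noteq> - \<alpha>"
  proof (cases "pos u \<beta>")
    case True
    then show ?thesis using that[OF \<beta>] big ne by blast
  next
    case False
    have lb: "\<beta> \<in> lattice" using anisotropic_real[OF \<beta>] real_lattice by blast
    have "pos u (- \<beta>)" using False coherent[OF u(1) real_\<Phi>[OF anisotropic_real[OF \<beta>]]] by blast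
    moreover have "pairing \<alpha> (- d) = - pairing \<alpha> d"
      by (rule pairing_unique) (simp add: lattice_coroot_diff(2)[OF la \<alpha> \<beta>] pairing_eq[OF \<beta> la])
    moreover have "pairing (- \<beta>) c = - pairing \<beta> c" by (rule pairing_uminus[OF \<alpha> lb])
    moreover have "- \<beta> \<noteq> \<alpha>" "- \<beta> \<noteq> - \<alpha>" using ne by (metis minus_minus)+
    ultimately show ?thesis using that[OF anisotropic_uminus[OF \<beta>]] big by simp
  qed
  have l1: "\<beta>1 \<in> lattice" using anisotropic_real[OF 1(1)] real_lattice by blast
  obtain \<beta>2 d2 where 2: "anisotropic \<beta>2 d2" "pos u \<beta>2" "4 \<le> pairing \<alpha> d2 * pairing \<beta>2 c" "pairing \<beta>2 c < 0"
  proof (cases "pairing \<beta>1 c < 0")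
    case True
    then show ?thesis using that 1 by blast
  next
    case False
    then have "0 < pairing \<beta>1 c" using 1(3) by (cases "pairing \<beta>1 c = 0") auto
    moreover have "pos u (refl_map \<alpha> c \<beta>1)"
      unfolding u(3) using refl_map_pos u \<alpha> 1 anisotropic_real[OF 1(1)] by blast
    moreover have "pairing (refl_map \<alpha> c \<beta>1) c = - pairing \<beta>1 c"
      by (rule pairing_unique) (simp add: refl_map_def anisotropic_self[OF \<alpha>] pairing_eq[OF \<alpha> l1])
    moreover have "pairing \<alpha> (d1 - s (\<alpha> d1) c) = - pairing \<alpha> d1"
      by (rule pairing_unique)
        (simp add: lattice_coroot_diff(1)[OF la \<alpha> 1(1)] anisotropic_self[OF \<alpha>] pairing_eq[OF 1(1) la])
    ultimately show ?thesis using that[OF anisotropic_refl[OF \<alpha> 1(1)]] 1(3) by simp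
  qed
  define a b where "a = - pairing \<alpha> d2" and "b = - pairing \<beta>2 c"
  have b: "0 < b" and ab: "4 \<le> a * b" using 2 by (auto simp: a_def b_def)
  have a: "0 < a" using ab b by (smt (verit) mult_nonneg_nonpos2)
  have p: "pairing \<alpha> d2 = - a" "pairing \<beta>2 c = - b" by (simp_all add: a_def b_def)
  \<comment> \<open>The coefficients 2 and \<open>a\<close> make ?\<gamma> vanish on
    \<open>d2\<close> and take the value 4 - a b, at most 0, on \<open>c\<close>. These are the
    inequalities that \<open>dihedral_cone\<close> needs for the two orders of the roots.\<close>
  let ?\<gamma> = "\<lambda>h. of_int 2 * \<alpha> h + of_int a * \<beta>2 h"
  have "pos w ?\<gamma>" if w: "w \<in> Sk" for w
  proof -
    consider "pos w \<alpha>" "pos w \<beta>2" | "\<not> pos w \<alpha>" | "\<not> pos w \<beta>2" by blast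
    then show ?thesis
    proof cases
      case 1
      show ?thesis by (rule pos_combination[OF w 1]) (use a in auto)
    next
      case 2
      show ?thesis
        by (rule dihedral_cone[OF \<alpha> \<open>anisotropic \<beta>2 d2\<close> p a b ab u(1) posa \<open>pos u \<beta>2\<close> w 2])
          (use a ab in \<open>simp_all add: mult.commute\<close>)
    next
      case 3
      have "pos w (\<lambda>h. of_int a * \<beta>2 h + of_int 2 * \<alpha> h)"
        by (rule dihedral_cone[OF \<open>anisotropic \<beta>2 d2\<close> \<alpha> p(2,1) b a _ u(1) \<open>pos u \<beta>2\<close> posa w 3])
          (use a ab in \<open>simp_all add: mult.commute\<close>)
      then show ?thesis by (simp add: add.commute)
    qed
  qed
  then have "?\<gamma> = 0" by (rule fin_zero)
  then have "ht u ?\<gamma> = ht u (\<lambda>h. of_int 0 * \<alpha> h)" by (simp add: zero_fun_def)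
  moreover have "ht u ?\<gamma> = 2 * ht u \<alpha> + a * ht u \<beta>2"
    by (rule ht_combination[OF u(1) la]) (rule pos_lattice[OF u(1) 2(2)])
  moreover have "0 < a * ht u \<beta>2"
    using a ht_pos[OF u(1) 2(2) real_nonzero[OF anisotropic_real[OF 2(1)]]] by simp
  ultimately show False using ht_root[OF u(1,2)] u(3) ht_scale[OF u(1) la, of 0] by simp
qed

section \<open>Finiteness of the set of anisotropic roots\<close>

definition "An = {\<beta>. \<exists>c. anisotropic \<beta> c}"

text \<open>An anisotropic root is determined by the values of its coroot on a finite basis
  \<open>B\<close> consisting of anisotropic roots, and these values are integers between -3 and
  3.\<close>

lemma finite_An: "finite An"
proof -
  interpret F: vector_space "\<lambda>c (f :: 'a \<Rightarrow> complex) h. c * f h"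
    by unfold_locales (auto simp: fun_eq_iff algebra_simps)
  have "An \<subseteq> F.span (root_of v ` X)"
  proof
    fix \<beta> assume "\<beta> \<in> An"
    then have "\<beta> \<in> lattice" using anisotropic_real real_lattice by (auto simp: An_def)
    then obtain n where n: "\<beta> = comb v n" by (auto simp: lattice_def)
    show "\<beta> \<in> F.span (root_of v ` X)"
      unfolding n int_comb_sum by (intro F.span_sum F.span_scale F.span_base) auto
  qed
  moreover obtain B where B: "B \<subseteq> An" "F.independent B" "An \<subseteq> F.span B"
    by (rule F.maximal_independent_subset)
  ultimately have finB: "finite B"
    using F.independent_span_bound[of "root_of v ` X" B] finX by auto
  define cor where "cor \<beta> = (SOME c. anisotropic \<beta> c)" for \<beta>
  have cor: "anisotropic \<beta> (cor \<beta>)" if "\<beta> \<in> An" for \<beta>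
    unfolding cor_def by (rule someI_ex) (use that in \<open>simp add: An_def\<close>)
  have l: "\<And>\<beta>. \<beta> \<in> An \<Longrightarrow> \<beta> \<in> lattice" using anisotropic_real real_lattice by (auto simp: An_def)
  define \<kappa> where "\<kappa> \<beta> = restrict (\<lambda>\<gamma>. pairing \<gamma> (cor \<beta>)) B" for \<beta>
  have bound: "pairing \<gamma> (cor \<beta>) \<in> {-3..3}" if "\<beta> \<in> An" "\<gamma> \<in> An" for \<beta> \<gamma>
  proof -
    consider "\<gamma> = \<beta>" | "\<gamma> = - \<beta>" | "\<gamma> \<noteq> \<beta>" "\<gamma> \<noteq> - \<beta>" by blast
    then show ?thesis
    proof cases
      case 1
      then have "pairing \<gamma> (cor \<beta>) = 2" using anisotropic_self[OF cor[OF that(1)]] by (simp add: pairing_def)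
      then show ?thesis by simp
    next
      case 2
      then have "pairing \<gamma> (cor \<beta>) = - 2" using anisotropic_self[OF cor[OF that(1)]] by (simp add: pairing_def)
      then show ?thesis by simp
    next
      case 3
      let ?p = "pairing \<beta> (cor \<gamma>)" and ?q = "pairing \<gamma> (cor \<beta>)"
      have pq: "0 \<le> ?p * ?q" "?p * ?q \<le> 3"
        by (rule anisotropic_product_nonneg[OF cor[OF that(1)] cor[OF that(2)]])
          (rule anisotropic_pairing_bound[OF cor[OF that(1)] cor[OF that(2)] 3])
      show ?thesis
      proof (cases "?p = 0")
        case True
        then show ?thesis using pairing_symmetric_zero[OF cor[OF that(1)] cor[OF that(2)]] by simp
      next
        case False
        then have "1 * \<bar>?q\<bar> \<le> \<bar>?p\<bar> * \<bar>?q\<bar>" by (intro mult_right_mono) auto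
        also have "\<dots> \<le> 3" using pq by (simp flip: abs_mult)
        finally show ?thesis by auto
      qed
    qed
  qed
  have "\<kappa> ` An \<subseteq> PiE B (\<lambda>_. {-3..3})" using bound B(1) unfolding \<kappa>_def by auto
  then have "finite (\<kappa> ` An)" using finite_PiE[OF finB, of "\<lambda>_. {-3..3::int}"] by (auto intro: finite_subset)
  moreover have "inj_on \<kappa> An"
  proof (rule inj_onI)
    fix \<beta> \<gamma> assume m: "\<beta> \<in> An" "\<gamma> \<in> An" "\<kappa> \<beta> = \<kappa> \<gamma>"
    have "b (cor \<beta>) = b (cor \<gamma>)" if "b \<in> B" for b
    proof -
      have "pairing b (cor \<beta>) = pairing b (cor \<gamma>)" using fun_cong[OF m(3), of b] that by (simp add: \<kappa>_def)
      then show ?thesis using pairing_eq cor m l B that by (metis subsetD)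
    qed
    moreover have "F.subspace {f. f (cor \<beta>) = f (cor \<gamma>)}" by (simp add: F.subspace_def)
    ultimately have "F.span B \<subseteq> {f. f (cor \<beta>) = f (cor \<gamma>)}" by (intro F.span_minimal) auto
    then have eq: "f (cor \<beta>) = f (cor \<gamma>)" if "f \<in> An" for f using that B by auto
    \<comment> \<open>Coroots that agree on all anisotropic roots give both mutual pairings the
      value 2. The product 4 exceeds the bound, unless the roots agree up to sign.\<close>
    have "\<gamma> (cor \<beta>) = 2" "\<beta> (cor \<gamma>) = 2"
      using eq[OF m(1)] eq[OF m(2)] anisotropic_self[OF cor[OF m(1)]] anisotropic_self[OF cor[OF m(2)]] by metis+
    then have "pairing \<gamma> (cor \<beta>) = 2" "pairing \<beta> (cor \<gamma>) = 2" by (simp_all add: pairing_def)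
    then have "\<gamma> = \<beta> \<or> \<gamma> = - \<beta>"
      using anisotropic_pairing_bound[OF cor[OF m(1)] cor[OF m(2)]] by fastforce
    moreover have "\<gamma> \<noteq> - \<beta>" using \<open>\<gamma> (cor \<beta>) = 2\<close> anisotropic_self[OF cor[OF m(1)]] by auto
    ultimately show "\<beta> = \<gamma>" by simp
  qed
  ultimately show ?thesis by (simp add: finite_image_iff)
qed

lemma An_iff: "\<beta> \<in> An \<longleftrightarrow> (\<exists>u\<in>Sk. \<exists>x\<in>X. A u x x \<noteq> 0 \<and> \<beta> = root_of u x)"
  by (auto simp: An_def anisotropic_def)

lemma symmetry_An: "symmetry g \<Longrightarrow> \<beta> \<in> An \<Longrightarrow> g \<beta> \<in> An"
  unfolding An_iff by (metis symmetry_forward)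

lemma An_lattice: "\<beta> \<in> An \<Longrightarrow> \<beta> \<in> lattice"
  using anisotropic_real real_lattice by (auto simp: An_def)

lemma An_uminus: "\<beta> \<in> An \<Longrightarrow> - \<beta> \<in> An"
  using anisotropic_uminus by (auto simp: An_def)

section \<open>Averaging over the Weyl group\<close>

inductive_set weyl where
  "id \<in> weyl"
| "g \<in> weyl \<Longrightarrow> anisotropic \<beta> c \<Longrightarrow> g \<circ> refl_map \<beta> c \<in> weyl"

lemma weyl_symmetry: "g \<in> weyl \<Longrightarrow> symmetry g"
  by (induction rule: weyl.induct) (blast intro: symmetry_id symmetry_comp symmetry_refl_map)+

text \<open>Only finitely many Weyl group elements are needed: representatives for the permutations
  of the anisotropic roots. Their sum kills the anisotropic roots, since precomposition with a
  reflection permutes the representatives as far as their action on those roots is concerned.\<close>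

lemma averaging:
  obtains G where "finite G" "G \<noteq> {}" "\<And>g. g \<in> G \<Longrightarrow> symmetry g"
    "\<And>\<beta>. \<beta> \<in> An \<Longrightarrow> (\<Sum>g\<in>G. g \<beta>) = 0"
proof -
  define \<rho> where "\<rho> g = restrict g An" for g :: "('a \<Rightarrow> complex) \<Rightarrow> 'a \<Rightarrow> complex"
  have "\<rho> ` weyl \<subseteq> PiE An (\<lambda>_. An)" using symmetry_An[OF weyl_symmetry]
    by (auto simp: \<rho>_def PiE_def Pi_def)
  then have fin: "finite (\<rho> ` weyl)" using finite_PiE[OF finite_An, of "\<lambda>_. An"] finite_An
    by (auto intro: finite_subset)
  obtain G where G: "G \<subseteq> weyl" "inj_on \<rho> G" "\<rho> ` weyl = \<rho> ` G"
    using subset_image_inj[of "\<rho> ` weyl" \<rho> weyl] by auto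
  have "(\<Sum>g\<in>G. g \<beta>) = 0" if "\<beta> \<in> An" for \<beta>
  proof -
    obtain c where c: "anisotropic \<beta> c" using \<open>\<beta> \<in> An\<close> by (auto simp: An_def)
    let ?s = "refl_map \<beta> c"
    have sAn: "?s \<gamma> \<in> An" if "\<gamma> \<in> An" for \<gamma> using symmetry_An[OF symmetry_refl_map[OF c] that] .
    define \<mu> where "\<mu> f = restrict (f \<circ> ?s) An" for f :: "('a \<Rightarrow> complex) \<Rightarrow> 'a \<Rightarrow> complex"
    have in_\<mu>: "\<mu> f \<in> \<rho> ` weyl" if "f \<in> \<rho> ` weyl" for f
    proof -
      obtain g where "f = \<rho> g" "g \<in> weyl" using \<open>f \<in> \<rho> ` weyl\<close> by auto
      then have "\<mu> f = \<rho> (g \<circ> ?s)" by (auto simp: \<mu>_def \<rho>_def fun_eq_iff sAn)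
      then show ?thesis using weyl.intros(2)[OF \<open>g \<in> weyl\<close> c] by auto
    qed
    have \<mu>\<mu>: "\<mu> (\<mu> f) = f" if "f \<in> \<rho> ` weyl" for f
    proof -
      obtain g where "f = \<rho> g" using \<open>f \<in> \<rho> ` weyl\<close> by auto
      then show ?thesis by (auto simp: \<mu>_def \<rho>_def restrict_def sAn refl_map_twice[OF c])
    qed
    have "(\<Sum>g\<in>G. g \<beta>) = (\<Sum>f\<in>\<rho> ` weyl. f \<beta>)"
      unfolding G(3) sum.reindex[OF G(2)] using that by (intro sum.cong) (auto simp: \<rho>_def)
    also have "\<dots> = (\<Sum>f\<in>\<rho> ` weyl. \<mu> f \<beta>)"
      by (rule sum.reindex_bij_witness[of _ \<mu> \<mu>]) (use in_\<mu> \<mu>\<mu> in auto)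
    also have "\<dots> = (\<Sum>f\<in>\<rho> ` weyl. - f \<beta>)"
    proof (rule sum.cong[OF HOL.refl])
      fix f assume "f \<in> \<rho> ` weyl"
      then obtain g where g: "f = \<rho> g" "g \<in> weyl" by auto
      have "g (\<lambda>h. of_int (- 1) * \<beta> h) = (\<lambda>h. of_int (- 1) * g \<beta> h)"
        by (rule symmetry_scale[OF weyl_symmetry[OF g(2)] An_lattice[OF that]])
      then have "g (- \<beta>) = - g \<beta>" by (simp add: fun_Compl_def)
      then show "\<mu> f \<beta> = - f \<beta>"
        using that An_uminus[OF that] by (simp add: \<mu>_def g \<rho>_def refl_map_self[OF c])
    qed
    finally have "(\<Sum>g\<in>G. g \<beta>) = - (\<Sum>g\<in>G. g \<beta>)"
      unfolding G(3) sum.reindex[OF G(2)] sum_negf using that by (simp add: \<rho>_def)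
    then show ?thesis by (simp add: fun_eq_iff)
  qed
  moreover have "finite G" using fin G by (metis finite_imageD)
  moreover have "G \<noteq> {}" using G(3) weyl.intros(1) by auto
  ultimately show ?thesis using that[of G] weyl_symmetry G(1) by blast
qed

lemma sum_apply: "sum f S h = (\<Sum>i\<in>S. f i h)" for f :: "'i \<Rightarrow> 'h \<Rightarrow> complex"
  by (induction S rule: infinite_finite_induct) auto

lemma root_multiple_of_real:
  assumes \<beta>: "\<beta> \<in> \<Phi>" "\<beta> \<noteq> 0"
  shows "\<exists>u\<in>Sk. \<exists>x\<in>X. \<exists>k\<in>{1, 2::nat}. \<beta> = (\<lambda>h. of_nat k * root_of u x h)"
proof (rule ccontr)
  assume no: "\<not> ?thesis"
  have step: "pos (reflexion s u x) \<beta>" if u: "u \<in> Sk" "x \<in> X" "pos u \<beta>" for u x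
  proof (rule ccontr)
    assume "\<not> pos (reflexion s u x) \<beta>"
    then obtain k where k: "k \<in> {0..2::nat}" "\<beta> = (\<lambda>h. of_nat k * root_of u x h)"
      using separated_step[OF u(1,2)] u(3) \<beta>(1) by blast
    then have "k \<noteq> 0" using \<beta>(2) by (auto simp: zero_fun_def)
    then have "k \<in> {1, 2}" using k(1) by auto
    with k(2) u no show False by blast
  qed
  have const: "pos u \<beta> \<longleftrightarrow> pos v \<beta>" if "u \<in> Sk" for u
    using that
  proof induction
    case (2 u x)
    have "pos u \<beta>" if "pos (reflexion s u x) \<beta>"
      using step[OF refl_Sk[OF 2(1,2)] 2(2) that] reflexion_twice[OF 2(1)] by simp
    then show ?case using step[OF 2(1,2)] 2 by blast
  qed simp
  show False
  proof (cases "pos v \<beta>")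
    case True
    then show False using fin_zero[of \<beta>] const \<beta>(2) by blast
  next
    case False
    then have "pos u (- \<beta>)" if "u \<in> Sk" for u using const[OF that] coherent[OF that \<beta>(1)] by blast
    then have "- \<beta> = 0" by (rule fin_zero)
    then show False using \<beta>(2) by simp
  qed
qed

text \<open>Induction on the length of the path, for all data of the skeleton at once: a path that
  returns to \<open>x\<close> or to its neighbours is shortened, and otherwise its first vertex is
  dropped, after the reflexion at \<open>x\<close> if necessary.\<close>

lemma isotropic_spread:
  fixes T :: "('a \<Rightarrow> complex) \<Rightarrow> 'a \<Rightarrow> complex"
  assumes add: "\<And>\<nu> \<mu>. \<nu> \<in> lattice \<Longrightarrow> \<mu> \<in> lattice \<Longrightarrow> T (\<nu> + \<mu>) = T \<nu> + T \<mu>"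
    and An: "\<And>\<beta>. \<beta> \<in> An \<Longrightarrow> T \<beta> = 0" and \<delta>: "\<delta> \<noteq> 0"
    and u: "u \<in> Sk" and path: "f 0 = x" "f n = y" "\<forall>i\<le>n. f i \<in> X" "\<forall>i<n. f i \<noteq> f (Suc i) \<and> A u (f i) (f (Suc i)) \<noteq> 0"
    and x: "A u x x = 0" "T (root_of u x) \<in> {\<delta>, - \<delta>}"
  shows "T (root_of u y) \<in> {0, \<delta>, - \<delta>}"
  using u path x
proof (induction n arbitrary: u x f rule: less_induct)
  case (less n u x f)
  note u = less.prems(1) and f = less.prems(2-5) and x = less.prems(6,7)
  have xX: "x \<in> X" using f(1,3) by auto
  have aniso: "T (root_of w z) = 0" if "w \<in> Sk" "z \<in> X" "A w z z \<noteq> 0" for w z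
    by (rule An) (use that in \<open>auto simp: An_iff\<close>)
  show ?case
  proof (cases "n = 0")
    case True
    then show ?thesis using f x by auto
  next
    case n: False
    show ?thesis
    proof (cases "\<exists>i. 2 \<le> i \<and> i \<le> n \<and> (f i = x \<or> A u x (f i) \<noteq> 0)")
      \<comment> \<open>A later vertex that equals \<open>x\<close> or is adjacent to it starts, or
        is reached by, a shorter path from \<open>x\<close>.\<close>
      case True
      then obtain i where i: "2 \<le> i" "i \<le> n" "f i = x \<or> A u x (f i) \<noteq> 0" by blast
      show ?thesis
      proof (cases "f i = x")
        case True
        have "f (i + j) \<noteq> f (Suc (i + j)) \<and> A u (f (i + j)) (f (Suc (i + j))) \<noteq> 0" if "j < n - i" for j
          using f(4) that by simp
        then show ?thesis
          by (intro less.IH[of "n - i" u "\<lambda>j. f (i + j)" x]) (use i True f u x in auto)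
      next
        case False
        let ?g = "\<lambda>j. if j = 0 then x else f (i + j - 1)"
        have "?g j \<noteq> ?g (Suc j) \<and> A u (?g j) (?g (Suc j)) \<noteq> 0" if "j < n - i + 1" for j
        proof (cases j)
          case 0
          then show ?thesis using i False by auto
        next
          case (Suc m)
          then show ?thesis using f(4)[rule_format, of "i + m"] that by auto
        qed
        then show ?thesis
          by (intro less.IH[of "n - i + 1" u ?g x]) (use i False f u x xX in auto)
      qed
    next
      case far: False
      let ?z = "f 1" and ?w = "reflexion s u x"
      have z: "?z \<in> X" "?z \<noteq> x" "A u x ?z \<noteq> 0" using f n by (metis One_nat_def less_Suc_eq_le not_less_zero linorder_neqE_nat Suc_leI gr0I)+
      have nz: "A u ?z x \<noteq> 0" using cartan_matrix_symmetric_zero[OF u z(1) xX z(2)] z(3) by blast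
      note w = refl_Sk[OF u xX]
      have rl: "root_of u q \<in> lattice" if "q \<in> X" for q using root_mem_lattice root_mem[OF u that] by blast
      have "root_of ?w ?z = root_of u ?z + root_of u x"
        using x z by (simp add: root_of_reflexion[OF vs] root_coeff_def Let_def fun_eq_iff)
      then have Tz: "T (root_of ?w ?z) = T (root_of u ?z) + T (root_of u x)"
        using add[OF rl[OF z(1)] rl[OF xX]] by simp
      have tail: "\<forall>i\<le>n - 1. f (Suc i) \<in> X" using f n by auto
      show ?thesis
      proof (cases "A u ?z ?z = 0")
        \<comment> \<open>An isotropic neighbour becomes anisotropic after the reflexion at
          \<open>x\<close>, with root b(z) + b(x), so the images of the two roots under
          \<open>T\<close> cancel.\<close>
        case True
        have "A ?w ?z ?z = 2 * A u ?z x"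
          using x z True by (simp add: cartan_matrix_reflexion[OF vs rd[OF u]] root_coeff_def coroot_coeff_def Let_def)
        then have "T (root_of u ?z) + T (root_of u x) = 0"
          using aniso[OF w z(1)] nz Tz by simp
        then have "T (root_of u ?z) = - T (root_of u x)" by (rule eq_neg_iff_add_eq_0[THEN iffD2])
        then have "T (root_of u ?z) \<in> {\<delta>, - \<delta>}" using x(2) by auto
        then show ?thesis
          by (intro less.IH[of "n - 1" u "\<lambda>j. f (Suc j)" ?z]) (use n f tail u True in auto)
      next
        \<comment> \<open>An anisotropic neighbour has image 0. After the reflexion at
          \<open>x\<close> it inherits the nonzero image of the root of \<open>x\<close>, hence is
          isotropic there; the rest of the path is not adjacent to \<open>x\<close> and keeps its
          roots and edges.\<close>
        case False
        then have Tz0: "T (root_of u ?z) = 0" using aniso[OF u z(1)] by blast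
        show ?thesis
        proof (cases "n = 1")
          case True
          then show ?thesis using Tz0 f(2) by simp
        next
          case n1: False
          have Tw: "T (root_of ?w ?z) = T (root_of u x)" using Tz Tz0 by simp
          then have iso: "A ?w ?z ?z = 0" 
          proof -
            have "T (root_of u x) \<noteq> 0" using x(2) \<delta> by (metis insertE neg_equal_0_iff_equal singletonD)
            then show ?thesis using aniso[OF w z(1)] Tw by metis
          qed
          have unch: "f i \<noteq> x" "A u x (f i) = 0" if "2 \<le> i" "i \<le> n" for i using far that by blast+
          have rc: "root_coeff u x (f i) = 0" if "2 \<le> i" "i \<le> n" for i
            using unch[OF that] x by (simp add: root_coeff_def Let_def)
          have "A ?w (f (Suc i)) (f (Suc (Suc i))) = A u (f (Suc i)) (f (Suc (Suc i)))" if "i < n - 1" for i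
            unfolding cartan_matrix_reflexion[OF vs rd[OF u]] using rc[of "Suc (Suc i)"] unch[of "Suc (Suc i)"] that by simp
          then have adj: "\<forall>i<n - 1. f (Suc i) \<noteq> f (Suc (Suc i)) \<and> A ?w (f (Suc i)) (f (Suc (Suc i))) \<noteq> 0"
            using f(4) by simp
          have "T (root_of ?w ?z) \<in> {\<delta>, - \<delta>}" unfolding Tw by (rule x(2))
          then have "T (root_of ?w y) \<in> {0, \<delta>, - \<delta>}"
            by (intro less.IH[of "n - 1" ?w "\<lambda>j. f (Suc j)" ?z]) (use n f tail adj w iso in auto)
          moreover have "root_of ?w y = root_of u y"
            using rc[of n] n n1 f(2) by (simp add: root_of_reflexion[OF vs] fun_eq_iff)
          ultimately show ?thesis by (simp only:)
        qed
      qed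
    qed
  qed
qed

section \<open>Connectedness of the graph of the Cartan matrix\<close>

lemma connected_path:
  assumes ind: "indecomposable X v" and xy: "x \<in> X" "y \<in> X"
  shows "\<exists>n f. f 0 = x \<and> f n = y \<and> (\<forall>i\<le>n. f i \<in> X) \<and> (\<forall>i<n. f i \<noteq> f (Suc i) \<and> A v (f i) (f (Suc i)) \<noteq> 0)"
proof -
  define C where "C = {y. \<exists>n f. f 0 = x \<and> f n = y \<and> (\<forall>i\<le>n. f i \<in> X) \<and>
    (\<forall>i<n. f i \<noteq> f (Suc i) \<and> A v (f i) (f (Suc i)) \<noteq> 0)}"
  have v: "v \<in> Sk" by (rule skeleton.intros)
  have sub: "C \<subseteq> X" by (auto simp: C_def)
  have "x \<in> C" unfolding C_def using xy by (auto intro!: exI[of _ 0] exI[of _ "\<lambda>_. x"])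
  have closed: "q \<in> C" if pq: "p \<in> C" "q \<in> X" "p \<noteq> q" "A v p q \<noteq> 0" for p q
  proof -
    obtain n f where f: "f 0 = x" "f n = p" "\<forall>i\<le>n. f i \<in> X"
      "\<forall>i<n. f i \<noteq> f (Suc i) \<and> A v (f i) (f (Suc i)) \<noteq> 0" using pq(1) by (auto simp: C_def)
    let ?g = "f(Suc n := q)"
    have "?g 0 = x \<and> ?g (Suc n) = q \<and> (\<forall>i\<le>Suc n. ?g i \<in> X) \<and>
      (\<forall>i<Suc n. ?g i \<noteq> ?g (Suc i) \<and> A v (?g i) (?g (Suc i)) \<noteq> 0)"
      using f pq by (auto simp: less_Suc_eq le_Suc_eq)
    then show ?thesis unfolding C_def by blast
  qed
  have "C = X"
  proof (rule ccontr)
    assume "C \<noteq> X"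
    have "A v p q = 0 \<and> A v q p = 0" if pq: "p \<in> C" "q \<in> X - C" for p q
    proof -
      have z: "A v p q = 0" using closed[of p q] pq by blast
      moreover have "A v q p = 0" by (rule cartan_matrix_symmetric_zero[OF v _ _ _ z]) (use pq sub in auto)
      ultimately show ?thesis by simp
    qed
    moreover have "C \<union> (X - C) = X" "C \<inter> (X - C) = {}" "C \<noteq> {}" "X - C \<noteq> {}"
      using sub \<open>C \<noteq> X\<close> \<open>x \<in> C\<close> by auto
    ultimately show False using ind unfolding indecomposable_def by meson
  qed
  then show ?thesis using xy by (auto simp: C_def)
qed

lemma decomposition_reflexion:
  assumes u: "u \<in> Sk" and x: "x \<in> X" and Y: "Y1 \<union> Y2 = X" "Y1 \<inter> Y2 = {}"
    and z: "\<forall>p\<in>Y1. \<forall>q\<in>Y2. A u p q = 0 \<and> A u q p = 0"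
  shows "\<forall>p\<in>Y1. \<forall>q\<in>Y2. A (reflexion s u x) p q = 0 \<and> A (reflexion s u x) q p = 0"
proof -
  have *: "A (reflexion s u x) p q = 0 \<and> A (reflexion s u x) q p = 0"
    if "x \<in> Z1" "Z1 \<inter> Z2 = {}" "p \<in> Z1" "q \<in> Z2" "\<forall>p\<in>Z1. \<forall>q\<in>Z2. A u p q = 0 \<and> A u q p = 0" for p q Z1 Z2
  proof -
    have "A u x q = 0" "A u q x = 0" "A u p q = 0" "A u q p = 0" "q \<noteq> x" using that by auto
    then show ?thesis
      by (simp add: cartan_matrix_reflexion[OF vs rd[OF u]] root_coeff_def coroot_coeff_def Let_def)
  qed
  show ?thesis
  proof (cases "x \<in> Y1")
    case True
    then show ?thesis using *[of Y1 Y2] Y z by blast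
  next
    case False
    then have "x \<in> Y2" using x Y by blast
    then show ?thesis using *[of Y2 Y1] Y z by blast
  qed
qed

lemma indecomposable_skeleton:
  assumes "indecomposable X v" "u \<in> Sk"
  shows "indecomposable X u"
  using assms(2)
proof induction
  case (2 u x)
  note w = refl_Sk[OF 2(1,2)]
  show ?case
    unfolding indecomposable_def
  proof
    assume "\<exists>X1 X2. X1 \<union> X2 = X \<and> X1 \<inter> X2 = {} \<and> X1 \<noteq> {} \<and> X2 \<noteq> {} \<and>
      (\<forall>p\<in>X1. \<forall>q\<in>X2. A (reflexion s u x) p q = 0 \<and> A (reflexion s u x) q p = 0)"
    then obtain X1 X2 where *: "X1 \<union> X2 = X" "X1 \<inter> X2 = {}" "X1 \<noteq> {}" "X2 \<noteq> {}"
      "\<forall>p\<in>X1. \<forall>q\<in>X2. A (reflexion s u x) p q = 0 \<and> A (reflexion s u x) q p = 0" by blast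
    have "\<forall>p\<in>X1. \<forall>q\<in>X2. A u p q = 0 \<and> A u q p = 0"
      using decomposition_reflexion[OF w 2(2) *(1,2,5)] reflexion_twice[OF 2(1)] by simp
    then show False using 2(4) * unfolding indecomposable_def by blast
  qed
qed (rule assms(1))

lemma neighbour:
  assumes "indecomposable X v" and u: "u \<in> Sk" and x: "x \<in> X" "X \<noteq> {x}"
  shows "\<exists>y\<in>X. y \<noteq> x \<and> A u x y \<noteq> 0"
proof (rule ccontr)
  assume no: "\<not> ?thesis"
  have "A u x y = 0 \<and> A u y x = 0" if y: "y \<in> X - {x}" for y
  proof -
    have z: "A u x y = 0" using no y by blast
    moreover have "A u y x = 0"
      by (rule cartan_matrix_symmetric_zero[OF u x(1) _ _ z]) (use y in auto)
    ultimately show ?thesis by simp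
  qed
  moreover have "{x} \<union> (X - {x}) = X" "{x} \<inter> (X - {x}) = {}" "{x} \<noteq> {}" "X - {x} \<noteq> {}"
    using x by auto
  ultimately show False
    using indecomposable_skeleton[OF assms(1) u] unfolding indecomposable_def by (metis singletonD)
qed

text \<open>The sum \<open>T\<close> of finitely many symmetries kills the anisotropic roots, hence it is unchanged up to sign
  along edges between isotropic roots and maps the whole lattice to the multiples of one \<open>\<delta>\<close>. Two chambers
  exclude \<open>\<delta>\<close> and \<open>- \<delta>\<close> from being positive, and their finitely many preimages under the symmetries
  exclude every nonzero lattice element; thus each root separates \<open>v\<close> from one of finitely many chambers.\<close>

theorem finite_roots:
  assumes ind: "indecomposable X v"
  shows "finite \<Phi>"
proof -
  have v: "v \<in> Sk" by (rule skeleton.intros)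
  obtain G where G: "finite G" "G \<noteq> {}" "\<And>g. g \<in> G \<Longrightarrow> symmetry g"
    "\<And>\<beta>. \<beta> \<in> An \<Longrightarrow> (\<Sum>g\<in>G. g \<beta>) = 0" by (rule averaging) blast
  define T where "T \<nu> = (\<Sum>g\<in>G. g \<nu>)" for \<nu>
  have add: "T (\<nu> + \<mu>) = T \<nu> + T \<mu>" if "\<nu> \<in> lattice" "\<mu> \<in> lattice" for \<nu> \<mu>
  proof -
    have "T (\<nu> + \<mu>) = (\<Sum>g\<in>G. g \<nu> + g \<mu>)"
      unfolding T_def by (rule sum.cong[OF HOL.refl]) (rule symmetry_add[OF G(3) that])
    then show ?thesis by (simp only: sum.distrib T_def)
  qed
  have An: "T \<beta> = 0" if "\<beta> \<in> An" for \<beta> using G(4)[OF that] by (simp only: T_def)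
  \<comment> \<open>A simple root with nonzero average is isotropic, because \<open>T\<close> kills
    \<open>An\<close>; its average serves as \<delta> and spreads along paths to all of
    \<open>X\<close>.\<close>
  obtain \<delta> where \<delta>: "\<And>y. y \<in> X \<Longrightarrow> T (root_of v y) \<in> {0, \<delta>, - \<delta>}" "\<delta> = 0 \<or> (\<exists>x\<in>X. \<delta> = T (root_of v x))"
  proof (cases "\<exists>x\<in>X. T (root_of v x) \<noteq> 0")
    case True
    then obtain x where x: "x \<in> X" "T (root_of v x) \<noteq> 0" by blast
    then have "A v x x = 0" using An[of "root_of v x"] v by (auto simp: An_iff)
    then have "T (root_of v y) \<in> {0, T (root_of v x), - T (root_of v x)}" if "y \<in> X" for y
      using connected_path[OF ind x(1) that] isotropic_spread[OF add An x(2) v, where y = y] by blast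
    then show ?thesis using that x by blast
  next
    case False
    then show ?thesis using that[of 0] by auto
  qed
  have \<delta>l: "\<delta> \<in> lattice"
    using \<delta>(2) lattice_zero lattice_sum[of G "\<lambda>g. g (root_of v _)"] symmetry_lattice[OF G(3)]
      root_mem_lattice[OF root_mem[OF v]] unfolding T_def by blast
  obtain e where e: "\<And>y. y \<in> X \<Longrightarrow> T (root_of v y) = (\<lambda>h. of_int (e y) * \<delta> h)"
  proof -
    have "\<exists>e::int. T (root_of v y) = (\<lambda>h. of_int e * \<delta> h)" if y: "y \<in> X" for y
    proof -
      consider "T (root_of v y) = 0" | "T (root_of v y) = \<delta>" | "T (root_of v y) = - \<delta>"
        using \<delta>(1)[OF y] by blast
      then show ?thesis
        by cases (rule exI[of _ 0] exI[of _ 1] exI[of _ "-1"]; simp add: fun_eq_iff)+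
    qed
    then show ?thesis using that by metis
  qed
  have T: "\<exists>k. T \<nu> = (\<lambda>h. of_int k * \<delta> h)" if \<nu>: "\<nu> \<in> lattice" for \<nu>
  proof -
    obtain n where n: "\<nu> = comb v n" using \<nu> by (auto simp: lattice_def)
    have rl: "root_of v x \<in> lattice" if "x \<in> X" for x using root_mem_lattice root_mem[OF v that] by blast
    have g: "g \<nu> h = (\<Sum>x\<in>X. of_int (n x) * g (root_of v x) h)" if "g \<in> G" for g h
    proof -
      have "g \<nu> = (\<Sum>x\<in>X. g (\<lambda>h. of_int (n x) * root_of v x h))"
        unfolding n int_comb_sum by (rule symmetry_sum[OF G(3)[OF that]]) (simp add: rl lattice_scale)
      also have "\<dots> = (\<Sum>x\<in>X. (\<lambda>h. of_int (n x) * g (root_of v x) h))"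
        by (rule sum.cong[OF HOL.refl]) (rule symmetry_scale[OF G(3)[OF that] rl])
      finally show ?thesis by (simp only: sum_apply)
    qed
    have "T \<nu> h = (\<Sum>x\<in>X. of_int (n x) * T (root_of v x) h)" for h
      unfolding T_def sum_apply sum_distrib_left by (subst sum.swap) (simp add: g)
    then have "T \<nu> h = of_int (\<Sum>x\<in>X. n x * e x) * \<delta> h" for h
      by (simp add: e sum_distrib_right mult.assoc)
    then show ?thesis by blast
  qed
  obtain u1 u2 where u12: "u1 \<in> Sk" "u2 \<in> Sk" "\<delta> \<noteq> 0 \<Longrightarrow> \<not> pos u1 \<delta>" "\<delta> \<noteq> 0 \<Longrightarrow> \<not> pos u2 (- \<delta>)"
  proof (cases "\<delta> = 0")
    case False
    then have "- \<delta> \<noteq> 0" by simp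
    with False obtain u1 u2 where "u1 \<in> Sk" "\<not> pos u1 \<delta>" "u2 \<in> Sk" "\<not> pos u2 (- \<delta>)"
      using fin_zero[of \<delta>] fin_zero[of "- \<delta>"] by blast
    then show ?thesis using that by blast
  qed (use that v in blast)
  \<comment> \<open>Positivity of \<open>g \<nu>\<close> at a chamber is positivity of \<nu> at the
    chamber pulled back along \<open>g\<close>, so finitely many conditions on \<nu> control all of
    its images.\<close>
  define pull where "pull g w = (SOME u. u \<in> Sk \<and> (\<forall>x. root_of w x = g (root_of u x)))"
    for g :: "('a \<Rightarrow> complex) \<Rightarrow> 'a \<Rightarrow> complex" and w :: "('a, 'b) root_datum"
  have pull: "pull g w \<in> Sk \<and> (\<forall>x. root_of w x = g (root_of (pull g w) x))" if "g \<in> G" "w \<in> Sk" for g w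
    unfolding pull_def by (rule someI_ex, rule symmetry_backward[OF G(3)[OF that(1)] that(2)]) blast
  define F where "F = (\<lambda>g. pull g u1) ` G \<union> (\<lambda>g. pull g u2) ` G"
  have F: "finite F" "F \<subseteq> Sk" using G(1) pull u12 by (auto simp: F_def)
  have zero: "\<nu> = 0" if \<nu>: "\<nu> \<in> lattice" "\<And>w. w \<in> F \<Longrightarrow> pos w \<nu>" for \<nu>
  proof -
    have p: "pos u1 (g \<nu>)" "pos u2 (g \<nu>)" if "g \<in> G" for g
    proof -
      have "pull g u1 \<in> F" "pull g u2 \<in> F" using that by (auto simp: F_def)
      then show "pos u1 (g \<nu>)" "pos u2 (g \<nu>)"
        using symmetry_pos[OF G(3)[OF that] _ u12(1) _ \<nu>(1), of "pull g u1"]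
          symmetry_pos[OF G(3)[OF that] _ u12(2) _ \<nu>(1), of "pull g u2"] pull[OF that] u12 \<nu>(2) by blast+
    qed
    have ps: "pos u (\<Sum>g\<in>S. g \<nu>) \<and> ht u (\<Sum>g\<in>S. g \<nu>) = (\<Sum>g\<in>S. ht u (g \<nu>))"
      if "finite S" "\<forall>g\<in>S. pos u (g \<nu>)" "u \<in> Sk" for S u
      using that(1,2)
    proof induction
      case empty
      have "pos u 0" using pos_iff[OF that(3) lattice_zero] co_scale[OF that(3) lattice_zero, of _ 0]
        by (auto simp: zero_fun_def)
      then show ?case using ht_scale[OF that(3) lattice_zero, of 0] by (simp add: zero_fun_def)
    next
      case (insert g S)
      then have *: "pos u (g \<nu>)" "pos u (\<Sum>g\<in>S. g \<nu>)"
        and ih: "ht u (\<Sum>g\<in>S. g \<nu>) = (\<Sum>g\<in>S. ht u (g \<nu>))" by auto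
      have "(\<lambda>h. of_int 1 * (g \<nu>) h + of_int 1 * (\<Sum>g\<in>S. g \<nu>) h) = g \<nu> + (\<Sum>g\<in>S. g \<nu>)"
        by (simp add: fun_eq_iff)
      then have "pos u (g \<nu> + (\<Sum>g\<in>S. g \<nu>))"
        using pos_combination[OF that(3) *, of 1 1] by (metis zero_le_one)
      moreover have "ht u (g \<nu> + (\<Sum>g\<in>S. g \<nu>)) = ht u (g \<nu>) + ht u (\<Sum>g\<in>S. g \<nu>)"
        by (rule ht_add[OF that(3) pos_lattice[OF that(3) *(1)] pos_lattice[OF that(3) *(2)]])
      ultimately show ?case unfolding sum.insert[OF insert(1,2)] ih by (rule conjI)
    qed
    obtain k where k: "T \<nu> = (\<lambda>h. of_int k * \<delta> h)" using T[OF \<nu>(1)] by blast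
    have "T \<nu> = 0"
    proof (rule ccontr)
      assume "T \<nu> \<noteq> 0"
      then have nz: "\<delta> \<noteq> 0" "k \<noteq> 0" using k by (auto simp: fun_eq_iff)
      have pT: "pos u1 (T \<nu>)" "pos u2 (T \<nu>)" using ps[OF G(1)] p u12(1,2) unfolding T_def by blast+
      have c: "0 \<le> k * co u1 \<delta> x" "0 \<le> k * co u2 \<delta> x" if "x \<in> X" for x
        using pT that \<delta>l unfolding k by (simp_all add: pos_iff u12(1,2) lattice_scale co_scale)
      show False
      proof (cases "0 < k")
        case True
        then have "pos u1 \<delta>" using c(1) by (simp add: pos_iff u12(1) \<delta>l zero_le_mult_iff)
        then show False using u12(3) nz by blast
      next
        case False
        then have "k < 0" using nz by simp
        then have "pos u2 (- \<delta>)" using c(2) by (simp add: pos_iff u12(2) \<delta>l lattice_uminus co_uminus zero_le_mult_iff)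
        then show False using u12(4) nz by blast
      qed
    qed
    \<comment> \<open>All the terms are nonnegative, so each \<open>g \<nu>\<close> is positive of
      height 0, hence zero, and symmetries are injective.\<close>
    then have "(\<Sum>g\<in>G. ht u1 (g \<nu>)) = 0"
      using ps[OF G(1) _ u12(1)] p ht_scale[OF u12(1) lattice_zero, of 0] by (simp add: T_def zero_fun_def)
    moreover obtain g where g: "g \<in> G" using G(2) by blast
    ultimately have "ht u1 (g \<nu>) = 0"
      using sum_nonneg_eq_0_iff[OF G(1), of "\<lambda>g. ht u1 (g \<nu>)"] ht_nonneg[OF u12(1) p(1)] by blast
    then have "g \<nu> = 0" using ht_pos[OF u12(1) p(1)[OF g]] by fastforce
    then show "\<nu> = 0" by (rule symmetry_inject[OF G(3)[OF g] \<nu>(1)])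
  qed
  have "\<Phi> \<subseteq> {0} \<union> (\<Union>u\<in>F. {\<beta> \<in> \<Phi>. pos v \<beta> \<and> \<not> pos u \<beta>} \<union> {\<beta> \<in> \<Phi>. pos u \<beta> \<and> \<not> pos v \<beta>})"
  proof
    fix \<beta> assume \<beta>: "\<beta> \<in> \<Phi>"
    note l = root_mem_lattice[OF \<beta>]
    show "\<beta> \<in> {0} \<union> (\<Union>u\<in>F. {\<beta> \<in> \<Phi>. pos v \<beta> \<and> \<not> pos u \<beta>} \<union> {\<beta> \<in> \<Phi>. pos u \<beta> \<and> \<not> pos v \<beta>})"
    proof (cases "\<beta> = 0")
      case nz: False
      then obtain u u' where u: "u \<in> F" "\<not> pos u \<beta>" "u' \<in> F" "\<not> pos u' (- \<beta>)"
        using zero[OF l] zero[OF lattice_uminus[OF l]] by (metis neg_equal_0_iff_equal)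
      then have "pos u' \<beta>" using coherent[of u' \<beta>] F(2) \<beta> by blast
      then show ?thesis using u \<beta> by blast
    qed simp
  qed
  moreover have "finite ({0} \<union> (\<Union>u\<in>F. {\<beta> \<in> \<Phi>. pos v \<beta> \<and> \<not> pos u \<beta>} \<union> {\<beta> \<in> \<Phi>. pos u \<beta> \<and> \<not> pos v \<beta>}))"
    using F finite_separated v by blast
  ultimately show ?thesis by (rule finite_subset)
qed

end

section \<open>Free Lie superalgebras\<close>

text \<open>Each generator occurs in both parities, so that one type serves all root data of a component, whose
  parities differ.\<close>

quotient_type 'g free_lie = "(bit \<times> 'g) lie_term" / "lie_eq UNIV fst {}"
proof (rule equivpI)
  show "reflp (lie_eq UNIV fst {} :: (bit \<times> 'g) lie_term \<Rightarrow> _)"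
    by (rule reflpI) (simp add: lie_eq.refl lie_terms_def)
  show "symp (lie_eq UNIV fst {} :: (bit \<times> 'g) lie_term \<Rightarrow> _)"
    by (rule sympI) (rule lie_eq.sym)
  show "transp (lie_eq UNIV fst {} :: (bit \<times> 'g) lie_term \<Rightarrow> _)"
    by (rule transpI) (rule lie_eq.trans)
qed

lemma in_lie_terms_UNIV [simp]: "t \<in> lie_terms UNIV"
  by (simp add: lie_terms_def)

instantiation free_lie :: (type) ab_group_add
begin

lift_definition zero_free_lie :: "'a free_lie" is Zero .
lift_definition plus_free_lie :: "'a free_lie \<Rightarrow> 'a free_lie \<Rightarrow> 'a free_lie" is Plus
  by (rule lie_eq.plus_cong)
lift_definition uminus_free_lie :: "'a free_lie \<Rightarrow> 'a free_lie" is "Scale (-1)"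
  by (rule lie_eq.scale_cong)
definition minus_free_lie :: "'a free_lie \<Rightarrow> 'a free_lie \<Rightarrow> 'a free_lie" where
  "minus_free_lie x y = x + (- y)"

instance
proof
  fix x y z :: "'a free_lie"
  show "x + y + z = x + (y + z)" by transfer (simp add: lie_eq.plus_assoc)
  show comm: "x + y = y + x" for x y :: "'a free_lie" by transfer (simp add: lie_eq.plus_comm)
  have "x + 0 = x" by transfer (simp add: lie_eq.plus_zero)
  then show "0 + x = x" by (simp add: comm)
  have "x + - x = 0" by transfer (simp add: lie_eq.plus_inverse)
  then show "- x + x = 0" by (simp add: comm)
  show "x - y = x + - y" by (rule minus_free_lie_def)
qed

end

lift_definition gen :: "bit \<Rightarrow> 'g \<Rightarrow> 'g free_lie" is "\<lambda>i g. Gen (i, g)" .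
lift_definition scl :: "complex \<Rightarrow> 'g free_lie \<Rightarrow> 'g free_lie" is Scale
  by (rule lie_eq.scale_cong)
lift_definition br :: "'g free_lie \<Rightarrow> 'g free_lie \<Rightarrow> 'g free_lie" is Brack
  by (rule lie_eq.brack_cong)
text \<open>A class also contains terms without parity, such as t + u - u with t and u of different
  parities, so only some representative is required to have one. Zero has both parities.\<close>

definition of_parity :: "bit \<Rightarrow> 'g free_lie \<Rightarrow> bool" where
  "of_parity i x \<longleftrightarrow> (\<exists>t. has_parity fst t i \<and> x = abs_free_lie t)"

global_interpretation free_lie: vector_space scl
proof
  fix a b :: complex and x y :: "'g free_lie"
  show "scl a (x + y) = scl a x + scl a y" by transfer (simp add: lie_eq.scale_plus)
  show "scl (a + b) x = scl a x + scl b x" by transfer (simp add: lie_eq.scale_add)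
  show "scl a (scl b x) = scl (a * b) x" by transfer (simp add: lie_eq.scale_scale)
  show "scl 1 x = x" by transfer (simp add: lie_eq.scale_one)
qed

lemma br_add_left: "br (x + y) z = br x z + br y z"
  by transfer (simp add: lie_eq.brack_plus_left)

lemma br_add_right: "br x (y + z) = br x y + br x z"
  by transfer (simp add: lie_eq.brack_plus_right)

lemma br_scale_left: "br (scl c x) y = scl c (br x y)"
  by transfer (simp add: lie_eq.brack_scale_left)

lemma br_scale_right: "br x (scl c y) = scl c (br x y)"
  by transfer (simp add: lie_eq.brack_scale_right)

lemma br_zero [simp]: "br 0 x = 0" "br x 0 = 0"
  using br_scale_left[of 0 0 x] br_scale_right[of x 0 0] by simp_all

lemma br_minus: "br (- x) y = - br x y" "br x (- y) = - br x y"
  using br_scale_left[of "-1" x y] br_scale_right[of x "-1" y] by simp_all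

lemma br_diff: "br (x - z) y = br x y - br z y" "br x (y - w) = br x y - br x w"
  using br_add_left[of x "- z" y] br_add_right[of x y "- w"] by (simp_all add: br_minus)

lemma abs_free_lie_simps:
  "abs_free_lie Zero = 0" "abs_free_lie (Gen p) = gen (fst p) (snd p)"
  "abs_free_lie (Plus t u) = abs_free_lie t + abs_free_lie u"
  "abs_free_lie (Scale c t) = scl c (abs_free_lie t)"
  "abs_free_lie (Brack t u) = br (abs_free_lie t) (abs_free_lie u)"
  by (simp_all add: zero_free_lie_def gen.abs_eq plus_free_lie.abs_eq scl.abs_eq br.abs_eq)

lemma of_parity_gen: "of_parity i (gen i g)"
  unfolding of_parity_def using has_parity.intros(1)[of fst "(i, g)"] abs_free_lie_simps(2)[of "(i, g)"]
  by (metis fst_conv snd_conv)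

lemma of_parity_zero: "of_parity i 0"
  unfolding of_parity_def using has_parity.intros(2) abs_free_lie_simps(1) by metis

lemma of_parity_add: "of_parity i x \<Longrightarrow> of_parity i y \<Longrightarrow> of_parity i (x + y)"
  unfolding of_parity_def using has_parity.intros(3) abs_free_lie_simps(3) by metis

lemma of_parity_scale: "of_parity i x \<Longrightarrow> of_parity i (scl c x)"
  unfolding of_parity_def using has_parity.intros(4) abs_free_lie_simps(4) by metis

lemma of_parity_br: "of_parity i x \<Longrightarrow> of_parity j y \<Longrightarrow> of_parity (i + j) (br x y)"
  unfolding of_parity_def using has_parity.intros(5) abs_free_lie_simps(5) by metis

lemma br_skew: "of_parity i x \<Longrightarrow> of_parity j y \<Longrightarrow> br x y = scl (- koszul_sign i j) (br y x)"
proof -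
  assume "of_parity i x" "of_parity j y"
  then obtain t u where *: "has_parity fst t i" "x = abs_free_lie t" "has_parity fst u j" "y = abs_free_lie u"
    unfolding of_parity_def by blast
  have "lie_eq UNIV fst {} (Brack t u) (Scale (- koszul_sign i j) (Brack u t))"
    by (rule lie_eq.skew) (use * in simp_all)
  then show ?thesis unfolding *(2,4) abs_free_lie_simps(4,5)[symmetric] by (simp only: free_lie.abs_eq_iff)
qed

lemma free_lie_induct [case_names gen zero add scale br, induct type: free_lie]:
  assumes "\<And>i g. P (gen i g)" "P 0" "\<And>x y. P x \<Longrightarrow> P y \<Longrightarrow> P (x + y)"
    "\<And>c x. P x \<Longrightarrow> P (scl c x)" "\<And>x y. P x \<Longrightarrow> P y \<Longrightarrow> P (br x y)"
  shows "P x"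
proof -
  obtain t where t: "x = abs_free_lie t" by (metis Quotient_abs_rep Quotient_free_lie)
  have "P (abs_free_lie t)"
    by (induction t) (auto simp: abs_free_lie_simps intro: assms)
  then show ?thesis using t by simp
qed

lemma parity_decomposition: "\<exists>y z. of_parity 0 y \<and> of_parity 1 z \<and> x = y + z"
proof (induction x)
  case (gen i g)
  show ?case
  proof (cases "i = 0")
    case True
    then show ?thesis using of_parity_gen[of i g] of_parity_zero by (metis add.right_neutral)
  next
    case False
    then show ?thesis using of_parity_gen[of i g] of_parity_zero
      by (metis add.left_neutral bit_not_zero_iff)
  qed
next
  case zero
  show ?case using of_parity_zero by (metis add.right_neutral)
next
  case (add x y)
  then obtain x0 x1 y0 y1 where "of_parity 0 x0" "of_parity 1 x1" "x = x0 + x1"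
    "of_parity 0 y0" "of_parity 1 y1" "y = y0 + y1" by blast
  then show ?case by (intro exI[of _ "x0 + y0"] exI[of _ "x1 + y1"]) (simp add: of_parity_add)
next
  case (scale c x)
  then obtain x0 x1 where "of_parity 0 x0" "of_parity 1 x1" "x = x0 + x1" by blast
  then show ?case
    by (intro exI[of _ "scl c x0"] exI[of _ "scl c x1"]) (simp add: of_parity_scale free_lie.scale_right_distrib)
next
  case (br x y)
  then obtain x0 x1 y0 y1 where *: "of_parity 0 x0" "of_parity 1 x1" "x = x0 + x1"
    "of_parity 0 y0" "of_parity 1 y1" "y = y0 + y1" by blast
  have "of_parity 0 (br x0 y0 + br x1 y1)" "of_parity 1 (br x0 y1 + br x1 y0)"
    using of_parity_br[OF *(1,4)] of_parity_br[OF *(2,5)] of_parity_br[OF *(1,5)] of_parity_br[OF *(2,4)]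
    by (auto intro!: of_parity_add)
  then show ?case using * by (intro exI[of _ "br x0 y0 + br x1 y1"] exI[of _ "br x0 y1 + br x1 y0"])
      (simp add: br_add_left br_add_right)
qed

text \<open>Both sides are additive in the third argument, which therefore need not be
  homogeneous.\<close>

lemma br_jacobi:
  assumes "of_parity i x" "of_parity j y"
  shows "br x (br y z) = br (br x y) z + scl (koszul_sign i j) (br y (br x z))"
proof -
  have *: "br x (br y z) = br (br x y) z + scl (koszul_sign i j) (br y (br x z))" if z: "of_parity k z" for k z
  proof -
    obtain t u w where *: "has_parity fst t i" "x = abs_free_lie t" "has_parity fst u j" "y = abs_free_lie u"
      "has_parity fst w k" "z = abs_free_lie w"
      using assms z unfolding of_parity_def by blast
    have "lie_eq UNIV fst {} (Brack t (Brack u w))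
       (Plus (Brack (Brack t u) w) (Scale (koszul_sign i j) (Brack u (Brack t w))))"
      by (rule lie_eq.jacobi) (use * in simp_all)
    then show ?thesis unfolding *(2,4,6) abs_free_lie_simps(3-5)[symmetric] by (simp only: free_lie.abs_eq_iff)
  qed
  obtain z0 z1 where z: "of_parity 0 z0" "of_parity 1 z1" "z = z0 + z1" using parity_decomposition by blast
  show ?thesis
    unfolding z(3) br_add_right *[OF z(1)] *[OF z(2)] free_lie.scale_right_distrib by simp
qed

section \<open>Systems of generators modulo an ideal\<close>

fun nested :: "('x \<Rightarrow> 'g free_lie) \<Rightarrow> 'x list \<Rightarrow> 'g free_lie" where
  "nested e [] = 0"
| "nested e [x] = e x"
| "nested e (x # y # w) = br (e x) (nested e (y # w))"

lemma nested_Cons: "w \<noteq> [] \<Longrightarrow> nested e (x # w) = br (e x) (nested e w)"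
  by (cases w) auto

definition word_weight :: "('x \<Rightarrow> 'u \<Rightarrow> complex) \<Rightarrow> 'x list \<Rightarrow> 'u \<Rightarrow> complex" where
  "word_weight b w = (\<lambda>h. \<Sum>x\<leftarrow>w. b x h)"

lemma word_weight_count:
  assumes "finite X" "w \<in> lists X"
  shows "word_weight b w = (\<lambda>h. \<Sum>x\<in>X. of_nat (count_list w x) * b x h)"
  using assms(2)
proof (induction w)
  case Nil
  show ?case by (simp add: word_weight_def)
next
  case (Cons y w)
  have "(\<Sum>x\<in>X. of_nat (count_list (y # w) x) * b x h) =
    (\<Sum>x\<in>X. (if x = y then b x h else 0) + of_nat (count_list w x) * b x h)" for h
    by (rule sum.cong) (auto simp: algebra_simps)
  also have "\<dots> h = b y h + (\<Sum>x\<in>X. of_nat (count_list w x) * b x h)" for h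
    using Cons assms(1) by (simp add: sum.distrib)
  finally show ?case using Cons by (simp add: word_weight_def fun_eq_iff)
qed

text \<open>The relations are only required modulo \<open>N\<close>, so that the generators attached to different root data of
  one skeleton can be compared inside a single algebra.\<close>

locale generated_system =
  fixes s :: "complex \<Rightarrow> 'u::ab_group_add \<Rightarrow> 'u" and C :: "'u set" and X :: "'x set"
    and N :: "'g free_lie set" and \<eta> :: "'u \<Rightarrow> 'g free_lie"
    and e f :: "'x \<Rightarrow> 'g free_lie" and a :: "'x \<Rightarrow> 'u" and b :: "'x \<Rightarrow> 'u \<Rightarrow> complex" and p :: "'x \<Rightarrow> bit"
  assumes vs: "vector_space s" and finX: "finite X"
    and C: "module.subspace s C" and a_in: "\<And>x. x \<in> X \<Longrightarrow> a x \<in> C"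
    and b_outside: "\<And>x h. h \<notin> C \<Longrightarrow> b x h = 0"
    and b_independent: "\<And>c x. (\<And>h. h \<in> C \<Longrightarrow> (\<Sum>x\<in>X. c x * b x h) = 0) \<Longrightarrow> x \<in> X \<Longrightarrow> c x = 0"
    and N: "free_lie.subspace N" and N_br: "\<And>x n. n \<in> N \<Longrightarrow> br x n \<in> N" "\<And>x n. n \<in> N \<Longrightarrow> br n x \<in> N"
    and \<eta>_add: "\<And>h k. h \<in> C \<Longrightarrow> k \<in> C \<Longrightarrow> \<eta> (h + k) - (\<eta> h + \<eta> k) \<in> N"
    and \<eta>_scale: "\<And>c h. h \<in> C \<Longrightarrow> \<eta> (s c h) - scl c (\<eta> h) \<in> N"
    and \<eta>_parity: "\<And>h. of_parity 0 (\<eta> h)"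
    and e_parity: "\<And>x. x \<in> X \<Longrightarrow> of_parity (p x) (e x)" and f_parity: "\<And>x. x \<in> X \<Longrightarrow> of_parity (p x) (f x)"
    and \<eta>_\<eta>: "\<And>h k. h \<in> C \<Longrightarrow> k \<in> C \<Longrightarrow> br (\<eta> h) (\<eta> k) \<in> N"
    and \<eta>_e: "\<And>h x. h \<in> C \<Longrightarrow> x \<in> X \<Longrightarrow> br (\<eta> h) (e x) - scl (b x h) (e x) \<in> N"
    and \<eta>_f: "\<And>h x. h \<in> C \<Longrightarrow> x \<in> X \<Longrightarrow> br (\<eta> h) (f x) - scl (- b x h) (f x) \<in> N"
    and e_f: "\<And>x y. x \<in> X \<Longrightarrow> y \<in> X \<Longrightarrow> x \<noteq> y \<Longrightarrow> br (e x) (f y) \<in> N"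
    and e_f_same: "\<And>x. x \<in> X \<Longrightarrow> br (e x) (f x) - \<eta> (a x) \<in> N"
    and generate: "\<And>S. free_lie.subspace S \<Longrightarrow> N \<subseteq> S \<Longrightarrow> (\<And>h. h \<in> C \<Longrightarrow> \<eta> h \<in> S) \<Longrightarrow>
        (\<And>x. x \<in> X \<Longrightarrow> e x \<in> S) \<Longrightarrow> (\<And>x. x \<in> X \<Longrightarrow> f x \<in> S) \<Longrightarrow>
        (\<And>y z. y \<in> S \<Longrightarrow> z \<in> S \<Longrightarrow> br y z \<in> S) \<Longrightarrow> S = UNIV"
begin

interpretation vector_space s by (rule vs)

lemmas N_zero = free_lie.subspace_0[OF N]
  and N_add = free_lie.subspace_add[OF N]
  and N_diff = free_lie.subspace_diff[OF N]
  and N_scale = free_lie.subspace_scale[OF N]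
  and N_neg = free_lie.subspace_neg[OF N]

lemma N_mod: "x - y \<in> N \<Longrightarrow> x \<in> N \<longleftrightarrow> y \<in> N"
  using N_add[of "x - y" y] N_diff[of x "x - y"] by auto

lemma N_sym: "x - y \<in> N \<Longrightarrow> y - x \<in> N"
  using N_neg[of "x - y"] by simp

lemma N_trans: "x - y \<in> N \<Longrightarrow> y - z \<in> N \<Longrightarrow> x - z \<in> N"
  using N_add[of "x - y" "y - z"] by simp

lemma N_mod_add: "x - y \<in> N \<Longrightarrow> z - w \<in> N \<Longrightarrow> (x + z) - (y + w) \<in> N"
  using N_add[of "x - y" "z - w"] by (simp add: algebra_simps)

lemma N_mod_scale: "x - y \<in> N \<Longrightarrow> scl c x - scl c y \<in> N"
  using N_scale[of "x - y" c] by (simp add: free_lie.scale_right_diff_distrib)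

lemma N_mod_br: "x - y \<in> N \<Longrightarrow> br x z - br y z \<in> N" "x - y \<in> N \<Longrightarrow> br z x - br z y \<in> N"
  using N_br(2)[of "x - y" z] N_br(1)[of "x - y" z] by (simp_all add: br_diff)

text \<open>Exchanging raising and lowering generators negates the roots, and skew symmetry of [f,e]
  determines the sign of the coroots. Facts about words in \<open>e\<close> thereby carry over to
  words in \<open>f\<close>.\<close>

lemma swapped: "generated_system s C X N \<eta> f e (\<lambda>x. s (- koszul_sign (p x) (p x)) (a x)) (\<lambda>x h. - b x h) p"
proof
  show "x \<in> X \<Longrightarrow> s (- koszul_sign (p x) (p x)) (a x) \<in> C" for x using a_in subspace_scale[OF C] by blast
  show "c x = 0" if "\<And>h. h \<in> C \<Longrightarrow> (\<Sum>x\<in>X. c x * - b x h) = 0" "x \<in> X" for c x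
    using b_independent[of c x] that by (simp add: sum_negf)
  show "br (\<eta> h) (e x) - scl (- (- b x h)) (e x) \<in> N" if "h \<in> C" "x \<in> X" for h x using \<eta>_e[OF that] by simp
  show "br (f x) (e y) \<in> N" if "x \<in> X" "y \<in> X" "x \<noteq> y" for x y
    unfolding br_skew[OF f_parity[OF that(1)] e_parity[OF that(2)]] by (rule N_scale[OF e_f]) (use that in auto)
  show "br (f x) (e x) - \<eta> (s (- koszul_sign (p x) (p x)) (a x)) \<in> N" if "x \<in> X" for x
    unfolding br_skew[OF f_parity[OF that] e_parity[OF that]]
    by (rule N_trans[OF N_mod_scale[OF e_f_same[OF that]] N_sym[OF \<eta>_scale[OF a_in[OF that]]]])
  show "S = UNIV" if "free_lie.subspace S" "N \<subseteq> S" "\<And>h. h \<in> C \<Longrightarrow> \<eta> h \<in> S" "\<And>x. x \<in> X \<Longrightarrow> f x \<in> S"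
    "\<And>x. x \<in> X \<Longrightarrow> e x \<in> S" "\<And>y z. y \<in> S \<Longrightarrow> z \<in> S \<Longrightarrow> br y z \<in> S" for S
    by (rule generate) (use that in auto)
qed (use finX C b_outside N N_br \<eta>_add \<eta>_scale \<eta>_parity e_parity f_parity \<eta>_\<eta> \<eta>_f in auto)

section \<open>Weight vectors modulo the ideal\<close>

definition "has_weight \<alpha> z \<longleftrightarrow> (\<forall>h\<in>C. br (\<eta> h) z - scl (\<alpha> h) z \<in> N)"

lemma has_weight_nested:
  assumes "w \<in> lists X"
  shows "has_weight (word_weight b w) (nested e w)"
  using assms
proof (induction w)
  case Nil
  show ?case by (simp add: has_weight_def N_zero)
next
  case (Cons x w)
  show ?case
  proof (cases "w = []")
    case True
    then show ?thesis using \<eta>_e Cons by (simp add: has_weight_def word_weight_def)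
  next
    case False
    have "br (\<eta> h) (nested e (x # w)) - scl (word_weight b (x # w) h) (nested e (x # w)) \<in> N" if h: "h \<in> C" for h
    proof -
      have "br (\<eta> h) (br (e x) (nested e w)) = br (br (\<eta> h) (e x)) (nested e w) + br (e x) (br (\<eta> h) (nested e w))"
        using br_jacobi[OF \<eta>_parity e_parity, of x h "nested e w"] Cons by (simp add: koszul_sign_def)
      moreover have "br (br (\<eta> h) (e x)) (nested e w) - br (scl (b x h) (e x)) (nested e w) \<in> N"
        using \<eta>_e[OF h] Cons by (intro N_mod_br) auto
      moreover have "br (e x) (br (\<eta> h) (nested e w)) - br (e x) (scl (word_weight b w h) (nested e w)) \<in> N"
        using Cons h by (intro N_mod_br) (auto simp: has_weight_def)
      ultimately have "br (\<eta> h) (br (e x) (nested e w)) -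
          (br (scl (b x h) (e x)) (nested e w) + br (e x) (scl (word_weight b w h) (nested e w))) \<in> N"
        using N_mod_add by metis
      then show ?thesis using False
        by (simp add: nested_Cons br_scale_left br_scale_right word_weight_def free_lie.scale_left_distrib)
    qed
    then show ?thesis by (simp add: has_weight_def)
  qed
qed

lemma has_weight_\<eta>: "h \<in> C \<Longrightarrow> has_weight (\<lambda>_. 0) (\<eta> h)"
  by (simp add: has_weight_def \<eta>_\<eta>)

lemma has_weight_add: "has_weight \<alpha> x \<Longrightarrow> has_weight \<alpha> y \<Longrightarrow> has_weight \<alpha> (x + y)"
  unfolding has_weight_def br_add_right free_lie.scale_right_distrib using N_mod_add by blast

lemma has_weight_scale: "has_weight \<alpha> x \<Longrightarrow> has_weight \<alpha> (scl c x)"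
  unfolding has_weight_def br_scale_right using N_mod_scale
  by (metis free_lie.scale_left_commute)

lemma has_weight_zero: "has_weight \<alpha> 0"
  by (simp add: has_weight_def N_zero)

lemma has_weight_subspace: "free_lie.subspace {z. has_weight \<alpha> z}"
  by (simp add: free_lie.subspace_def has_weight_zero has_weight_add has_weight_scale)

text \<open>Separating one weight from another by an element of the Cartan subspace removes it from a sum.\<close>

lemma weight_components:
  assumes J: "free_lie.subspace J" "N \<subseteq> J" "\<And>h j. h \<in> C \<Longrightarrow> j \<in> J \<Longrightarrow> br (\<eta> h) j \<in> J"
    and A: "finite A" "\<And>\<alpha>. \<alpha> \<in> A \<Longrightarrow> \<forall>h. h \<notin> C \<longrightarrow> \<alpha> h = 0" "\<And>\<alpha>. \<alpha> \<in> A \<Longrightarrow> has_weight \<alpha> (z \<alpha>)"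
    and sum: "(\<Sum>\<alpha>\<in>A. z \<alpha>) \<in> J" and "\<alpha> \<in> A"
  shows "z \<alpha> \<in> J"
  using A sum \<open>\<alpha> \<in> A\<close>
proof (induction "card A" arbitrary: A z \<alpha> rule: less_induct)
  case less
  note A = less.prems
  show ?case
  proof (cases "A = {\<alpha>}")
    case True
    then show ?thesis using A by simp
  next
    case False
    then obtain \<beta> where \<beta>: "\<beta> \<in> A" "\<beta> \<noteq> \<alpha>" using A(5) by blast
    then obtain h where h: "\<alpha> h \<noteq> \<beta> h" by (metis ext)
    then have hC: "h \<in> C" using A(2)[OF \<beta>(1)] A(2)[OF A(5)] by metis
    have "(\<Sum>\<gamma>\<in>A. br (\<eta> h) (z \<gamma>)) = br (\<eta> h) (\<Sum>\<gamma>\<in>A. z \<gamma>)"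
      by (induction A rule: infinite_finite_induct) (auto simp: br_add_right)
    also have "\<dots> \<in> J" by (rule J(3)[OF hC A(4)])
    finally have 1: "(\<Sum>\<gamma>\<in>A. br (\<eta> h) (z \<gamma>)) \<in> J" .
    have 2: "(\<Sum>\<gamma>\<in>A. br (\<eta> h) (z \<gamma>) - scl (\<gamma> h) (z \<gamma>)) \<in> J"
      using A(3) hC J(2) by (intro free_lie.subspace_sum[OF J(1)]) (auto simp: has_weight_def)
    have 3: "(\<Sum>\<gamma>\<in>A. scl (\<beta> h) (z \<gamma>)) \<in> J"
      using free_lie.subspace_scale[OF J(1) A(4), of "\<beta> h"] by (simp add: free_lie.scale_sum_right)
    have "(\<Sum>\<gamma>\<in>A. br (\<eta> h) (z \<gamma>)) - (\<Sum>\<gamma>\<in>A. br (\<eta> h) (z \<gamma>) - scl (\<gamma> h) (z \<gamma>)) - (\<Sum>\<gamma>\<in>A. scl (\<beta> h) (z \<gamma>)) \<in> J"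
      by (intro free_lie.subspace_diff[OF J(1)] 1 2 3)
    then have "(\<Sum>\<gamma>\<in>A. scl (\<gamma> h - \<beta> h) (z \<gamma>)) \<in> J"
      by (simp add: sum_subtractf[symmetric] free_lie.scale_left_diff_distrib)
    also have "(\<Sum>\<gamma>\<in>A. scl (\<gamma> h - \<beta> h) (z \<gamma>)) = (\<Sum>\<gamma>\<in>A - {\<beta>}. scl (\<gamma> h - \<beta> h) (z \<gamma>))"
      using A(1) \<beta>(1) by (subst sum.remove[of _ \<beta>]) auto
    finally have "scl (\<alpha> h - \<beta> h) (z \<alpha>) \<in> J"
      using A \<beta> card_Diff1_less[OF A(1) \<beta>(1)] by (intro less.hyps[of "A - {\<beta>}" "\<lambda>\<gamma>. scl (\<gamma> h - \<beta> h) (z \<gamma>)"])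
        (auto simp del: card_Diff_insert intro: has_weight_scale)
    then have "scl (inverse (\<alpha> h - \<beta> h)) (scl (\<alpha> h - \<beta> h) (z \<alpha>)) \<in> J" by (rule free_lie.subspace_scale[OF J(1)])
    then show ?thesis using h by simp
  qed
qed

lemma br_span:
  assumes "free_lie.subspace S" "\<And>g. g \<in> G \<Longrightarrow> br z g \<in> S" "y \<in> free_lie.span G"
  shows "br z y \<in> S"
  using assms(3)
  by (induction rule: free_lie.span_induct_alt)
    (use assms(1,2) in \<open>auto simp: br_add_right br_scale_right free_lie.subspace_0
      intro: free_lie.subspace_add free_lie.subspace_scale\<close>)

lemma \<eta>_zero: "\<eta> 0 \<in> N"
  using \<eta>_scale[of 0 0] subspace_0[OF C] by simp

lemma br_\<eta>_right:
  assumes "h \<in> C" "x \<in> X"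
  shows "br (e x) (\<eta> h) - scl (- b x h) (e x) \<in> N"
proof -
  have "br (e x) (\<eta> h) = - br (\<eta> h) (e x)"
    using br_skew[OF e_parity[OF assms(2)] \<eta>_parity, of h] by (simp add: koszul_sign_def)
  then show ?thesis using N_neg[OF \<eta>_e[OF assms]] by simp
qed

text \<open>Induction on the word by the Jacobi identity: the bracket with the first letter is zero
  or a Cartan element, which acts on the remaining word by a scalar.\<close>

lemma br_e_nested_f:
  assumes w: "w \<in> lists X" and x: "x \<in> X"
  shows "br (e x) (nested f w) \<in> free_lie.span (N \<union> \<eta> ` C \<union> nested f ` lists X)" (is "_ \<in> ?S")
proof -
  interpret sw: generated_system s C X N \<eta> f e "\<lambda>x. s (- koszul_sign (p x) (p x)) (a x)" "\<lambda>x h. - b x h" p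
    by (rule swapped)
  have S: "free_lie.subspace ?S" by (rule free_lie.subspace_span)
  have NS: "n \<in> ?S" if "n \<in> N" for n using that by (intro free_lie.span_base) auto
  have modS: "z \<in> ?S" if "z - y \<in> N" "y \<in> ?S" for y z
    using free_lie.subspace_add[OF S NS[OF that(1)] that(2)] by simp
  have fS: "nested f w \<in> ?S" if "w \<in> lists X" for w using that by (intro free_lie.span_base) auto
  have \<eta>S: "\<eta> h \<in> ?S" if "h \<in> C" for h using that by (intro free_lie.span_base) auto
  \<comment> \<open>Stability of the span under the lowering generators handles the other Jacobi
    term, where the induction hypothesis sits inside a bracket with the first letter.\<close>
  have ad_f: "br (f y) z \<in> ?S" if y: "y \<in> X" and z: "z \<in> ?S" for y z
  proof (rule br_span[OF S _ z])
    fix g assume "g \<in> N \<union> \<eta> ` C \<union> nested f ` lists X"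
    then consider "g \<in> N" | h where "h \<in> C" "g = \<eta> h" | w where "w \<in> lists X" "g = nested f w" by blast
    then show "br (f y) g \<in> ?S"
    proof cases
      case 1
      then show ?thesis by (intro NS N_br)
    next
      case 2
      show ?thesis unfolding 2
        by (rule modS[OF sw.br_\<eta>_right[OF 2(1) y]])
          (use fS[of "[y]"] y in \<open>auto intro: free_lie.subspace_scale[OF S]\<close>)
    next
      case 3
      show ?thesis
      proof (cases "w = []")
        case True
        then show ?thesis using 3 free_lie.subspace_0[OF S] by simp
      next
        case False
        then show ?thesis using 3 fS[of "y # w"] y by (simp add: nested_Cons)
      qed
    qed
  qed
  show ?thesis using w
  proof (induction w)
    case Nil
    then show ?case using free_lie.subspace_0[OF S] by simp
  next
    case (Cons y w)
    have y: "y \<in> X" using Cons by simp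
    have xy: "br (e x) (f y) \<in> ?S"
    proof (cases "x = y")
      case True
      then show ?thesis using modS[OF e_f_same[OF x] \<eta>S[OF a_in[OF x]]] by simp
    next
      case False
      then show ?thesis using NS e_f x y by blast
    qed
    show ?case
    proof (cases "w = []")
      case True
      then show ?thesis using xy by simp
    next
      case False
      have "br (br (e x) (f y)) (nested f w) \<in> ?S"
      proof (cases "x = y")
        case True
        have "br (br (e x) (f x)) (nested f w) - br (\<eta> (a x)) (nested f w) \<in> N"
          by (rule N_mod_br[OF e_f_same[OF x]])
        moreover have "br (\<eta> (a x)) (nested f w) - scl (word_weight (\<lambda>x h. - b x h) w (a x)) (nested f w) \<in> N"
          using sw.has_weight_nested[of w] Cons a_in[OF x] by (auto simp: sw.has_weight_def)
        ultimately show ?thesis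
          using modS[OF N_trans] free_lie.subspace_scale[OF S fS[of w]] Cons True by auto
      next
        case False
        then show ?thesis using NS N_br e_f x y by blast
      qed
      moreover have "br (f y) (br (e x) (nested f w)) \<in> ?S" using ad_f[OF y] Cons by simp
      moreover have "br (e x) (nested f (y # w)) = br (br (e x) (f y)) (nested f w)
          + scl (koszul_sign (p x) (p y)) (br (f y) (br (e x) (nested f w)))"
        using False by (simp add: nested_Cons br_jacobi[OF e_parity[OF x] f_parity[OF y]])
      ultimately show ?thesis using S by (simp add: free_lie.subspace_add free_lie.subspace_scale)
    qed
  qed
qed

text \<open>This is the triangular decomposition: the span is stable under bracketing with the
  generators, hence with everything they generate, so it is a subalgebra that contains them.\<close>

lemma span_UNIV: "free_lie.span (N \<union> \<eta> ` C \<union> nested e ` lists X \<union> nested f ` lists X) = UNIV"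
proof -
  interpret sw: generated_system s C X N \<eta> f e "\<lambda>x. s (- koszul_sign (p x) (p x)) (a x)" "\<lambda>x h. - b x h" p
    by (rule swapped)
  define S where "S = free_lie.span (N \<union> \<eta> ` C \<union> nested e ` lists X \<union> nested f ` lists X)"
  have S: "free_lie.subspace S" unfolding S_def by (rule free_lie.subspace_span)
  have NS: "n \<in> S" if "n \<in> N" for n using that unfolding S_def by (intro free_lie.span_base) auto
  have modS: "z \<in> S" if "z - y \<in> N" "y \<in> S" for y z
    using free_lie.subspace_add[OF S NS[OF that(1)] that(2)] by simp
  have eS: "nested e w \<in> S" and fS: "nested f w \<in> S" if "w \<in> lists X" for w
    using that unfolding S_def by (auto intro!: free_lie.span_base)
  have \<eta>S: "\<eta> h \<in> S" if "h \<in> C" for h using that unfolding S_def by (intro free_lie.span_base) auto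
  have e1: "e x \<in> S" and f1: "f x \<in> S" if "x \<in> X" for x using eS[of "[x]"] fS[of "[x]"] that by auto
  define stab where "stab = {z. \<forall>y\<in>S. br z y \<in> S}"
  have stabI: "z \<in> stab" if "\<And>n. n \<in> N \<Longrightarrow> br z n \<in> S" "\<And>h. h \<in> C \<Longrightarrow> br z (\<eta> h) \<in> S"
    "\<And>w. w \<in> lists X \<Longrightarrow> br z (nested e w) \<in> S" "\<And>w. w \<in> lists X \<Longrightarrow> br z (nested f w) \<in> S" for z
    unfolding stab_def
  proof (intro CollectI ballI)
    fix y assume "y \<in> S"
    then show "br z y \<in> S" unfolding S_def
      by (rule br_span[OF S[unfolded S_def], rotated]) (use that in \<open>auto simp: S_def\<close>)
  qed
  have sub1: "free_lie.span (N \<union> \<eta> ` C \<union> nested f ` lists X) \<subseteq> S"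
    "free_lie.span (N \<union> \<eta> ` C \<union> nested e ` lists X) \<subseteq> S" unfolding S_def by (intro free_lie.span_mono; blast)+
  have cons: "br (e x) (nested e w) \<in> S" "br (f x) (nested f w) \<in> S" if "w \<in> lists X" "x \<in> X" for x w
    using eS[of "x # w"] fS[of "x # w"] that free_lie.subspace_0[OF S] by (cases w; simp)+
  have est: "e x \<in> stab" if x: "x \<in> X" for x
  proof (rule stabI)
    show "br (e x) (\<eta> h) \<in> S" if "h \<in> C" for h
      by (rule modS[OF br_\<eta>_right[OF that x] free_lie.subspace_scale[OF S e1[OF x]]])
    show "br (e x) (nested f w) \<in> S" if "w \<in> lists X" for w using br_e_nested_f[OF that x] sub1 by blast
  qed (use NS N_br cons x in auto)
  have fst: "f x \<in> stab" if x: "x \<in> X" for x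
  proof (rule stabI)
    show "br (f x) (\<eta> h) \<in> S" if "h \<in> C" for h
      by (rule modS[OF sw.br_\<eta>_right[OF that x] free_lie.subspace_scale[OF S f1[OF x]]])
    show "br (f x) (nested e w) \<in> S" if "w \<in> lists X" for w using sw.br_e_nested_f[OF that x] sub1 by blast
  qed (use NS N_br cons x in auto)
  have \<eta>st: "\<eta> h \<in> stab" if h: "h \<in> C" for h
  proof (rule stabI)
    show "br (\<eta> h) (nested e w) \<in> S" if "w \<in> lists X" for w
      using has_weight_nested[OF that] h modS[OF _ free_lie.subspace_scale[OF S eS[OF that]]]
      unfolding has_weight_def by blast
    show "br (\<eta> h) (nested f w) \<in> S" if "w \<in> lists X" for w
      using sw.has_weight_nested[OF that] h modS[OF _ free_lie.subspace_scale[OF S fS[OF that]]]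
      unfolding sw.has_weight_def by blast
  qed (use NS N_br \<eta>_\<eta> h in auto)
  have Nst: "n \<in> stab" if "n \<in> N" for n using that NS N_br by (auto simp: stab_def)
  have stab: "free_lie.subspace stab"
    unfolding free_lie.subspace_def stab_def
    using S by (auto simp: br_add_left br_scale_left intro: free_lie.subspace_0 free_lie.subspace_add free_lie.subspace_scale)
  have stab_br: "br y z \<in> stab" if "y \<in> stab" "z \<in> stab" "of_parity i y" "of_parity j z" for y z i j
  proof -
    have "br (br y z) g = br y (br z g) - scl (koszul_sign i j) (br z (br y g))" for g
      using br_jacobi[OF that(3,4), of g] by simp
    then show ?thesis using that(1,2) free_lie.subspace_diff[OF S] free_lie.subspace_scale[OF S]
      unfolding stab_def by auto
  qed
  \<comment> \<open>The Jacobi identity is available for homogeneous elements, so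
    \<open>stab\<close> is not visibly closed under brackets. \<open>T\<close> adds up its
    homogeneous elements and the ideal, and is a subalgebra containing all generators.\<close>
  define T where "T = {n + y + z | n y z. n \<in> N \<and> y \<in> stab \<and> z \<in> stab \<and> of_parity 0 y \<and> of_parity 1 z}"
  have NT: "n \<in> T" if "n \<in> N" for n
  proof -
    have "n = n + 0 + 0" by simp
    then show ?thesis unfolding T_def using that of_parity_zero free_lie.subspace_0[OF stab] by blast
  qed
  have homT: "z \<in> T" if "z \<in> stab" "of_parity i z" for z i
  proof (cases "i = 0")
    case True
    have "z = 0 + z + 0" by simp
    then show ?thesis unfolding T_def using that True of_parity_zero free_lie.subspace_0[OF stab] N_zero by blast
  next
    case False
    then have "i = 1" by (simp add: bit_not_zero_iff)
    have "z = 0 + 0 + z" by simp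
    then show ?thesis unfolding T_def using that \<open>i = 1\<close> of_parity_zero free_lie.subspace_0[OF stab] N_zero by blast
  qed
  have T: "free_lie.subspace T"
    unfolding free_lie.subspace_def
  proof (intro conjI ballI allI)
    show "0 \<in> T" by (rule NT[OF N_zero])
    fix x assume "x \<in> T"
    then obtain n x0 x1 where x: "x = n + x0 + x1" "n \<in> N" "x0 \<in> stab" "x1 \<in> stab" "of_parity 0 x0" "of_parity 1 x1"
      unfolding T_def by blast
    show "scl c x \<in> T" for c
    proof -
      have "scl c x = scl c n + scl c x0 + scl c x1 \<and> scl c n \<in> N \<and> scl c x0 \<in> stab \<and> scl c x1 \<in> stab \<and>
          of_parity 0 (scl c x0) \<and> of_parity 1 (scl c x1)"
        using x by (simp add: free_lie.scale_right_distrib of_parity_scale free_lie.subspace_scale[OF stab] N_scale)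
      then show ?thesis unfolding T_def by blast
    qed
    fix y assume "y \<in> T"
    then obtain m y0 y1 where y: "y = m + y0 + y1" "m \<in> N" "y0 \<in> stab" "y1 \<in> stab" "of_parity 0 y0" "of_parity 1 y1"
      unfolding T_def by blast
    have "x + y = (n + m) + (x0 + y0) + (x1 + y1) \<and> n + m \<in> N \<and> x0 + y0 \<in> stab \<and> x1 + y1 \<in> stab \<and>
        of_parity 0 (x0 + y0) \<and> of_parity 1 (x1 + y1)"
      using x y by (simp add: of_parity_add free_lie.subspace_add[OF stab] N_add)
    then show "x + y \<in> T" unfolding T_def by blast
  qed
  have "T = UNIV"
  proof (rule generate[OF T])
    show "N \<subseteq> T" using NT by blast
    show "br y z \<in> T" if yz: "y \<in> T" "z \<in> T" for y z
    proof -
      obtain n y0 y1 m z0 z1 where y: "y = n + y0 + y1" "n \<in> N" "y0 \<in> stab" "y1 \<in> stab" "of_parity 0 y0" "of_parity 1 y1"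
        and z: "z = m + z0 + z1" "m \<in> N" "z0 \<in> stab" "z1 \<in> stab" "of_parity 0 z0" "of_parity 1 z1"
        using yz unfolding T_def by blast
      have "br y0 z0 \<in> T" "br y0 z1 \<in> T" "br y1 z0 \<in> T" "br y1 z1 \<in> T"
        using y z by (blast intro: homT stab_br of_parity_br)+
      moreover have "br n t \<in> T" "br t m \<in> T" for t using N_br y z NT by blast+
      ultimately show ?thesis unfolding y(1) z(1) br_add_left br_add_right by (intro free_lie.subspace_add[OF T])
    qed
  qed (use homT \<eta>st est fst \<eta>_parity e_parity f_parity in blast)+
  then have "z \<in> stab" for z
  proof -
    have "z \<in> T" using \<open>T = UNIV\<close> by simp
    then show ?thesis unfolding T_def using free_lie.subspace_add[OF stab] Nst by auto
  qed
  then show ?thesis unfolding S_def[symmetric]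
    by (intro generate[OF S]) (use NS \<eta>S e1 f1 in \<open>auto simp: stab_def\<close>)
qed

section \<open>Weight spaces spanned by words\<close>

definition "weight_gens \<alpha> =
  {nested e w | w. w \<in> lists X \<and> w \<noteq> [] \<and> word_weight b w = \<alpha>} \<union>
  {nested f w | w. w \<in> lists X \<and> w \<noteq> [] \<and> word_weight b w = - \<alpha>} \<union>
  {\<eta> h | h. h \<in> C \<and> \<alpha> = 0}"

lemma word_weight_uminus: "word_weight (\<lambda>x h. - b x h) w = - word_weight b w"
  by (induction w) (auto simp: word_weight_def fun_eq_iff)

lemma word_weight_outside: "h \<notin> C \<Longrightarrow> word_weight b w h = 0"
  by (induction w) (auto simp: word_weight_def b_outside)

lemma has_weight_nested_f:
  assumes "w \<in> lists X" shows "has_weight (- word_weight b w) (nested f w)"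
proof -
  interpret sw: generated_system s C X N \<eta> f e "\<lambda>x. s (- koszul_sign (p x) (p x)) (a x)" "\<lambda>x h. - b x h" p
    by (rule swapped)
  show ?thesis using sw.has_weight_nested[OF assms] unfolding sw.has_weight_def has_weight_def word_weight_uminus .
qed

lemma weight_gens_cases:
  assumes "g \<in> weight_gens \<alpha>"
  obtains w where "w \<in> lists X" "w \<noteq> []" "word_weight b w = \<alpha>" "g = nested e w"
    | w where "w \<in> lists X" "w \<noteq> []" "word_weight b w = - \<alpha>" "g = nested f w"
    | h where "h \<in> C" "\<alpha> = 0" "g = \<eta> h"
  using assms unfolding weight_gens_def by blast

lemma has_weight_gens:
  assumes "g \<in> weight_gens \<alpha>" shows "has_weight \<alpha> g"
  using assms
proof (cases rule: weight_gens_cases)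
  case (1 w)
  then show ?thesis using has_weight_nested by blast
next
  case (2 w)
  then have "\<alpha> = - word_weight b w" by simp
  then show ?thesis using has_weight_nested_f 2 by blast
next
  case (3 h)
  then show ?thesis using has_weight_\<eta> by (simp add: zero_fun_def)
qed

lemma weight_gens_outside:
  assumes "g \<in> weight_gens \<alpha>" "h \<notin> C" shows "\<alpha> h = 0"
  using assms(1)
proof (cases rule: weight_gens_cases)
  case (2 w)
  then have "\<alpha> h = - word_weight b w h" by simp
  then show ?thesis using word_weight_outside[OF assms(2)] by simp
qed (use word_weight_outside[OF assms(2)] in auto)

lemma weight_decomposition:
  "\<exists>n A y. n \<in> N \<and> finite A \<and> (\<forall>\<alpha>. y \<alpha> \<in> free_lie.span (weight_gens \<alpha>)) \<and>
     (\<forall>\<alpha>. \<alpha> \<notin> A \<longrightarrow> y \<alpha> = 0) \<and> (\<forall>\<alpha>\<in>A. \<forall>h. h \<notin> C \<longrightarrow> \<alpha> h = 0) \<and> z = n + (\<Sum>\<alpha>\<in>A. y \<alpha>)"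
proof -
  have "z \<in> free_lie.span (N \<union> \<eta> ` C \<union> nested e ` lists X \<union> nested f ` lists X)"
    by (simp add: span_UNIV)
  then show ?thesis
  proof (induction rule: free_lie.span_induct_alt)
    case base
    show ?case
      by (intro exI[of _ 0] exI[of _ "{}"] exI[of _ "\<lambda>_. 0"]) (simp add: N_zero free_lie.span_zero)
  next
    case (step c g z)
    then obtain n A y where *: "n \<in> N" "finite A" "\<And>\<alpha>. y \<alpha> \<in> free_lie.span (weight_gens \<alpha>)"
      "\<And>\<alpha>. \<alpha> \<notin> A \<Longrightarrow> y \<alpha> = 0" "\<forall>\<alpha>\<in>A. \<forall>h. h \<notin> C \<longrightarrow> \<alpha> h = 0" "z = n + (\<Sum>\<alpha>\<in>A. y \<alpha>)" by blast
    have "g \<in> N \<or> (\<exists>\<alpha>. g \<in> weight_gens \<alpha>)"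
    proof -
      have "nested e w \<in> N \<or> (\<exists>\<alpha>. nested e w \<in> weight_gens \<alpha>)" if "w \<in> lists X" for w
        using that by (cases "w = []") (auto simp: weight_gens_def N_zero)
      moreover have "nested f w \<in> N \<or> (\<exists>\<alpha>. nested f w \<in> weight_gens \<alpha>)" if "w \<in> lists X" for w
      proof (cases "w = []")
        case False
        then have "nested f w \<in> weight_gens (- word_weight b w)" using that unfolding weight_gens_def by auto
        then show ?thesis by blast
      qed (simp add: N_zero)
      moreover have "\<eta> h \<in> weight_gens 0" if "h \<in> C" for h using that by (auto simp: weight_gens_def)
      ultimately show ?thesis using step(1) by blast
    qed
    then show ?case
    proof
      assume "g \<in> N"
      then show ?thesis using *
        by (intro exI[of _ "scl c g + n"] exI[of _ A] exI[of _ y]) (auto simp: N_add N_scale)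
    next
      assume "\<exists>\<alpha>. g \<in> weight_gens \<alpha>"
      then obtain \<alpha> where \<alpha>: "g \<in> weight_gens \<alpha>" by blast
      define y' where "y' = y(\<alpha> := y \<alpha> + scl c g)"
      have "(\<Sum>\<beta>\<in>insert \<alpha> A. y' \<beta>) = y' \<alpha> + (\<Sum>\<beta>\<in>A - {\<alpha>}. y' \<beta>)"
        using *(2) by (subst sum.insert_remove) auto
      also have "(\<Sum>\<beta>\<in>A - {\<alpha>}. y' \<beta>) = (\<Sum>\<beta>\<in>A - {\<alpha>}. y \<beta>)" by (rule sum.cong) (auto simp: y'_def)
      also have "y' \<alpha> + \<dots> = scl c g + (y \<alpha> + (\<Sum>\<beta>\<in>A - {\<alpha>}. y \<beta>))" by (simp add: y'_def)
      also have "y \<alpha> + (\<Sum>\<beta>\<in>A - {\<alpha>}. y \<beta>) = (\<Sum>\<beta>\<in>insert \<alpha> A. y \<beta>)" using *(2) by (subst sum.insert_remove) auto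
      also have "\<dots> = (\<Sum>\<beta>\<in>A. y \<beta>)" using *(2,4) by (cases "\<alpha> \<in> A") (auto simp: insert_absorb)
      finally have "scl c g + z = n + (\<Sum>\<beta>\<in>insert \<alpha> A. y' \<beta>)" using *(6) by simp
      moreover have "y' \<beta> \<in> free_lie.span (weight_gens \<beta>)" for \<beta>
        using *(3) \<alpha> by (auto simp: y'_def intro: free_lie.span_add free_lie.span_scale free_lie.span_base)
      moreover have "\<forall>\<beta>. \<beta> \<notin> insert \<alpha> A \<longrightarrow> y' \<beta> = 0" using *(4) by (simp add: y'_def)
      moreover have "\<forall>\<beta>\<in>insert \<alpha> A. \<forall>h. h \<notin> C \<longrightarrow> \<beta> h = 0" using *(5) weight_gens_outside[OF \<alpha>] by blast
      ultimately show ?thesis using *(1,2)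
        by (intro exI[of _ n] exI[of _ "insert \<alpha> A"] exI[of _ y']) simp
    qed
  qed
qed

lemma has_weight_span: "y \<in> free_lie.span (weight_gens \<alpha>) \<Longrightarrow> has_weight \<alpha> y"
  using free_lie.span_minimal[OF _ has_weight_subspace, of "weight_gens \<alpha>" \<alpha>] has_weight_gens by blast

lemma weight_space:
  assumes z: "has_weight \<alpha> z" and \<alpha>: "\<forall>h. h \<notin> C \<longrightarrow> \<alpha> h = 0"
  obtains y where "y \<in> free_lie.span (weight_gens \<alpha>)" "z - y \<in> N"
proof -
  obtain n A y where *: "n \<in> N" "finite A" "\<And>\<alpha>. y \<alpha> \<in> free_lie.span (weight_gens \<alpha>)"
      "\<And>\<alpha>. \<alpha> \<notin> A \<Longrightarrow> y \<alpha> = 0" "\<forall>\<alpha>\<in>A. \<forall>h. h \<notin> C \<longrightarrow> \<alpha> h = 0" "z = n + (\<Sum>\<alpha>\<in>A. y \<alpha>)"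
    using weight_decomposition[of z] by blast
  \<comment> \<open>Subtracting \<open>z\<close> from the component at \<alpha> leaves weight
    vectors whose sum is \<open>- n\<close>, an element of \<open>N\<close>; by
    \<open>weight_components\<close> the component at \<alpha> then lies in
    \<open>N\<close>.\<close>
  define y' where "y' = y(\<alpha> := y \<alpha> - z)"
  have "(\<Sum>\<beta>\<in>insert \<alpha> A. y' \<beta>) = y' \<alpha> + (\<Sum>\<beta>\<in>A - {\<alpha>}. y' \<beta>)"
    using *(2) by (subst sum.insert_remove) auto
  also have "(\<Sum>\<beta>\<in>A - {\<alpha>}. y' \<beta>) = (\<Sum>\<beta>\<in>A - {\<alpha>}. y \<beta>)" by (rule sum.cong) (auto simp: y'_def)
  also have "y' \<alpha> + \<dots> = - z + (y \<alpha> + (\<Sum>\<beta>\<in>A - {\<alpha>}. y \<beta>))" by (simp add: y'_def)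
  also have "y \<alpha> + (\<Sum>\<beta>\<in>A - {\<alpha>}. y \<beta>) = (\<Sum>\<beta>\<in>insert \<alpha> A. y \<beta>)" using *(2) by (subst sum.insert_remove) auto
  also have "\<dots> = (\<Sum>\<beta>\<in>A. y \<beta>)" using *(2,4) by (cases "\<alpha> \<in> A") (auto simp: insert_absorb)
  finally have "(\<Sum>\<beta>\<in>insert \<alpha> A. y' \<beta>) = - n" using *(6) by simp
  then have s: "(\<Sum>\<beta>\<in>insert \<alpha> A. y' \<beta>) \<in> N" using *(1) N_neg by simp
  have w: "has_weight \<beta> (y' \<beta>)" for \<beta>
    using has_weight_span[OF *(3)] has_weight_add[of \<alpha> "y \<alpha>" "scl (-1) z"] has_weight_scale[OF z, of "-1"]
    by (auto simp: y'_def)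
  have "y' \<alpha> \<in> N"
    by (rule weight_components[OF N subset_refl N_br(1) _ _ _ s]) (use *(2,5) \<alpha> w in auto)
  then have "y \<alpha> - z \<in> N" by (simp add: y'_def)
  then show ?thesis using that[OF *(3)] N_sym by blast
qed

text \<open>In every Lie superalgebra [e,[e,e]] = 0: for even e already [e,e] = 0, and for odd e the
  Jacobi identity says that three times the element vanishes.\<close>

lemma nested_replicate: "x \<in> X \<Longrightarrow> nested e (replicate (3 + n) x) = 0"
proof (induction n)
  case 0
  have "br (e x) (br (e x) (e x)) = 0"
  proof (cases "p x = 0")
    case True
    then have "br (e x) (e x) + br (e x) (e x) = 0"
      using br_skew[OF e_parity[OF 0] e_parity[OF 0]] by (simp add: koszul_sign_def add_eq_0_iff)
    then have "scl 2 (br (e x) (e x)) = 0" using free_lie.scale_left_distrib[of 1 1 "br (e x) (e x)"] by simp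
    then show ?thesis by simp
  next
    case False
    then have odd: "of_parity 1 (e x)" using e_parity[OF 0] by (simp add: bit_not_zero_iff)
    have ev: "of_parity 0 (br (e x) (e x))" using of_parity_br[OF odd odd] by simp
    let ?t = "br (e x) (br (e x) (e x))"
    have "br (br (e x) (e x)) (e x) = - ?t" using br_skew[OF ev odd] by (simp add: koszul_sign_def)
    then have "?t = - ?t - ?t" using br_jacobi[OF odd odd, of "e x"] by (simp add: koszul_sign_def)
    then have "?t + ?t + ?t = 0" by (simp add: algebra_simps)
    then have "scl (1 + 1 + 1) ?t = 0" by (simp only: free_lie.scale_left_distrib free_lie.scale_one)
    then show ?thesis by simp
  qed
  then show ?case by (simp add: numeral_3_eq_3)
next
  case (Suc n)
  have 1: "replicate (3 + Suc n) x = x # replicate (3 + n) x" by (simp only: add_Suc_right replicate_Suc)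
  show ?case unfolding 1 using Suc nested_Cons[of "replicate (3 + n) x" e x] by simp
qed

lemma b_eq_coeff:
  assumes "(\<lambda>h. \<Sum>x\<in>X. c x * b x h) = (\<lambda>h. \<Sum>x\<in>X. d x * b x h)" "x \<in> X"
  shows "c x = d x"
proof -
  have "(\<Sum>x\<in>X. (c x - d x) * b x h) = 0" for h
    using fun_cong[OF assms(1), of h] by (simp add: left_diff_distrib sum_subtractf)
  then show ?thesis using b_independent[of "\<lambda>x. c x - d x" x] assms(2) by simp
qed

lemma weight_positive:
  assumes "has_weight \<alpha> z" "\<forall>h. h \<notin> C \<longrightarrow> \<alpha> h = 0" "\<alpha> \<noteq> 0" "z \<notin> N"
  shows "\<exists>w\<in>lists X. word_weight b w = \<alpha> \<or> word_weight b w = - \<alpha>"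
proof (rule ccontr)
  assume "\<not> ?thesis"
  then have "weight_gens \<alpha> = {}" using assms(3) unfolding weight_gens_def by blast
  then show False using weight_space[OF assms(1,2)] assms(4) by (metis diff_zero empty_iff free_lie.span_empty singletonD)
qed

text \<open>By independence of the simple roots, a word in \<open>e\<close> of this weight consists
  of \<open>k\<close> letters \<open>x\<close>; for k > 0 neither words in \<open>f\<close> nor
  Cartan elements have this weight.\<close>

lemma weight_space_multiple:
  assumes z: "has_weight (\<lambda>h. of_nat k * b x h) z" and x: "x \<in> X" and k: "0 < k"
  obtains c where "z - scl c (nested e (replicate k x)) \<in> N"
proof -
  define \<alpha> where "\<alpha> = (\<lambda>h. of_nat k * b x h)"
  have \<alpha>: "\<alpha> = (\<lambda>h. \<Sum>y\<in>X. (if y = x then of_nat k else 0) * b y h)"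
    unfolding \<alpha>_def using finX x by (simp add: if_distrib[of "\<lambda>k. k * _"] cong: if_cong)
  have "weight_gens \<alpha> \<subseteq> {nested e (replicate k x)}"
  proof
    fix g assume "g \<in> weight_gens \<alpha>"
    then show "g \<in> {nested e (replicate k x)}"
    proof (cases rule: weight_gens_cases)
      case (1 w)
      have c: "of_nat (count_list w y) = (if y = x then of_nat k else 0 :: complex)" if "y \<in> X" for y
        by (rule b_eq_coeff[OF 1(3)[unfolded word_weight_count[OF finX 1(1)] \<alpha>] that])
      have "set w \<subseteq> {x}"
      proof
        fix y assume y: "y \<in> set w"
        then have "y \<in> X" "count_list w y \<noteq> 0" using 1(1) by (auto simp: count_list_0_iff)
        then show "y \<in> {x}" using c[of y] by (auto split: if_splits)
      qed
      then have "w = replicate (length w) x" by (intro replicate_eqI) auto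
      then obtain m where w: "w = replicate m x" by blast
      have "count_list (replicate m x) x = m" for m by (induction m) auto
      then have "m = k" using c[OF x] w by simp
      then show ?thesis using 1 w by simp
    next
      case (2 w)
      have "- \<alpha> = (\<lambda>h. \<Sum>y\<in>X. (if y = x then - of_nat k else 0) * b y h)"
        unfolding \<alpha> by (auto simp: fun_eq_iff sum_negf[symmetric] intro!: sum.cong)
      from b_eq_coeff[OF 2(3)[unfolded word_weight_count[OF finX 2(1)] this] x]
      have "of_nat (count_list w x) = (- of_nat k :: complex)" by simp
      then have "of_nat (count_list w x + k) = (0 :: complex)" by simp
      then have "count_list w x + k = 0" unfolding of_nat_eq_0_iff .
      then show ?thesis using k by simp
    next
      case (3 h)
      from 3(2) have "of_nat k = (0 :: complex)"
        using b_eq_coeff[of "\<lambda>y. if y = x then of_nat k else 0" "\<lambda>_. 0", OF _ x] \<alpha> by (simp add: zero_fun_def)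
      then show ?thesis using k by simp
    qed
  qed
  moreover obtain y where y: "y \<in> free_lie.span (weight_gens \<alpha>)" "z - y \<in> N"
    by (rule weight_space[OF z[folded \<alpha>_def]]) (simp add: b_outside \<alpha>_def)
  ultimately have "y \<in> free_lie.span {nested e (replicate k x)}" using free_lie.span_mono by blast
  then show ?thesis using that y(2) by (auto simp: free_lie.span_singleton)
qed

text \<open>The only words of this weight are x y and y x, and their brackets are proportional by
  skew symmetry.\<close>

lemma weight_space_two:
  assumes z: "has_weight (\<lambda>h. b x h + b y h) z" and x: "x \<in> X" and y: "y \<in> X" "x \<noteq> y"
  obtains c where "z - scl c (br (e x) (e y)) \<in> N"
proof -
  define \<alpha> where "\<alpha> = (\<lambda>h. b x h + b y h)"
  have \<alpha>: "\<alpha> = (\<lambda>h. \<Sum>z\<in>X. (if z = x then 1 else if z = y then 1 else 0) * b z h)"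
    unfolding \<alpha>_def
  proof
    fix h
    have "(\<Sum>z\<in>X. (if z = x then 1 else if z = y then 1 else 0) * b z h) =
      (\<Sum>z\<in>X. (if z = x then b z h else 0) + (if z = y then b z h else 0))"
      by (rule sum.cong) (use y in auto)
    also have "\<dots> = b x h + b y h" using finX x y by (simp add: sum.distrib)
    finally show "b x h + b y h = (\<Sum>z\<in>X. (if z = x then 1 else if z = y then 1 else 0) * b z h)" by simp
  qed
  have "weight_gens \<alpha> \<subseteq> {br (e x) (e y), br (e y) (e x)}"
  proof
    fix g assume "g \<in> weight_gens \<alpha>"
    then show "g \<in> {br (e x) (e y), br (e y) (e x)}"
    proof (cases rule: weight_gens_cases)
      case (1 w)
      have c: "count_list w z = (if z = x then 1 else if z = y then 1 else 0)" if "z \<in> X" for z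
      proof -
        have "of_nat (count_list w z) = (if z = x then 1 else if z = y then 1 else 0 :: complex)"
          by (rule b_eq_coeff[OF 1(3)[unfolded word_weight_count[OF finX 1(1)] \<alpha>] that])
        then show ?thesis by (auto split: if_splits)
      qed
      have "sum (count_list w) (set w) = sum (count_list w) X"
        using 1(1) finX by (intro sum.mono_neutral_left) (auto simp: count_list_0_iff)
      also have "\<dots> = (\<Sum>z\<in>X. (if z = x then 1 else 0) + (if z = y then 1 else 0))"
        by (rule sum.cong) (use c y in auto)
      also have "\<dots> = 2" using finX x y by (simp add: sum.distrib)
      finally have "length w = 2" by (simp add: sum_count_set)
      then obtain q r where w: "w = [q, r]" by (metis One_nat_def Suc_1 length_0_conv length_Suc_conv)
      then have "q \<in> X" "r \<in> X" using 1(1) by auto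
      then have "{q, r} = {x, y}" using c[OF x] c[OF y(1)] y(2) w by (auto split: if_splits)
      then show ?thesis using 1 w by (auto simp: doubleton_eq_iff)
    next
      case (2 w)
      have "- \<alpha> = (\<lambda>h. \<Sum>z\<in>X. (if z = x then -1 else if z = y then -1 else 0) * b z h)"
        unfolding \<alpha> by (auto simp: fun_eq_iff sum_negf[symmetric] intro!: sum.cong)
      from b_eq_coeff[OF 2(3)[unfolded word_weight_count[OF finX 2(1)] this] x]
      have "of_nat (count_list w x) = (- 1 :: complex)" by simp
      then have "of_nat (count_list w x + 1) = (0 :: complex)" by simp
      then have "count_list w x + 1 = 0" unfolding of_nat_eq_0_iff .
      then show ?thesis by simp
    next
      case (3 h)
      from 3(2) have "(1 :: complex) = 0"
        using b_eq_coeff[of "\<lambda>z. if z = x then 1 else if z = y then 1 else 0" "\<lambda>_. 0", OF _ x] \<alpha>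
        by (simp add: zero_fun_def)
      then show ?thesis by simp
    qed
  qed
  moreover obtain t where t: "t \<in> free_lie.span (weight_gens \<alpha>)" "z - t \<in> N"
    by (rule weight_space[OF z[folded \<alpha>_def]]) (simp add: b_outside \<alpha>_def)
  ultimately have t': "t \<in> free_lie.span {br (e x) (e y), br (e y) (e x)}" using free_lie.span_mono by blast
  have "br (e y) (e x) \<in> free_lie.span {br (e x) (e y)}"
    unfolding br_skew[OF e_parity[OF y(1)] e_parity[OF x]] by (intro free_lie.span_scale free_lie.span_base) simp
  then have "free_lie.span {br (e x) (e y), br (e y) (e x)} \<subseteq> free_lie.span {br (e x) (e y)}"
    by (intro free_lie.span_minimal) (auto intro: free_lie.span_base)
  then show ?thesis using that t(2) t' by (auto simp: free_lie.span_singleton)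
qed

lemma \<eta>_span: "y \<in> free_lie.span (\<eta> ` C) \<Longrightarrow> \<exists>h\<in>C. y - \<eta> h \<in> N"
proof (induction rule: free_lie.span_induct_alt)
  case base
  show ?case using subspace_0[OF C] N_neg[OF \<eta>_zero] by (intro bexI[of _ 0]) auto
next
  case (step c g y)
  then obtain h k where *: "h \<in> C" "y - \<eta> h \<in> N" "k \<in> C" "g = \<eta> k" by auto
  have "scl c (\<eta> k) - \<eta> (s c k) \<in> N" by (rule N_sym[OF \<eta>_scale[OF *(3)]])
  then have "scl c g + y - (\<eta> (s c k) + \<eta> h) \<in> N" using N_mod_add *(2,4) by blast
  moreover have "\<eta> (s c k) + \<eta> h - \<eta> (s c k + h) \<in> N"
    by (rule N_sym[OF \<eta>_add[OF subspace_scale[OF C *(3)] *(1)]])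
  ultimately have "scl c g + y - \<eta> (s c k + h) \<in> N" by (rule N_trans)
  then show ?case using subspace_add[OF C subspace_scale[OF C *(3)] *(1)] by blast
qed

lemma weight_space_zero:
  assumes z: "has_weight 0 z"
  obtains h where "h \<in> C" "z - \<eta> h \<in> N"
proof -
  have "weight_gens 0 \<subseteq> \<eta> ` C"
  proof
    fix g assume "g \<in> weight_gens 0"
    then consider w where "w \<in> lists X" "w \<noteq> []" "word_weight b w = 0" | "g \<in> \<eta> ` C"
      by (cases rule: weight_gens_cases) auto
    then show "g \<in> \<eta> ` C"
    proof cases
      case 1
      then have "hd w \<in> X" "count_list w (hd w) \<noteq> 0" by (cases w; simp)+
      moreover have "(\<lambda>h. \<Sum>y\<in>X. of_nat (count_list w y) * b y h) = (\<lambda>h. \<Sum>y\<in>X. 0 * b y h)"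
        using 1(3) unfolding word_weight_count[OF finX 1(1)] by (simp add: zero_fun_def)
      ultimately show ?thesis using b_eq_coeff[of "\<lambda>x. of_nat (count_list w x)" "\<lambda>_. 0" "hd w"] by simp
    qed
  qed
  moreover obtain t where t: "t \<in> free_lie.span (weight_gens 0)" "z - t \<in> N"
    by (rule weight_space[OF z]) simp
  ultimately have "t \<in> free_lie.span (\<eta> ` C)" using free_lie.span_mono by blast
  from \<eta>_span[OF this] obtain h where "h \<in> C" "t - \<eta> h \<in> N" by blast
  then show ?thesis using that N_trans[OF t(2)] by blast
qed

section \<open>Weight components of ideals\<close>

lemma subspace_components:
  assumes J: "free_lie.subspace J" "N \<subseteq> J" "\<And>h j. h \<in> C \<Longrightarrow> j \<in> J \<Longrightarrow> br (\<eta> h) j \<in> J" and z: "z \<in> J"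
  obtains n A y where "n \<in> N" "finite A" "\<And>\<alpha>. has_weight \<alpha> (y \<alpha>)" "\<And>\<alpha>. y \<alpha> \<in> J"
    "\<And>\<alpha>. \<alpha> \<notin> A \<Longrightarrow> y \<alpha> = 0" "\<And>\<alpha> h. \<alpha> \<in> A \<Longrightarrow> h \<notin> C \<Longrightarrow> \<alpha> h = 0" "z = n + (\<Sum>\<alpha>\<in>A. y \<alpha>)"
proof -
  obtain n A y where *: "n \<in> N" "finite A" "\<And>\<alpha>. y \<alpha> \<in> free_lie.span (weight_gens \<alpha>)"
      "\<And>\<alpha>. \<alpha> \<notin> A \<Longrightarrow> y \<alpha> = 0" "\<forall>\<alpha>\<in>A. \<forall>h. h \<notin> C \<longrightarrow> \<alpha> h = 0" "z = n + (\<Sum>\<alpha>\<in>A. y \<alpha>)"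
    using weight_decomposition[of z] by blast
  have w: "has_weight \<alpha> (y \<alpha>)" for \<alpha> using has_weight_span *(3) by blast
  have "z - n \<in> J" using free_lie.subspace_diff[OF J(1) z] J(2) *(1) by blast
  then have sum: "(\<Sum>\<alpha>\<in>A. y \<alpha>) \<in> J" using *(6) by simp
  have outside: "\<forall>h. h \<notin> C \<longrightarrow> \<alpha> h = 0" if "\<alpha> \<in> A" for \<alpha> using *(5) that by blast
  have "y \<alpha> \<in> J" for \<alpha>
  proof (cases "\<alpha> \<in> A")
    case True
    show ?thesis by (rule weight_components[OF J *(2) outside w sum True])
  qed (use *(4) free_lie.subspace_0[OF J(1)] in simp)
  then show thesis using that[OF *(1,2) w _ *(4) _ *(6)] *(5) by blast
qed

text \<open>A Cartan element of the sum has weight 0, and the components of weight 0 of both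
  summands lie in \<open>N\<close> because those summands avoid the Cartan subspace. Maximality
  among all such ideals rests on this.\<close>

lemma cartan_free_sum:
  assumes J: "free_lie.subspace J" "N \<subseteq> J" "\<And>h j. h \<in> C \<Longrightarrow> j \<in> J \<Longrightarrow> br (\<eta> h) j \<in> J"
      "\<And>h. h \<in> C \<Longrightarrow> \<eta> h \<in> J \<Longrightarrow> h = 0"
    and M: "free_lie.subspace M" "N \<subseteq> M" "\<And>h j. h \<in> C \<Longrightarrow> j \<in> M \<Longrightarrow> br (\<eta> h) j \<in> M"
      "\<And>h. h \<in> C \<Longrightarrow> \<eta> h \<in> M \<Longrightarrow> h = 0"
    and h: "h \<in> C" "\<eta> h = j + m" "j \<in> J" "m \<in> M"
  shows "h = 0"
proof -
  have zero: "y \<in> N" if y: "has_weight 0 y" "y \<in> K" and K: "free_lie.subspace K" "N \<subseteq> K"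
    "\<And>h. h \<in> C \<Longrightarrow> \<eta> h \<in> K \<Longrightarrow> h = 0" for y K
  proof -
    obtain h where h: "h \<in> C" "y - \<eta> h \<in> N" using weight_space_zero[OF y(1)] by blast
    have "y - (y - \<eta> h) \<in> K" using free_lie.subspace_diff[OF K(1) y(2)] h(2) K(2) by blast
    then have "h = 0" using K(3) h(1) by simp
    then have "\<eta> h \<in> N" using \<eta>_zero by simp
    then show ?thesis using N_mod[OF h(2)] by blast
  qed
  obtain n A y where y: "n \<in> N" "finite A" "\<And>\<alpha>. has_weight \<alpha> (y \<alpha>)" "\<And>\<alpha>. y \<alpha> \<in> J"
    "\<And>\<alpha>. \<alpha> \<notin> A \<Longrightarrow> y \<alpha> = 0" "\<And>\<alpha> h. \<alpha> \<in> A \<Longrightarrow> h \<notin> C \<Longrightarrow> \<alpha> h = 0" "j = n + (\<Sum>\<alpha>\<in>A. y \<alpha>)"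
    using subspace_components[OF J(1-3) h(3)] by blast
  obtain n' A' y' where y': "n' \<in> N" "finite A'" "\<And>\<alpha>. has_weight \<alpha> (y' \<alpha>)" "\<And>\<alpha>. y' \<alpha> \<in> M"
    "\<And>\<alpha>. \<alpha> \<notin> A' \<Longrightarrow> y' \<alpha> = 0" "\<And>\<alpha> h. \<alpha> \<in> A' \<Longrightarrow> h \<notin> C \<Longrightarrow> \<alpha> h = 0" "m = n' + (\<Sum>\<alpha>\<in>A'. y' \<alpha>)"
    using subspace_components[OF M(1-3) h(4)] by blast
  \<comment> \<open>The weights of both decompositions, with 0 always included to make room for the
    Cartan element; \<open>w\<close> is then the component of \<open>j + m - \<eta> h\<close>, up to
    elements of \<open>N\<close>.\<close>
  define B where "B = insert 0 (A \<union> A')"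
  define w where "w \<alpha> = y \<alpha> + y' \<alpha> + scl (if \<alpha> = 0 then -1 else 0) (\<eta> h)" for \<alpha>
  have B: "finite B" using y(2) y'(2) by (simp add: B_def)
  have s1: "(\<Sum>\<alpha>\<in>B. y \<alpha>) = (\<Sum>\<alpha>\<in>A. y \<alpha>)"
    by (rule sum.mono_neutral_right) (use B y(5) in \<open>auto simp: B_def\<close>)
  have s2: "(\<Sum>\<alpha>\<in>B. y' \<alpha>) = (\<Sum>\<alpha>\<in>A'. y' \<alpha>)"
    by (rule sum.mono_neutral_right) (use B y'(5) in \<open>auto simp: B_def\<close>)
  have s3: "(\<Sum>\<alpha>\<in>B. scl (if \<alpha> = 0 then -1 else 0) (\<eta> h)) = - \<eta> h"
  proof -
    have "(\<Sum>\<alpha>\<in>B. scl (if \<alpha> = 0 then -1 else 0) (\<eta> h)) = (\<Sum>\<alpha>\<in>B. if \<alpha> = 0 then - \<eta> h else 0)"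
      by (rule sum.cong) auto
    also have "\<dots> = - \<eta> h" using B by (simp add: B_def)
    finally show ?thesis .
  qed
  have "(\<Sum>\<alpha>\<in>B. w \<alpha>) = (j - n) + (m - n') - \<eta> h"
    unfolding w_def sum.distrib s1 s2 s3 y(7) y'(7) by simp
  also have "\<dots> = - (n + n')" using h(2) by simp
  finally have sumN: "(\<Sum>\<alpha>\<in>B. w \<alpha>) \<in> N" using free_lie.subspace_neg[OF N N_add[OF y(1) y'(1)]] by simp
  have ww: "has_weight \<alpha> (w \<alpha>)" for \<alpha>
  proof -
    have "has_weight \<alpha> (scl (if \<alpha> = 0 then -1 else 0) (\<eta> h))"
      using has_weight_scale[OF has_weight_\<eta>[OF h(1)], of "-1"] by (simp add: has_weight_zero zero_fun_def)
    then show ?thesis unfolding w_def by (intro has_weight_add y(3) y'(3))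
  qed
  have "w 0 \<in> N"
    by (rule weight_components[OF N subset_refl N_br(1) B _ ww sumN])
      (use y(6) y'(6) in \<open>auto simp: B_def\<close>)
  moreover have "y 0 \<in> N" by (rule zero[OF y(3) y(4) J(1,2,4)])
  moreover have "y' 0 \<in> N" by (rule zero[OF y'(3) y'(4) M(1,2,4)])
  ultimately have "(y 0 + y' 0) - w 0 \<in> N" using N_add N_diff by blast
  then have "\<eta> h \<in> N" by (simp add: w_def)
  then show ?thesis using J(2,4) h(1) by blast
qed

end

section \<open>A Verma module: the Cartan subspace embeds\<close>

text \<open>A type of linear endomorphisms, so that the identities of an associative algebra come
  from the class \<open>ring\<close>.\<close>

typedef 'i operator = "{T :: ('i \<Rightarrow> complex) \<Rightarrow> 'i \<Rightarrow> complex.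
    (\<forall>\<phi> \<psi> w. T (\<lambda>w. \<phi> w + \<psi> w) w = T \<phi> w + T \<psi> w) \<and> (\<forall>c \<phi> w. T (\<lambda>w. c * \<phi> w) w = c * T \<phi> w)}"
  by (rule exI[of _ "\<lambda>\<phi>. \<phi>"]) simp

setup_lifting type_definition_operator

instantiation operator :: (type) ring
begin

lift_definition zero_operator :: "'a operator" is "\<lambda>\<phi> w. 0" by simp
lift_definition plus_operator :: "'a operator \<Rightarrow> 'a operator \<Rightarrow> 'a operator" is "\<lambda>S T \<phi> w. S \<phi> w + T \<phi> w"
  by (simp add: algebra_simps)
lift_definition uminus_operator :: "'a operator \<Rightarrow> 'a operator" is "\<lambda>T \<phi> w. - T \<phi> w"
  by simp
lift_definition minus_operator :: "'a operator \<Rightarrow> 'a operator \<Rightarrow> 'a operator" is "\<lambda>S T \<phi> w. S \<phi> w - T \<phi> w"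
  by (simp add: algebra_simps)
lift_definition times_operator :: "'a operator \<Rightarrow> 'a operator \<Rightarrow> 'a operator" is "\<lambda>S T \<phi>. S (T \<phi>)"
proof -
  fix S T :: "('a \<Rightarrow> complex) \<Rightarrow> 'a \<Rightarrow> complex"
  assume *: "(\<forall>\<phi> \<psi> w. S (\<lambda>w. \<phi> w + \<psi> w) w = S \<phi> w + S \<psi> w) \<and> (\<forall>c \<phi> w. S (\<lambda>w. c * \<phi> w) w = c * S \<phi> w)"
    "(\<forall>\<phi> \<psi> w. T (\<lambda>w. \<phi> w + \<psi> w) w = T \<phi> w + T \<psi> w) \<and> (\<forall>c \<phi> w. T (\<lambda>w. c * \<phi> w) w = c * T \<phi> w)"
  then have "T (\<lambda>w. \<phi> w + \<psi> w) = (\<lambda>w. T \<phi> w + T \<psi> w)" "T (\<lambda>w. c * \<phi> w) = (\<lambda>w. c * T \<phi> w)" for \<phi> \<psi> c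
    by auto
  then show "(\<forall>\<phi> \<psi> w. S (T (\<lambda>w. \<phi> w + \<psi> w)) w = S (T \<phi>) w + S (T \<psi>) w) \<and>
      (\<forall>c \<phi> w. S (T (\<lambda>w. c * \<phi> w)) w = c * S (T \<phi>) w)"
    using * by simp
qed

instance
  by standard (transfer; auto simp: fun_eq_iff algebra_simps)+

end

lift_definition scale_operator :: "complex \<Rightarrow> 'i operator \<Rightarrow> 'i operator" is "\<lambda>c T \<phi> w. c * T \<phi> w"
  by (simp add: algebra_simps)

lemma scale_operator_simps:
  "scale_operator c (S + T) = scale_operator c S + scale_operator c T"
  "scale_operator c (S - T) = scale_operator c S - scale_operator c T"
  "scale_operator (c + d) T = scale_operator c T + scale_operator d T"
  "scale_operator c (scale_operator d T) = scale_operator (c * d) T"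
  "scale_operator 1 T = T" "scale_operator (-1) T = - T" "scale_operator c 0 = 0"
  "scale_operator c S * T = scale_operator c (S * T)" "S * scale_operator c T = scale_operator c (S * T)"
  by (transfer; auto simp: fun_eq_iff algebra_simps)+

text \<open>Operators form an associative superalgebra, an element being written as the pair of its
  even and odd components.\<close>

primrec interpret_term :: "('g \<Rightarrow> bit) \<Rightarrow> ('g \<Rightarrow> 'i operator) \<Rightarrow> 'g lie_term \<Rightarrow> 'i operator \<times> 'i operator" where
  "interpret_term par I (Gen g) = (if par g = 0 then (I g, 0) else (0, I g))"
| "interpret_term par I Zero = (0, 0)"
| "interpret_term par I (Plus t u) = (fst (interpret_term par I t) + fst (interpret_term par I u),
     snd (interpret_term par I t) + snd (interpret_term par I u))"
| "interpret_term par I (Scale c t) =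
    (scale_operator c (fst (interpret_term par I t)), scale_operator c (snd (interpret_term par I t)))"
| "interpret_term par I (Brack t u) =
    (let (A0, A1) = interpret_term par I t; (B0, B1) = interpret_term par I u in
     (A0 * B0 - B0 * A0 + (A1 * B1 + B1 * A1), A0 * B1 - B1 * A0 + (A1 * B0 - B0 * A1)))"

lemma interpret_parity:
  assumes "has_parity par t i"
  shows "(i = 0 \<longrightarrow> snd (interpret_term par I t) = 0) \<and> (i = 1 \<longrightarrow> fst (interpret_term par I t) = 0)"
  using assms
proof induction
  case (5 t i u j)
  then show ?case
    by (cases i rule: bit.exhaust; cases j rule: bit.exhaust) (auto simp: Let_def case_prod_beta)
qed (auto simp: scale_operator_simps)

text \<open>The Lie axioms hold for the supercommutator of any associative superalgebra. Homogeneous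
  terms have one vanishing component, which reduces skew symmetry and Jacobi to a check for each
  choice of parities.\<close>

lemma interpret_sound:
  assumes rel: "\<And>t u. (t, u) \<in> Rel \<Longrightarrow> interpret_term par I t = interpret_term par I u"
    and eq: "lie_eq G par Rel t u"
  shows "interpret_term par I t = interpret_term par I u"
  using eq
proof induction
  case (relation t u)
  then show ?case by (intro rel)
next
  case (skew t u i j)
  note P = interpret_parity[OF skew(3), of I] interpret_parity[OF skew(4), of I]
  show ?case
    using P
    by (cases i rule: bit.exhaust; cases j rule: bit.exhaust)
      (auto simp: Let_def case_prod_beta koszul_sign_def scale_operator_simps algebra_simps)
next
  case (jacobi t u w i j k)
  note P = interpret_parity[OF jacobi(4), of I] interpret_parity[OF jacobi(5), of I] interpret_parity[OF jacobi(6), of I]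
  show ?case
    using P
    by (cases i rule: bit.exhaust; cases j rule: bit.exhaust; cases k rule: bit.exhaust)
      (auto simp: Let_def case_prod_beta koszul_sign_def scale_operator_simps algebra_simps)
qed (auto simp: Let_def case_prod_beta scale_operator_simps algebra_simps)

text \<open>The action of the generators on functions of words, transposed from a Verma module: the word
  \<open>w\<close> stands for the product of the \<open>f\<close>'s applied to a highest weight vector of weight \<open>\<Lambda>\<close>.\<close>

context
  fixes \<Lambda> :: "'u::ab_group_add \<Rightarrow> complex" and u :: "('u, 'x) root_datum"
begin

definition verma_weight :: "'x list \<Rightarrow> 'u \<Rightarrow> complex" where
  "verma_weight w h = \<Lambda> h - word_weight (root_of u) w h"

text \<open>A function is read as a formal, possibly infinite, sum of words, so its new value at a
  word collects the ways of inserting \<open>x\<close> there. Moving e past a letter costs the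
  Koszul sign; meeting the inserted letter leaves the coroot, which acts by the weight of the
  remaining word.\<close>

fun raising :: "'x \<Rightarrow> ('x list \<Rightarrow> complex) \<Rightarrow> 'x list \<Rightarrow> complex" where
  "raising x \<phi> [] = verma_weight [] (coroot_of u x) * \<phi> [x]"
| "raising x \<phi> (z # w) = verma_weight (z # w) (coroot_of u x) * \<phi> (x # z # w) +
    koszul_sign (parity_of u x) (parity_of u z) * raising x (\<lambda>w. \<phi> (z # w)) w"

lemma raising_linear:
  "raising x (\<lambda>w. \<phi> w + \<psi> w) w = raising x \<phi> w + raising x \<psi> w"
  "raising x (\<lambda>w. c * \<phi> w) w = c * raising x \<phi> w"
  by (induction w arbitrary: \<phi> \<psi>) (simp_all add: algebra_simps)

lift_definition lowering_op :: "'x \<Rightarrow> 'x list operator" is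
  "\<lambda>x \<phi> w. case w of [] \<Rightarrow> 0 | z # w \<Rightarrow> if z = x then \<phi> w else 0"
  by (auto split: list.split)

lift_definition raising_op :: "'x \<Rightarrow> 'x list operator" is "\<lambda>x. raising x"
  by (simp add: raising_linear)

lift_definition cartan_op :: "'u \<Rightarrow> 'x list operator" is "\<lambda>h \<phi> w. verma_weight w h * \<phi> w"
  by (simp add: algebra_simps)

text \<open>The shift \<open>k\<close> is there for the induction: removing the first letter changes
  the weight by the root of that letter.\<close>

lemma raising_cartan:
  "raising x (\<lambda>w. (verma_weight w h + k) * \<phi> w) w = (verma_weight w h - root_of u x h + k) * raising x \<phi> w"
proof (induction w arbitrary: \<phi> k)
  case Nil
  show ?case by (simp add: verma_weight_def word_weight_def algebra_simps)
next
  case (Cons z w)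
  have "(\<lambda>w. (verma_weight (z # w) h + k) * \<phi> (z # w)) =
      (\<lambda>w. (verma_weight w h + (k - root_of u z h)) * \<phi> (z # w))"
    by (simp add: verma_weight_def word_weight_def algebra_simps)
  then have A: "raising x (\<lambda>w. (verma_weight (z # w) h + k) * \<phi> (z # w)) w =
      (verma_weight w h - root_of u x h + (k - root_of u z h)) * raising x (\<lambda>w. \<phi> (z # w)) w"
    by (simp only: Cons)
  show ?case
    unfolding raising.simps A by (simp add: verma_weight_def word_weight_def algebra_simps)
qed

lemma cartan_raising: "cartan_op h * raising_op x - raising_op x * cartan_op h = scale_operator (root_of u x h) (raising_op x)"
  using raising_cartan[of x h 0]
  by transfer (auto simp: fun_eq_iff algebra_simps)

lemma cartan_lowering: "cartan_op h * lowering_op x - lowering_op x * cartan_op h = scale_operator (- root_of u x h) (lowering_op x)"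
  by transfer (auto simp: fun_eq_iff verma_weight_def word_weight_def algebra_simps split: list.split)

lemma cartan_cartan: "cartan_op h * cartan_op k = cartan_op k * cartan_op h"
  by transfer (auto simp: fun_eq_iff)

lemma raising_lowering:
  "raising_op x * lowering_op y - scale_operator (koszul_sign (parity_of u x) (parity_of u y)) (lowering_op y * raising_op x) =
     (if x = y then cartan_op (coroot_of u x) else 0)"
proof -
  have z: "raising x (\<lambda>w. 0) w = 0" for x w using raising_linear(2)[of x 0 "\<lambda>_. 0" w] by simp
  show ?thesis
    by transfer (auto simp: fun_eq_iff z split: list.split)
qed

fun verma_action :: "('u, 'x) generator \<Rightarrow> 'x list operator" where
  "verma_action (H h) = cartan_op h"
| "verma_action (E x) = raising_op x"
| "verma_action (F x) = lowering_op x"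

lemma verma_relations:
  assumes vs: "vector_space s" and u: "is_root_datum s X u"
    and \<Lambda>: "\<And>h k. \<Lambda> (h + k) = \<Lambda> h + \<Lambda> k" "\<And>c h. \<Lambda> (s c h) = c * \<Lambda> h"
    and rel: "(t, t') \<in> relations s X u"
  shows "interpret_term (generator_parity u) verma_action t = interpret_term (generator_parity u) verma_action t'"
proof -
  have ww: "word_weight (root_of u) w (h + k) = word_weight (root_of u) w h + word_weight (root_of u) w k"
    "word_weight (root_of u) w (s c h) = c * word_weight (root_of u) w h"
    if "h \<in> cartan u" "k \<in> cartan u" for w h k c
    by (induction w) (simp_all add: word_weight_def dual_space_add[OF vs root_in_dual[OF vs u]] that
        dual_space_scale[OF vs root_in_dual[OF vs u]] algebra_simps)
  have add: "cartan_op (h + k) = cartan_op h + cartan_op k" if "h \<in> cartan u" "k \<in> cartan u" for h k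
    using ww(1)[OF that] \<Lambda>(1) by transfer (simp add: verma_weight_def fun_eq_iff algebra_simps)
  have scale: "cartan_op (s c h) = scale_operator c (cartan_op h)" if "h \<in> cartan u" for c h
    using ww(2)[OF that that] \<Lambda>(2) by transfer (simp add: verma_weight_def fun_eq_iff algebra_simps)
  have rl: "raising_op x * lowering_op y =
      scale_operator (koszul_sign (parity_of u x) (parity_of u y)) (lowering_op y * raising_op x) +
      (if x = y then cartan_op (coroot_of u x) else 0)" for x y
    using raising_lowering[of x y] by (simp add: algebra_simps)
  show ?thesis
    using rel unfolding relations_def
    by (auto simp: add scale cartan_cartan cartan_raising cartan_lowering scale_operator_simps rl koszul_sign_def
        bit_not_zero_iff)
qed

end

lemma linear_functional_exists:
  assumes "vector_space s" "h \<noteq> 0"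
  shows "\<exists>\<Lambda>. (\<forall>h k. \<Lambda> (h + k) = \<Lambda> h + \<Lambda> k) \<and> (\<forall>c h. \<Lambda> (s c h) = c * \<Lambda> h) \<and> \<Lambda> h = (1::complex)"
proof -
  interpret vector_space s by (rule assms(1))
  interpret vector_space_pair s "(*)"
    by unfold_locales (auto simp: algebra_simps)
  have "independent {h}" using assms(2) by simp
  then obtain g where "Vector_Spaces.linear s (*) g" "\<forall>x\<in>{h}. g x = 1"
    using linear_independent_extend[of "{h}" "\<lambda>_. 1"] by blast
  then show ?thesis by (intro exI[of _ g]) (auto simp: linear_add linear_scale)
qed

text \<open>With a highest weight of value 1 at \<open>h\<close>, the element \<open>h\<close> acts
  on the empty word by 1, whereas Zero acts by 0. Trivial intersection of an ideal with the image of
  the Cartan subspace would not give this by itself.\<close>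

lemma cartan_injects:
  fixes s :: "complex \<Rightarrow> 'u::ab_group_add \<Rightarrow> 'u" and u :: "('u, 'x) root_datum"
  assumes "vector_space s" "is_root_datum s X u" "h \<noteq> 0"
  shows "\<not> lie_eq (generators X u) (generator_parity u) (relations s X u) (Gen (H h)) Zero"
proof
  assume eq: "lie_eq (generators X u) (generator_parity u) (relations s X u) (Gen (H h)) Zero"
  obtain \<Lambda> where \<Lambda>: "\<And>h k. \<Lambda> (h + k) = \<Lambda> h + \<Lambda> k" "\<And>c h. \<Lambda> (s c h) = c * \<Lambda> h" "\<Lambda> h = (1::complex)"
    using linear_functional_exists[OF assms(1,3)] by blast
  have "interpret_term (generator_parity u) (verma_action \<Lambda> u) (Gen (H h)) =
      interpret_term (generator_parity u) (verma_action \<Lambda> u) Zero"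
    by (rule interpret_sound[OF _ eq]) (rule verma_relations[OF assms(1,2) \<Lambda>(1,2)])
  then have "cartan_op \<Lambda> u h = 0" by simp
  then have "Rep_operator (cartan_op \<Lambda> u h) (\<lambda>_ :: 'x list. 1) [] = Rep_operator 0 (\<lambda>_ :: 'x list. 1) []" by simp
  then show False
    by (simp add: cartan_op.rep_eq zero_operator.rep_eq verma_weight_def word_weight_def \<Lambda>(3))
qed

section \<open>Presented algebras and quotients\<close>

text \<open>A surjective homomorphism from a free Lie superalgebra. Cosets, ideals and equations are
  computed through preimages under it, which hides the set-valued operations of quotients.\<close>

definition presents :: "'h superalgebra \<Rightarrow> ('g free_lie \<Rightarrow> 'h) \<Rightarrow> bool" where
  "presents L k \<longleftrightarrow> elems L = range k \<and> zero_el L = k 0 \<and>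
     (\<forall>x y. add_el L (k x) (k y) = k (x + y)) \<and> (\<forall>c x. scale_el L c (k x) = k (scl c x)) \<and>
     (\<forall>x y. bracket L (k x) (k y) = k (br x y)) \<and> (\<forall>i. homog L i = k ` {x. of_parity i x})"

lemma presentsD:
  assumes "presents L k"
  shows "elems L = range k" "zero_el L = k 0" "add_el L (k x) (k y) = k (x + y)"
    "scale_el L c (k x) = k (scl c x)" "bracket L (k x) (k y) = k (br x y)" "homog L i = k ` {x. of_parity i x}"
  using assms by (auto simp: presents_def)

lemma presents_cong:
  assumes "presents L k" "k x = k x'" "k y = k y'"
  shows "k (x + y) = k (x' + y')" "k (scl c x) = k (scl c x')" "k (br x y) = k (br x' y')"
  using presentsD(3)[OF assms(1), of x y] presentsD(3)[OF assms(1), of x' y']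
    presentsD(4)[OF assms(1), of c x] presentsD(4)[OF assms(1), of c x']
    presentsD(5)[OF assms(1), of x y] presentsD(5)[OF assms(1), of x' y'] assms by auto

lemma presents_eq_iff:
  assumes "presents L k"
  shows "k x = k y \<longleftrightarrow> k (x - y) = k 0"
proof
  assume "k x = k y"
  then show "k (x - y) = k 0" using presents_cong(1)[OF assms, of x y "- y" "- y"] by simp
next
  assume "k (x - y) = k 0"
  then show "k x = k y" using presents_cong(1)[OF assms, of "x - y" 0 y y] by simp
qed

lemma ideal_vimage:
  assumes k: "presents L k" and J: "super_ideal L J"
  shows "free_lie.subspace (k -` J)" "n \<in> k -` J \<Longrightarrow> br x n \<in> k -` J" "n \<in> k -` J \<Longrightarrow> br n x \<in> k -` J"
    "k x = k y \<Longrightarrow> x - y \<in> k -` J" "k ` (k -` J) = J"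
proof -
  have lin: "lin_subspace L J" and ad: "\<And>g i. g \<in> elems L \<Longrightarrow> i \<in> J \<Longrightarrow> bracket L g i \<in> J \<and> bracket L i g \<in> J"
    using J by (auto simp: super_ideal_def)
  have 0: "k 0 \<in> J" using lin presentsD(2)[OF k] by (simp add: lin_subspace_def)
  show "free_lie.subspace (k -` J)"
    unfolding free_lie.subspace_def
  proof (intro conjI ballI allI)
    fix x y c assume x: "x \<in> k -` J"
    have "scale_el L c (k x) \<in> J" using x lin by (simp add: lin_subspace_def)
    then show "scl c x \<in> k -` J" by (simp add: presentsD(4)[OF k])
    assume "y \<in> k -` J"
    then show "x + y \<in> k -` J" using x lin presentsD(3)[OF k, of x y] unfolding lin_subspace_def by (metis vimageD vimageI)
  qed (use 0 in simp)
  show "n \<in> k -` J \<Longrightarrow> br x n \<in> k -` J" "n \<in> k -` J \<Longrightarrow> br n x \<in> k -` J"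
    using ad[of "k x" "k n"] presentsD(1)[OF k] presentsD(5)[OF k, of x n] presentsD(5)[OF k, of n x] by auto
  show "x - y \<in> k -` J" if "k x = k y" using that 0 unfolding presents_eq_iff[OF k, of x y] by simp
  have "J \<subseteq> range k" using lin presentsD(1)[OF k] by (auto simp: lin_subspace_def)
  then show "k ` (k -` J) = J" by (simp add: image_vimage_eq inf_absorb1)
qed

lemma coset_eq:
  assumes k: "presents L k" and J: "super_ideal L J"
  shows "coset L J (k x) = k ` ((+) x ` (k -` J))"
proof -
  have "coset L J (k x) = (\<lambda>n. add_el L (k x) (k n)) ` (k -` J)"
    unfolding coset_def image_image[symmetric, of "add_el L (k x)" k] ideal_vimage(5)[OF k J] ..
  then show ?thesis by (simp add: presentsD(3)[OF k] image_image)
qed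

lemma coset_eq_iff:
  assumes k: "presents L k" and J: "super_ideal L J"
  shows "coset L J (k x) = coset L J (k y) \<longleftrightarrow> x - y \<in> k -` J"
proof
  note V = ideal_vimage[OF k J]
  assume "coset L J (k x) = coset L J (k y)"
  moreover have "k x \<in> coset L J (k x)"
    unfolding coset_eq[OF k J] using free_lie.subspace_0[OF V(1)] by (metis add.right_neutral image_eqI)
  ultimately obtain n where "k x = k (y + n)" "n \<in> k -` J" unfolding coset_eq[OF k J] by auto
  then have "x - (y + n) + n \<in> k -` J" using V(4) free_lie.subspace_add[OF V(1)] by blast
  then show "x - y \<in> k -` J" by simp
next
  note V = ideal_vimage[OF k J]
  assume xy: "x - y \<in> k -` J"
  have "(+) x ` (k -` J) = (+) y ` (k -` J)"
  proof (intro set_eqI iffI)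
    fix z assume "z \<in> (+) x ` (k -` J)"
    then obtain n where n: "z = x + n" "n \<in> k -` J" by auto
    then have "z = y + ((x - y) + n)" "(x - y) + n \<in> k -` J" using free_lie.subspace_add[OF V(1) xy] by auto
    then show "z \<in> (+) y ` (k -` J)" by blast
  next
    fix z assume "z \<in> (+) y ` (k -` J)"
    then obtain n where n: "z = y + n" "n \<in> k -` J" by auto
    then have "z = x + (n - (x - y))" "n - (x - y) \<in> k -` J" using free_lie.subspace_diff[OF V(1) _ xy] by auto
    then show "z \<in> (+) x ` (k -` J)" by blast
  qed
  then show "coset L J (k x) = coset L J (k y)" by (simp add: coset_eq[OF k J])
qed

lemma presents_quotient:
  assumes k: "presents L k" and J: "super_ideal L J"
  shows "presents (quotient_alg L J) (\<lambda>x. coset L J (k x))"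
proof -
  note V = ideal_vimage[OF k J]
  let ?q = "\<lambda>x. coset L J (k x)"
  have mem: "g \<in> ?q x \<longleftrightarrow> (\<exists>n\<in>k -` J. g = k (x + n))" for g x unfolding coset_eq[OF k J] by auto
  have self: "k x \<in> ?q x" for x unfolding mem using free_lie.subspace_0[OF V(1)] by (metis add.right_neutral)
  have UN2: "(\<Union>g\<in>?q x. \<Union>h\<in>?q y. coset L J (op g h)) = ?q (op' x y)"
    if op: "\<And>x y. op (k x) (k y) = k (op' x y)"
      and cong: "\<And>n m. n \<in> k -` J \<Longrightarrow> m \<in> k -` J \<Longrightarrow> op' (x + n) (y + m) - op' x y \<in> k -` J" for op op' x y
  proof -
    have "coset L J (op g h) = ?q (op' x y)" if "g \<in> ?q x" "h \<in> ?q y" for g h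
    proof -
      obtain n m where "n \<in> k -` J" "g = k (x + n)" "m \<in> k -` J" "h = k (y + m)" using \<open>g \<in> ?q x\<close> \<open>h \<in> ?q y\<close> mem by blast
      then show ?thesis using cong by (simp add: op coset_eq_iff[OF k J])
    qed
    then show ?thesis using self by blast
  qed
  have add: "(\<Union>g\<in>?q x. \<Union>h\<in>?q y. coset L J (add_el L g h)) = ?q (x + y)" for x y
  proof (rule UN2)
    show "x + n + (y + m) - (x + y) \<in> k -` J" if "n \<in> k -` J" "m \<in> k -` J" for n m
      using free_lie.subspace_add[OF V(1) that] by (simp add: algebra_simps)
  qed (rule presentsD(3)[OF k])
  have brk: "(\<Union>g\<in>?q x. \<Union>h\<in>?q y. coset L J (bracket L g h)) = ?q (br x y)" for x y
  proof (rule UN2)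
    show "br (x + n) (y + m) - br x y \<in> k -` J" if "n \<in> k -` J" "m \<in> k -` J" for n m
      using free_lie.subspace_add[OF V(1) V(2)[OF that(2), of "x + n"] V(3)[OF that(1), of y]]
      by (simp add: br_add_left br_add_right algebra_simps)
  qed (rule presentsD(5)[OF k])
  have scale: "(\<Union>g\<in>?q x. coset L J (scale_el L c g)) = ?q (scl c x)" for c x
  proof -
    have "coset L J (scale_el L c g) = ?q (scl c x)" if "g \<in> ?q x" for g
    proof -
      obtain n where n: "n \<in> k -` J" "g = k (x + n)" using \<open>g \<in> ?q x\<close> mem by blast
      have "scl c (x + n) - scl c x \<in> k -` J"
        using free_lie.subspace_scale[OF V(1) n(1), of c] by (simp add: free_lie.scale_right_distrib)
      then show ?thesis using n by (simp add: presentsD(4)[OF k] coset_eq_iff[OF k J])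
    qed
    then show ?thesis using self by blast
  qed
  show ?thesis
    unfolding presents_def quotient_alg_def
    by (simp add: add brk scale presentsD(1,2,6)[OF k] image_image)
qed

text \<open>Generators outside the set \<open>G\<close> and generators with the wrong parity are sent to zero, so that the
  free Lie superalgebra on all generators maps onto every presented algebra.\<close>

primrec restrict_term :: "'g set \<Rightarrow> ('g \<Rightarrow> bit) \<Rightarrow> (bit \<times> 'g) lie_term \<Rightarrow> 'g lie_term" where
  "restrict_term G par (Gen p) = (if snd p \<in> G \<and> fst p = par (snd p) then Gen (snd p) else Zero)"
| "restrict_term G par Zero = Zero"
| "restrict_term G par (Plus t u) = Plus (restrict_term G par t) (restrict_term G par u)"
| "restrict_term G par (Scale c t) = Scale c (restrict_term G par t)"
| "restrict_term G par (Brack t u) = Brack (restrict_term G par t) (restrict_term G par u)"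

lemma restrict_term_in: "restrict_term G par t \<in> lie_terms G"
  by (induction t) (auto simp: lie_terms_def)

lemma restrict_term_parity: "has_parity fst t i \<Longrightarrow> has_parity par (restrict_term G par t) i"
proof (induction rule: has_parity.induct)
  case (1 g)
  then show ?case using has_parity.intros(1)[of par "snd g"] by (auto intro: has_parity.intros(2))
next
  case (5 t i u j)
  then show ?case unfolding restrict_term.simps by (intro has_parity.intros(5))
qed (simp_all add: has_parity.intros)

lemma lie_eq_in: "lie_eq G par Rel t u \<Longrightarrow> t \<in> lie_terms G \<and> u \<in> lie_terms G"
  by (induction rule: lie_eq.induct) (auto simp: lie_terms_def)

lemma restrict_term_eq:
  "lie_eq UNIV fst {} t u \<Longrightarrow> lie_eq G par Rel (restrict_term G par t) (restrict_term G par u)"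
proof (induction rule: lie_eq.induct)
  case (trans t u w)
  then show ?case by (blast intro: lie_eq.trans)
next
  case (skew t u i j)
  then show ?case by (auto intro!: lie_eq.skew restrict_term_in restrict_term_parity)
next
  case (jacobi t u w i j k)
  then show ?case by (auto intro!: lie_eq.jacobi restrict_term_in restrict_term_parity)
qed (auto intro: lie_eq.intros restrict_term_in)

definition presented_class where
  "presented_class G par Rel x = lie_class G par Rel (restrict_term G par (rep_free_lie x))"

lemma lie_class_eq: "t \<in> lie_terms G \<Longrightarrow> lie_class G par Rel t = lie_class G par Rel u \<longleftrightarrow> lie_eq G par Rel t u"
  unfolding lie_class_def using lie_eq.refl lie_eq.sym lie_eq.trans by (metis (no_types, lifting) Collect_cong mem_Collect_eq)

lemma presented_class_abs:
  "presented_class G par Rel (abs_free_lie t) = lie_class G par Rel (restrict_term G par t)"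
proof -
  have "lie_eq UNIV fst {} (rep_free_lie (abs_free_lie t)) t"
    by (metis Quotient_free_lie Quotient_rep_abs_eq free_lie.abs_eq_iff Quotient_abs_rep)
  then show ?thesis
    unfolding presented_class_def using lie_class_eq[OF restrict_term_in] restrict_term_eq by blast
qed

lemma ex_abs_free_lie: "\<exists>t. x = abs_free_lie t"
  by (metis Quotient_abs_rep Quotient_free_lie)

lemma presents_presented: "presents (presented_alg G par Rel) (presented_class G par Rel)"
proof -
  let ?k = "presented_class G par Rel" and ?c = "lie_class G par Rel"
  \<comment> \<open>A section of \<open>restrict_term\<close>, which tags every generator with its
    proper parity.\<close>
  define lift where "lift = map_lie_term (\<lambda>g. (par g, g))"
  have lift: "restrict_term G par (lift t) = t" if "t \<in> lie_terms G" for t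
    using that unfolding lift_def by (induction t) (auto simp: lie_terms_def)
  have lift_parity: "has_parity fst (lift t) i" if "has_parity par t i" for t i
    using that
  proof induction
    case (1 g)
    then show ?case using has_parity.intros(1)[of fst "(par g, g)"] by (simp add: lift_def)
  next
    case (5 t i u j)
    then show ?case unfolding lift_def lie_term.map by (intro has_parity.intros(5))
  qed (simp_all add: lift_def has_parity.intros)
  have surj: "?c t = ?k (abs_free_lie (lift t))" if "t \<in> lie_terms G" for t
    using that by (simp add: presented_class_abs lift)
  have UN2: "(\<Union>t'\<in>?c t. \<Union>u'\<in>?c u. ?c (op t' u')) = ?c (op t u)"
    if "t \<in> lie_terms G" "u \<in> lie_terms G"
      "\<And>t' u'. lie_eq G par Rel t t' \<Longrightarrow> lie_eq G par Rel u u' \<Longrightarrow> lie_eq G par Rel (op t u) (op t' u')" for op t u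
  proof -
    have "?c (op t' u') = ?c (op t u)" if "t' \<in> ?c t" "u' \<in> ?c u" for t' u'
    proof -
      have eq: "lie_eq G par Rel (op t u) (op t' u')"
        using \<open>t' \<in> ?c t\<close> \<open>u' \<in> ?c u\<close> \<open>\<And>t' u'. lie_eq G par Rel t t' \<Longrightarrow> lie_eq G par Rel u u' \<Longrightarrow> _\<close>
        by (simp add: lie_class_def)
      show ?thesis using lie_class_eq[OF lie_eq_in[OF eq, THEN conjunct1], THEN iffD2, OF eq] by (rule HOL.sym)
    qed
    moreover have "t \<in> ?c t" "u \<in> ?c u" using that(1,2) by (auto simp: lie_class_def intro: lie_eq.refl)
    ultimately show ?thesis by blast
  qed
  have UN1: "(\<Union>t'\<in>?c t. ?c (op t')) = ?c (op t)"
    if "t \<in> lie_terms G" "\<And>t'. lie_eq G par Rel t t' \<Longrightarrow> lie_eq G par Rel (op t) (op t')" for op t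
  proof -
    have "?c (op t') = ?c (op t)" if "t' \<in> ?c t" for t'
    proof -
      have eq: "lie_eq G par Rel (op t) (op t')"
        using \<open>t' \<in> ?c t\<close> \<open>\<And>t'. lie_eq G par Rel t t' \<Longrightarrow> _\<close> by (simp add: lie_class_def)
      show ?thesis using lie_class_eq[OF lie_eq_in[OF eq, THEN conjunct1], THEN iffD2, OF eq] by (rule HOL.sym)
    qed
    moreover have "t \<in> ?c t" using that(1) by (auto simp: lie_class_def intro: lie_eq.refl)
    ultimately show ?thesis by blast
  qed
  show ?thesis
    unfolding presents_def
  proof (intro conjI allI)
    have "?c ` lie_terms G = range ?k"
    proof (intro set_eqI iffI)
      fix g assume "g \<in> range ?k"
      then show "g \<in> ?c ` lie_terms G" using restrict_term_in unfolding presented_class_def by blast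
    next
      fix g assume "g \<in> ?c ` lie_terms G"
      then obtain t where "t \<in> lie_terms G" "g = ?c t" by blast
      then show "g \<in> range ?k" using surj by blast
    qed
    then show "elems (presented_alg G par Rel) = range ?k" by (simp add: presented_alg_def)
    show "zero_el (presented_alg G par Rel) = ?k 0"
      unfolding abs_free_lie_simps(1)[symmetric] presented_class_abs by (simp add: presented_alg_def)
    fix x y :: "'a free_lie" and c i
    obtain t u where tu: "x = abs_free_lie t" "y = abs_free_lie u" using ex_abs_free_lie by metis
    show "add_el (presented_alg G par Rel) (?k x) (?k y) = ?k (x + y)"
      unfolding tu abs_free_lie_simps(3)[symmetric] presented_class_abs
      by (simp add: presented_alg_def UN2 restrict_term_in lie_eq.plus_cong)
    show "scale_el (presented_alg G par Rel) c (?k x) = ?k (scl c x)"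
      unfolding tu abs_free_lie_simps(4)[symmetric] presented_class_abs
      by (simp add: presented_alg_def UN1 restrict_term_in lie_eq.scale_cong)
    show "bracket (presented_alg G par Rel) (?k x) (?k y) = ?k (br x y)"
      unfolding tu abs_free_lie_simps(5)[symmetric] presented_class_abs
      by (simp add: presented_alg_def UN2 restrict_term_in lie_eq.brack_cong)
    show "homog (presented_alg G par Rel) i = ?k ` {x. of_parity i x}"
    proof (intro set_eqI iffI)
      fix g assume "g \<in> homog (presented_alg G par Rel) i"
      then obtain t where t: "t \<in> lie_terms G" "has_parity par t i" "g = ?c t" by (auto simp: presented_alg_def)
      then have "of_parity i (abs_free_lie (lift t))" using lift_parity by (auto simp: of_parity_def)
      then show "g \<in> ?k ` {x. of_parity i x}" using surj[OF t(1)] t(3) by blast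
    next
      fix g assume "g \<in> ?k ` {x. of_parity i x}"
      then obtain t where "has_parity fst t i" "g = ?k (abs_free_lie t)" by (auto simp: of_parity_def)
      then show "g \<in> homog (presented_alg G par Rel) i"
        unfolding presented_class_abs using restrict_term_in restrict_term_parity by (force simp: presented_alg_def)
    qed
  qed
qed

section \<open>Root algebras as quotients of free Lie superalgebras\<close>

definition half_baked_class where
  "half_baked_class s X u = presented_class (generators X u) (generator_parity u) (relations s X u)"

definition ideal_kernel where
  "ideal_kernel s X u J = half_baked_class s X u -` J"

definition quotient_class where
  "quotient_class s X u J x = coset (half_baked s X u) J (half_baked_class s X u x)"

abbreviation gen_H :: "'u \<Rightarrow> ('u, 'x) generator free_lie" where "gen_H h \<equiv> gen 0 (H h)"
abbreviation gen_E where "gen_E u x \<equiv> gen (parity_of u x) (E x)"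
abbreviation gen_F where "gen_F u x \<equiv> gen (parity_of u x) (F x)"

lemma presents_half_baked: "presents (half_baked s X u) (half_baked_class s X u)"
  unfolding half_baked_def half_baked_class_def by (rule presents_presented)

lemma presents_root_algebra:
  "super_ideal (half_baked s X u) J \<Longrightarrow> presents (root_algebra s X u J) (quotient_class s X u J)"
  unfolding root_algebra_def quotient_class_def by (rule presents_quotient[OF presents_half_baked])

lemma quotient_class_eq:
  "super_ideal (half_baked s X u) J \<Longrightarrow>
    quotient_class s X u J x = quotient_class s X u J y \<longleftrightarrow> x - y \<in> ideal_kernel s X u J"
  unfolding quotient_class_def ideal_kernel_def by (rule coset_eq_iff[OF presents_half_baked])

lemma half_baked_class_gen:
  assumes "g \<in> generators X u"
  shows "half_baked_class s X u (gen (generator_parity u g) g) =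
    lie_class (generators X u) (generator_parity u) (relations s X u) (Gen g)"
proof -
  have "half_baked_class s X u (abs_free_lie (Gen (generator_parity u g, g))) =
      lie_class (generators X u) (generator_parity u) (relations s X u) (Gen g)"
    unfolding half_baked_class_def presented_class_abs using assms by simp
  then show ?thesis by (simp only: abs_free_lie_simps fst_conv snd_conv)
qed

lemma half_baked_class_cartan:
  assumes "h \<in> cartan u"
  shows "half_baked_class s X u (gen_H h) = half_baked_cartan s X u h"
  using half_baked_class_gen[of "H h" X u s] assms by (simp add: generators_def half_baked_cartan_def)

lemma quotient_class_cartan:
  "h \<in> cartan u \<Longrightarrow> quotient_class s X u J (gen_H h) = cartan_embedding s X u J h"
  by (simp add: quotient_class_def cartan_embedding_def half_baked_class_cartan)

definition lift_term where
  "lift_term par = map_lie_term (\<lambda>g. (par g, g))"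

lemma abs_lift_term:
  "abs_free_lie (lift_term par Zero) = 0" "abs_free_lie (lift_term par (Gen g)) = gen (par g) g"
  "abs_free_lie (lift_term par (Plus t u)) = abs_free_lie (lift_term par t) + abs_free_lie (lift_term par u)"
  "abs_free_lie (lift_term par (Scale c t)) = scl c (abs_free_lie (lift_term par t))"
  "abs_free_lie (lift_term par (Brack t u)) = br (abs_free_lie (lift_term par t)) (abs_free_lie (lift_term par u))"
  by (simp_all add: lift_term_def abs_free_lie_simps)

lemma relation_kernel:
  assumes J: "super_ideal (half_baked s X u) J" and rel: "(t, t') \<in> relations s X u"
    and "t \<in> lie_terms (generators X u)" "t' \<in> lie_terms (generators X u)"
  shows "abs_free_lie (lift_term (generator_parity u) t) - abs_free_lie (lift_term (generator_parity u) t')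
    \<in> ideal_kernel s X u J"
proof -
  have restrict: "restrict_term G par (lift_term par t) = t" if "t \<in> lie_terms G"
    for G and par :: "('a, 'b) generator \<Rightarrow> bit" and t
    using that unfolding lift_term_def by (induction t) (auto simp: lie_terms_def)
  have "half_baked_class s X u (abs_free_lie (lift_term (generator_parity u) t)) =
      half_baked_class s X u (abs_free_lie (lift_term (generator_parity u) t'))"
    unfolding half_baked_class_def presented_class_abs restrict[OF assms(3)] restrict[OF assms(4)]
      lie_class_eq[OF assms(3)] by (rule lie_eq.relation[OF rel assms(3,4)])
  then show ?thesis
    using ideal_vimage(4)[OF presents_half_baked J] by (simp add: ideal_kernel_def)
qed

lemma generated_system_basic:
  fixes s :: "complex \<Rightarrow> 'u::ab_group_add \<Rightarrow> 'u" and u :: "('u, 'x) root_datum"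
  assumes vs: "vector_space s" and fin: "finite X" and u: "is_root_datum s X u"
    and J: "super_ideal (half_baked s X u) J"
  shows "generated_system s (cartan u) X (ideal_kernel s X u J) gen_H (gen_E u) (gen_F u)
    (coroot_of u) (root_of u) (parity_of u)"
proof (rule generated_system.intro)
  let ?N = "ideal_kernel s X u J"
  interpret vector_space s by (rule vs)
  note V = ideal_vimage[OF presents_half_baked J, folded ideal_kernel_def]
  note sub = cartan_subspace[OF vs u]
  have G: "t \<in> lie_terms (generators X u) \<longleftrightarrow> gens t \<subseteq> generators X u" for t :: "('u, 'x) generator lie_term"
    by (simp add: lie_terms_def)
  note R = relation_kernel[OF J, unfolded G]
  show "free_lie.subspace ?N" by (rule V)
  show "br x n \<in> ?N" "br n x \<in> ?N" if "n \<in> ?N" for x n using V(2,3) that by blast+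
  show "gen_H (h + k) - (gen_H h + gen_H k) \<in> ?N" if "h \<in> cartan u" "k \<in> cartan u" for h k
    using R[of "Gen (H (h + k))" "Plus (Gen (H h)) (Gen (H k))"] that subspace_add[OF sub that]
    by (auto simp: relations_def abs_lift_term generators_def)
  show "gen_H (s c h) - scl c (gen_H h) \<in> ?N" if "h \<in> cartan u" for c h
    using R[of "Gen (H (s c h))" "Scale c (Gen (H h))"] that subspace_scale[OF sub that]
    by (auto simp: relations_def abs_lift_term generators_def)
  show "br (gen_H h) (gen_H k) \<in> ?N" if "h \<in> cartan u" "k \<in> cartan u" for h k
    using R[of "Brack (Gen (H h)) (Gen (H k))" "Zero"] that by (auto simp: relations_def abs_lift_term generators_def)
  show "br (gen_H h) (gen_E u x) - scl (root_of u x h) (gen_E u x) \<in> ?N" if "h \<in> cartan u" "x \<in> X" for h x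
    using R[of "Brack (Gen (H h)) (Gen (E x))" "Scale (root_of u x h) (Gen (E x))"] that
    by (auto simp: relations_def abs_lift_term generators_def)
  show "br (gen_H h) (gen_F u x) - scl (- root_of u x h) (gen_F u x) \<in> ?N" if "h \<in> cartan u" "x \<in> X" for h x
    using R[of "Brack (Gen (H h)) (Gen (F x))" "Scale (- root_of u x h) (Gen (F x))"] that
    by (auto simp: relations_def abs_lift_term generators_def)
  show "br (gen_E u x) (gen_F u y) \<in> ?N" if "x \<in> X" "y \<in> X" "x \<noteq> y" for x y
    using R[of "Brack (Gen (E x)) (Gen (F y))" "Zero"] that by (auto simp: relations_def abs_lift_term generators_def)
  show "br (gen_E u x) (gen_F u x) - gen_H (coroot_of u x) \<in> ?N" if "x \<in> X" for x
    using R[of "Brack (Gen (E x)) (Gen (F x))" "Gen (H (coroot_of u x))"] that coroot_in_cartan[OF vs u]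
    by (auto simp: relations_def abs_lift_term generators_def)
  show "root_of u x h = 0" if "h \<notin> cartan u" for x h
    using dual_space_outside[OF vs root_in_dual[OF vs u] that] .
  show "c x = 0" if "\<And>h. h \<in> cartan u \<Longrightarrow> (\<Sum>x\<in>X. c x * root_of u x h) = 0" "x \<in> X" for c x
    by (rule roots_independent[OF vs u that])
  show "S = UNIV" if S: "free_lie.subspace S" "?N \<subseteq> S" "\<And>h. h \<in> cartan u \<Longrightarrow> gen_H h \<in> S"
    "\<And>x. x \<in> X \<Longrightarrow> gen_E u x \<in> S" "\<And>x. x \<in> X \<Longrightarrow> gen_F u x \<in> S"
    "\<And>y z. y \<in> S \<Longrightarrow> z \<in> S \<Longrightarrow> br y z \<in> S" for S
  proof -
    have "z \<in> S" for z
    proof (induction z)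
      case (gen i g)
      show ?case
      proof (cases "g \<in> generators X u \<and> i = generator_parity u g")
        case True
        then show ?thesis using S by (auto simp: generators_def)
      next
        \<comment> \<open>A generator that is outside the presentation or carries the wrong parity
          has class zero, hence lies in the kernel.\<close>
        case False
        have "half_baked_class s X u (abs_free_lie (Gen (i, g))) = half_baked_class s X u (abs_free_lie Zero)"
          unfolding half_baked_class_def presented_class_abs using False by (auto simp only: restrict_term.simps fst_conv snd_conv if_False)
        then have "gen i g - 0 \<in> ?N" using V(4) unfolding abs_free_lie_simps fst_conv snd_conv by blast
        then show ?thesis using S(2) by auto
      qed
    qed (use S in \<open>auto simp: free_lie.subspace_0 free_lie.subspace_add free_lie.subspace_scale\<close>)
    then show ?thesis by blast
  qed
qed (use vs fin cartan_subspace[OF vs u] coroot_in_cartan[OF vs u] in \<open>auto intro: of_parity_gen\<close>)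

text \<open>Along the isomorphism of a root algebra at \<open>v\<close> with one at \<open>u\<close> that is the identity on the Cartan
  subspace, the generators at \<open>u\<close> give a second system of generators at \<open>v\<close>.\<close>

lemma generated_system_transport:
  fixes s :: "complex \<Rightarrow> 'u::ab_group_add \<Rightarrow> 'u" and u v :: "('u, 'x) root_datum"
  assumes vs: "vector_space s" and fin: "finite X" and u: "is_root_datum s X u"
    and J: "super_ideal (half_baked s X v) J" and J': "super_ideal (half_baked s X u) J'"
    and iso: "superalgebra_iso (root_algebra s X v J) (root_algebra s X u J') \<phi>"
    and c: "cartan u = cartan v"
    and \<phi>: "\<And>h. h \<in> cartan v \<Longrightarrow> \<phi> (cartan_embedding s X v J h) = cartan_embedding s X u J' h"
  shows "\<exists>e f. generated_system s (cartan v) X (ideal_kernel s X v J) gen_H e f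
    (coroot_of u) (root_of u) (parity_of u)"
proof -
  let ?N = "ideal_kernel s X v J" and ?M = "ideal_kernel s X u J'"
  let ?q = "quotient_class s X v J" and ?r = "quotient_class s X u J'"
  note P = presentsD[OF presents_root_algebra[OF J]] and Q = presentsD[OF presents_root_algebra[OF J']]
  note eqN = quotient_class_eq[OF J] and eqM = quotient_class_eq[OF J']
  have bij: "bij_betw \<phi> (range ?q) (range ?r)"
    and padd: "\<phi> (?q (x + y)) = add_el (root_algebra s X u J') (\<phi> (?q x)) (\<phi> (?q y))"
    and pscale: "\<phi> (?q (scl k x)) = scale_el (root_algebra s X u J') k (\<phi> (?q x))"
    and pbr: "\<phi> (?q (br x y)) = bracket (root_algebra s X u J') (\<phi> (?q x)) (\<phi> (?q y))"
    and phom: "\<phi> ` ?q ` {x. of_parity i x} = ?r ` {x. of_parity i x}" for x y k i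
    using iso by (auto simp: superalgebra_iso_def P(1,6) Q(1,6) simp flip: P(3,4,5))
  \<comment> \<open>The isomorphism is defined on classes only; \<open>rel\<close> relates
    representatives of corresponding classes, and \<open>rel_N\<close> carries every relation modulo
    one kernel over to the other.\<close>
  define rel where "rel x y \<longleftrightarrow> \<phi> (?q x) = ?r y" for x y
  have rel_add: "rel (x + x') (y + y')" if "rel x y" "rel x' y'" for x y x' y'
    using that by (simp add: rel_def padd Q(3))
  have rel_scale: "rel (scl k x) (scl k y)" if "rel x y" for x y k
    using that by (simp add: rel_def pscale Q(4))
  have rel_br: "rel (br x x') (br y y')" if "rel x y" "rel x' y'" for x y x' y'
    using that by (simp add: rel_def pbr Q(5))
  have inj: "\<phi> (?q x) = \<phi> (?q y) \<longleftrightarrow> ?q x = ?q y" for x y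
    using bij by (auto simp: bij_betw_def inj_on_def)
  have rel_N: "x - x' \<in> ?N \<longleftrightarrow> y - y' \<in> ?M" if "rel x y" "rel x' y'" for x y x' y'
    using that inj[of x x'] by (simp add: rel_def flip: eqN eqM)
  have rel_H: "rel (gen_H h) (gen_H h)" if "h \<in> cartan v" for h
    using \<phi>[OF that] that by (simp add: rel_def quotient_class_cartan c)
  have rel_0: "rel 0 0"
  proof -
    have "?r 0 \<in> \<phi> ` range ?q" using bij by (simp add: bij_betw_def)
    then obtain x where "rel x 0" by (auto simp: rel_def)
    from rel_scale[OF this, of 0] show ?thesis by simp
  qed
  have lift: "\<exists>x. of_parity i x \<and> rel x y" if "of_parity i y" for i y
  proof -
    have "?r y \<in> \<phi> ` ?q ` {x. of_parity i x}" using that phom by blast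
    then show ?thesis by (auto simp: rel_def)
  qed
  have lift': "\<exists>y. rel x y" for x
  proof -
    have "\<phi> (?q x) \<in> range ?r" using bij unfolding bij_betw_def by blast
    then show ?thesis by (auto simp: rel_def)
  qed
  have "\<forall>x. \<exists>z. of_parity (parity_of u x) z \<and> rel z (gen_E u x)" 
    by (intro allI lift of_parity_gen)
  from choice[OF this] obtain e where e: "\<And>x. of_parity (parity_of u x) (e x) \<and> rel (e x) (gen_E u x)" by blast
  have "\<forall>x. \<exists>z. of_parity (parity_of u x) z \<and> rel z (gen_F u x)" 
    by (intro allI lift of_parity_gen)
  from choice[OF this] obtain f where f: "\<And>x. of_parity (parity_of u x) (f x) \<and> rel (f x) (gen_F u x)" by blast
  interpret U: generated_system s "cartan u" X ?M gen_H "gen_E u" "gen_F u" "coroot_of u" "root_of u" "parity_of u"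
    by (rule generated_system_basic[OF vs fin u J'])
  note V = ideal_vimage[OF presents_half_baked J, folded ideal_kernel_def]
  interpret vector_space s by (rule vs)
  have sub: "subspace (cartan v)" using U.C c by simp
  have "generated_system s (cartan v) X ?N gen_H e f (coroot_of u) (root_of u) (parity_of u)"
  proof (rule generated_system.intro)
    show "free_lie.subspace ?N" by (rule V)
    show "br x n \<in> ?N" "br n x \<in> ?N" if "n \<in> ?N" for x n using V(2,3) that by blast+
    show "module.subspace s (cartan v)" using U.C c by simp
    show "gen_H (h + k) - (gen_H h + gen_H k) \<in> ?N" if "h \<in> cartan v" "k \<in> cartan v" for h k
      using rel_N[OF rel_H[OF subspace_add[OF sub that]] rel_add[OF rel_H[OF that(1)] rel_H[OF that(2)]]]
        U.\<eta>_add that c by simp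
    show "gen_H (s k h) - scl k (gen_H h) \<in> ?N" if "h \<in> cartan v" for k h
      using rel_N[OF rel_H[OF subspace_scale[OF sub that]] rel_scale[OF rel_H[OF that]]] U.\<eta>_scale that c
      by simp
    show "br (gen_H h) (gen_H k) \<in> ?N" if "h \<in> cartan v" "k \<in> cartan v" for h k
      using rel_N[OF rel_br[OF rel_H[OF that(1)] rel_H[OF that(2)]] rel_0] U.\<eta>_\<eta> that c by simp
    show "br (gen_H h) (e x) - scl (root_of u x h) (e x) \<in> ?N" if "h \<in> cartan v" "x \<in> X" for h x
      using rel_N[OF rel_br[OF rel_H[OF that(1)] e[THEN conjunct2]] rel_scale[OF e[THEN conjunct2]]] U.\<eta>_e that c
      by simp
    show "br (gen_H h) (f x) - scl (- root_of u x h) (f x) \<in> ?N" if "h \<in> cartan v" "x \<in> X" for h x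
      using rel_N[OF rel_br[OF rel_H[OF that(1)] f[THEN conjunct2]] rel_scale[OF f[THEN conjunct2]]] U.\<eta>_f that c
      by metis
    show "br (e x) (f y) \<in> ?N" if "x \<in> X" "y \<in> X" "x \<noteq> y" for x y
      using rel_N[OF rel_br[OF e[THEN conjunct2] f[THEN conjunct2]] rel_0] U.e_f[OF that] by simp
    show "br (e x) (f x) - gen_H (coroot_of u x) \<in> ?N" if "x \<in> X" for x
      using rel_N[OF rel_br[OF e[THEN conjunct2] f[THEN conjunct2]] rel_H] U.e_f_same[OF that] U.a_in[OF that] c
      by simp
    show "S = UNIV" if S: "free_lie.subspace S" "?N \<subseteq> S" "\<And>h. h \<in> cartan v \<Longrightarrow> gen_H h \<in> S"
      "\<And>x. x \<in> X \<Longrightarrow> e x \<in> S" "\<And>x. x \<in> X \<Longrightarrow> f x \<in> S"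
      "\<And>y z. y \<in> S \<Longrightarrow> z \<in> S \<Longrightarrow> br y z \<in> S" for S
    proof -
      define T where "T = {y. \<exists>x\<in>S. rel x y}"
      have "T = UNIV"
      proof (rule U.generate)
        show "free_lie.subspace T"
          unfolding free_lie.subspace_def T_def
          using rel_0 rel_add rel_scale free_lie.subspace_0[OF S(1)] free_lie.subspace_add[OF S(1)]
            free_lie.subspace_scale[OF S(1)] by blast
        show "?M \<subseteq> T"
        proof
          fix y assume "y \<in> ?M"
          then have "?r y = ?r 0" using eqM by simp
          then have "rel 0 y" using rel_0 by (simp add: rel_def)
          then show "y \<in> T" unfolding T_def using free_lie.subspace_0[OF S(1)] by blast
        qed
        show "br y z \<in> T" if "y \<in> T" "z \<in> T" for y z
          using that rel_br S(6) unfolding T_def by blast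
        show "gen_H h \<in> T" if "h \<in> cartan u" for h
          using S(3)[of h] rel_H[of h] that c unfolding T_def by auto
        show "gen_E u x \<in> T" "gen_F u x \<in> T" if "x \<in> X" for x
          using S(4,5)[OF that] e f unfolding T_def by blast+
      qed
      have "z \<in> S" for z
      proof -
        obtain y where y: "rel z y" using lift' by blast
        obtain x where x: "x \<in> S" "rel x y" using \<open>T = UNIV\<close> unfolding T_def by blast
        then have "z - x \<in> ?N" using rel_N[OF y x(2)] free_lie.subspace_0[OF U.N] by simp
        then have "(z - x) + x \<in> S" using S(2) x(1) free_lie.subspace_add[OF S(1)] by blast
        then show ?thesis by simp
      qed
      then show ?thesis by blast
    qed
  qed (use vs fin e f c U.a_in U.b_outside U.b_independent of_parity_gen in auto)
  then show ?thesis by blast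
qed

text \<open>The ideal condition makes the class of \<open>h\<close> zero in the half-baked algebra;
  the Verma module then gives h = 0.\<close>

lemma kernel_meets_cartan:
  assumes vs: "vector_space s" and u: "is_root_datum s X u" and J: "cartan_free_ideal s X u J"
    and h: "h \<in> cartan u" "gen_H h \<in> ideal_kernel s X u J"
  shows "h = 0"
proof (rule ccontr)
  assume "h \<noteq> 0"
  have "half_baked_cartan s X u h \<in> J" using h half_baked_class_cartan[OF h(1), of s X] by (simp add: ideal_kernel_def)
  then have "half_baked_cartan s X u h = zero_el (half_baked s X u)"
    using J h(1) unfolding cartan_free_ideal_def by blast
  then have "lie_eq (generators X u) (generator_parity u) (relations s X u) (Gen (H h)) Zero"
    unfolding half_baked_cartan_def half_baked_def presented_alg_def
    using h(1) lie_class_eq[of "Gen (H h)" "generators X u"] by (simp add: lie_terms_def generators_def)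
  then show False using cartan_injects[OF vs u \<open>h \<noteq> 0\<close>] by blast
qed

section \<open>Root Lie superalgebras\<close>

locale root_superalgebra =
  fixes s :: "complex \<Rightarrow> 'u::ab_group_add \<Rightarrow> 'u" and X :: "'x set"
    and R :: "('u, 'x) root_datum set" and I :: "('u, 'x) root_datum \<Rightarrow> ('u, 'x) half_baked_el set"
    and v :: "('u, 'x) root_datum"
  assumes vs: "vector_space s" and finX: "finite X" and component: "is_component s X R"
    and full: "fully_reflectable X R" and algebra: "root_lie_superalgebra s X R I" and v: "v \<in> R"
begin

interpretation vector_space s by (rule vs)

lemma rdv: "is_root_datum s X v"
  using component v is_root_datum_arrow[OF vs finX] by (auto simp: is_component_def)

lemma skeleton_component: "u \<in> skeleton s X v \<Longrightarrow> u \<in> R"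
proof -
  assume "u \<in> skeleton s X v"
  then have a: "arrow s X v id u" by (rule arrow_skeleton[OF vs finX rdv])
  obtain w where w: "R = {v'. \<exists>\<theta>. arrow s X w \<theta> v'}" using component by (auto simp: is_component_def)
  then obtain \<theta> where "arrow s X w \<theta> v" using v by auto
  from arrow.compose[OF this a] show ?thesis using w by blast
qed

lemma skeleton_datum: "u \<in> skeleton s X v \<Longrightarrow> is_root_datum s X u"
  by (rule is_root_datum_skeleton[OF vs finX rdv])

lemma skeleton_cartan: "u \<in> skeleton s X v \<Longrightarrow> cartan u = cartan v"
  by (induction rule: skeleton.induct) (auto simp: cartan_reflexion[OF vs])

lemma cartan_free: "u \<in> R \<Longrightarrow> cartan_free_ideal s X u (I u)"
  using algebra by (auto simp: root_lie_superalgebra_def)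

lemma ideal: "u \<in> R \<Longrightarrow> super_ideal (half_baked s X u) (I u)"
  using cartan_free by (auto simp: cartan_free_ideal_def)

abbreviation "N \<equiv> ideal_kernel s X v (I v)"

abbreviation "system u e f \<equiv>
  generated_system s (cartan v) X N gen_H e f (coroot_of u) (root_of u) (parity_of u)"

lemma ex_system:
  assumes u: "u \<in> skeleton s X v"
  shows "\<exists>e f. system u e f"
proof -
  have "arrow s X v id u" by (rule arrow_skeleton[OF vs finX rdv u])
  then obtain \<phi> where \<phi>: "superalgebra_iso (root_algebra s X v (I v)) (root_algebra s X u (I u)) \<phi>"
    "\<forall>h\<in>cartan v. \<phi> (cartan_embedding s X v (I v) h) = cartan_embedding s X u (I u) (id h)"
    using algebra v skeleton_component[OF u] unfolding root_lie_superalgebra_def by blast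
  show ?thesis
    by (rule generated_system_transport[OF vs finX skeleton_datum[OF u] ideal[OF v]
          ideal[OF skeleton_component[OF u]] \<phi>(1) skeleton_cartan[OF u]]) (use \<phi>(2) in simp)
qed

lemma cartan_N: "h \<in> cartan v \<Longrightarrow> gen_H h \<in> N \<Longrightarrow> h = 0"
  by (rule kernel_meets_cartan[OF vs rdv cartan_free[OF v]])

lemma coroot_nonzero: "u \<in> skeleton s X v \<Longrightarrow> x \<in> X \<Longrightarrow> coroot_of u x \<noteq> 0"
proof
  assume u: "u \<in> skeleton s X v" and x: "x \<in> X" and z: "coroot_of u x = 0"
  have "(\<Sum>y\<in>X. s (if y = x then 1 else 0) (coroot_of u y)) = (\<Sum>y\<in>X. if y = x then coroot_of u y else 0)"
    by (rule sum.cong) auto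
  then have "(\<Sum>y\<in>X. s (if y = x then 1 else 0) (coroot_of u y)) = 0" using z finX x by simp
  from coroots_independent[OF vs skeleton_datum[OF u] this x] show False by simp
qed

lemma ideal_without_generators:
  assumes u: "u \<in> skeleton s X v" and x: "x \<in> X" and sys: "system u e f"
    and M: "N \<subseteq> M" "free_lie.subspace M" "\<And>y m. m \<in> M \<Longrightarrow> br y m \<in> M" "\<And>y m. m \<in> M \<Longrightarrow> br m y \<in> M"
      "\<And>h. h \<in> cartan v \<Longrightarrow> gen_H h \<in> M \<Longrightarrow> h = 0"
  shows "e x \<notin> M" "f x \<notin> M"
proof -
  interpret U: generated_system s "cartan v" X N gen_H e f "coroot_of u" "root_of u" "parity_of u"
    by (rule sys)
  have "br (e x) (f x) \<notin> M"
  proof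
    assume "br (e x) (f x) \<in> M"
    then have "br (e x) (f x) - (br (e x) (f x) - gen_H (coroot_of u x)) \<in> M"
      using U.e_f_same[OF x] M(1,2) by (blast intro: free_lie.subspace_diff)
    then have "gen_H (coroot_of u x) \<in> M" by simp
    then show False using M(5) U.a_in[OF x] coroot_nonzero[OF u x] by blast
  qed
  then show "e x \<notin> M" "f x \<notin> M" using M(3,4) by blast+
qed

lemma generators_not_in_N:
  assumes "u \<in> skeleton s X v" "x \<in> X" "system u e f"
  shows "e x \<notin> N" "f x \<notin> N"
proof -
  interpret U: generated_system s "cartan v" X N gen_H e f "coroot_of u" "root_of u" "parity_of u"
    by (rule assms(3))
  show "e x \<notin> N" "f x \<notin> N"
    using ideal_without_generators[OF assms subset_refl U.N U.N_br cartan_N] by blast+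
qed

section \<open>Roots of the quotient and their sign coherence\<close>

definition "weight \<alpha> z \<longleftrightarrow> (\<forall>h\<in>cartan v. br (gen_H h) z - scl (\<alpha> h) z \<in> N)"

abbreviation "\<Delta> \<equiv> roots s X v (I v)"

lemma roots_iff:
  "\<alpha> \<in> \<Delta> \<longleftrightarrow> \<alpha> \<in> dual_space s (cartan v) \<and> \<alpha> \<noteq> 0 \<and> (\<exists>z. z \<notin> N \<and> weight \<alpha> z)"
proof -
  let ?L = "root_algebra s X v (I v)" and ?q = "quotient_class s X v (I v)"
  note P = presentsD[OF presents_root_algebra[OF ideal[OF v]]]
  note eq = quotient_class_eq[OF ideal[OF v]]
  have "(\<exists>g\<in>elems ?L. g \<noteq> zero_el ?L \<and> (\<forall>h\<in>cartan v. bracket ?L (cartan_embedding s X v (I v) h) g = scale_el ?L (\<alpha> h) g))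
    \<longleftrightarrow> (\<exists>z. ?q z \<noteq> ?q 0 \<and> (\<forall>h\<in>cartan v. bracket ?L (?q (gen_H h)) (?q z) = scale_el ?L (\<alpha> h) (?q z)))"
    unfolding P(1,2) by (auto simp: quotient_class_cartan)
  also have "\<dots> \<longleftrightarrow> (\<exists>z. z \<notin> N \<and> weight \<alpha> z)"
    unfolding P(4,5) eq weight_def by simp
  finally show ?thesis unfolding roots_def Let_def by (simp add: zero_fun_def)
qed

lemma root_of_is_root:
  assumes u: "u \<in> skeleton s X v" and x: "x \<in> X"
  shows "root_of u x \<in> \<Delta>"
proof -
  obtain e f where sys: "system u e f" using ex_system[OF u] by blast
  interpret U: generated_system s "cartan v" X N gen_H e f "coroot_of u" "root_of u" "parity_of u"
    by (rule sys)
  have "root_of u x \<noteq> 0"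
  proof
    assume z: "root_of u x = 0"
    have "(\<Sum>y\<in>X. (if y = x then 1 else 0) * root_of u y h) = 0" for h
    proof -
      have "(\<Sum>y\<in>X. (if y = x then 1 else 0) * root_of u y h) = (\<Sum>y\<in>X. if y = x then root_of u y h else 0)"
        by (rule sum.cong) auto
      then show ?thesis using z finX x by simp
    qed
    from roots_independent[OF vs skeleton_datum[OF u] this x] show False by simp
  qed
  moreover have "weight (root_of u x) (e x)" using U.\<eta>_e x by (simp add: weight_def)
  moreover have "root_of u x \<in> dual_space s (cartan v)"
    using root_in_dual[OF vs skeleton_datum[OF u], of x] skeleton_cartan[OF u] by simp
  ultimately show ?thesis using roots_iff generators_not_in_N[OF u x sys] by blast
qed

lemma positive_cone_word:
  assumes "w \<in> lists X"
  shows "word_weight (root_of u) w \<in> positive_cone X u"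
  unfolding word_weight_count[OF finX assms] positive_cone_def by blast

text \<open>Coherence at \<open>u\<close> comes from the triangular decomposition for the generators
  at \<open>u\<close>: a weight is plus or minus the weight of a word. The bound on multiples holds
  because the weight space of k b(x) is spanned by the \<open>k\<close>-fold bracket of e, which is
  zero from k = 3 on.\<close>

lemma root_chambers: "root_chambers s X v \<Delta>"
proof
  show "reflectable X u x" if "u \<in> skeleton s X v" "x \<in> X" for u x
    using full skeleton_component[OF that(1)] that(2) by (simp add: fully_reflectable_def)
  show "root_of u x \<in> \<Delta>" if "u \<in> skeleton s X v" "x \<in> X" for u x using that by (rule root_of_is_root)
  show "\<beta> \<in> positive_cone X u \<or> - \<beta> \<in> positive_cone X u" if u: "u \<in> skeleton s X v" and \<beta>: "\<beta> \<in> \<Delta>" for u \<beta>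
  proof -
    obtain e f where sys: "system u e f" using ex_system[OF u] by blast
    interpret U: generated_system s "cartan v" X N gen_H e f "coroot_of u" "root_of u" "parity_of u"
      by (rule sys)
    obtain z where z: "z \<notin> N" "weight \<beta> z" "\<beta> \<noteq> 0" "\<beta> \<in> dual_space s (cartan v)" using \<beta> roots_iff by blast
    then have "\<exists>w\<in>lists X. word_weight (root_of u) w = \<beta> \<or> word_weight (root_of u) w = - \<beta>"
      by (intro U.weight_positive[of \<beta> z]) (auto simp: U.has_weight_def weight_def dual_space_def)
    then show ?thesis using positive_cone_word by metis
  qed
  show "k \<le> 2" if u: "u \<in> skeleton s X v" and x: "x \<in> X" and k: "(\<lambda>h. of_nat k * root_of u x h) \<in> \<Delta>" for u x k
  proof (rule ccontr)
    assume "\<not> k \<le> 2"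
    then obtain n where n: "k = 3 + n" by (metis le_Suc_ex not_less_eq_eq numeral_3_eq_3 numeral_2_eq_2)
    obtain e f where sys: "system u e f" using ex_system[OF u] by blast
    interpret U: generated_system s "cartan v" X N gen_H e f "coroot_of u" "root_of u" "parity_of u"
      by (rule sys)
    obtain z where z: "z \<notin> N" "weight (\<lambda>h. of_nat k * root_of u x h) z" using k roots_iff by blast
    then have "U.has_weight (\<lambda>h. of_nat k * root_of u x h) z" by (simp add: U.has_weight_def weight_def)
    then obtain c where "z - scl c (nested e (replicate k x)) \<in> N"
      using U.weight_space_multiple[OF _ x] n by (metis add_gr_0 zero_less_numeral)
    then show False using z(1) unfolding n U.nested_replicate[OF x] by simp
  qed
qed (use vs finX rdv in \<open>auto simp: vector_space_def\<close>)

end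

locale root_superalgebra_fin = root_superalgebra +
  assumes fin: "type_Fin s X v" and ind: "indecomposable X v"
begin

interpretation vector_space s by (rule vs)

sublocale root_chambers_fin s X v \<Delta>
  using root_chambers fin by (simp add: root_chambers_fin_def root_chambers_fin_axioms_def type_Fin_def)

theorem no_imaginary_roots: "imaginary_roots s X v (I v) = {}"
proof -
  have "\<exists>q :: rat. (\<lambda>h. of_rat q * \<beta> h) \<in> real_roots s X v" if \<beta>: "\<beta> \<in> \<Delta>" for \<beta>
  proof -
    have "\<beta> \<noteq> 0" using \<beta> roots_iff by blast
    then obtain u x k where u: "u \<in> skeleton s X v" "x \<in> X" "k \<in> {1, 2::nat}" "\<beta> = (\<lambda>h. of_nat k * root_of u x h)"
      using root_multiple_of_real[OF \<beta>] by blast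
    have "(\<lambda>h. of_rat (1 / of_nat k) * \<beta> h) = root_of u x"
      using u(3) by (auto simp: u(4) of_rat_divide fun_eq_iff)
    then show ?thesis using u(1,2) unfolding real_roots_def by blast
  qed
  then show ?thesis unfolding imaginary_roots_def by blast
qed

text \<open>If \<open>a\<^sub>x\<^sub>x \<noteq> 0\<close>, the bracket of \<open>f\<^sub>x\<close> with \<open>[e\<^sub>x, e\<^sub>x]\<close> is a nonzero multiple of \<open>e\<^sub>x\<close>. Otherwise \<open>x\<close> has a
  neighbour \<open>y\<close>, and after the isotropic reflexion at \<open>x\<close> the relation \<open>[e\<^sub>y, f\<^sub>x] = 0\<close> says that
  \<open>[[e\<^sub>x, e\<^sub>y], e\<^sub>x] = 0\<close> at \<open>u\<close>, which forces \<open>[e\<^sub>x, e\<^sub>x]\<close> to vanish. This fails for \<open>gl(1|1)\<close> only.\<close>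

lemma square_in_N:
  assumes not_gl11: "\<not> (\<exists>x. X = {x} \<and> parity_of v x = 1 \<and> cartan_matrix v x x = 0)"
    and M: "N \<subseteq> M" "free_lie.subspace M" "\<And>y m. m \<in> M \<Longrightarrow> br y m \<in> M" "\<And>y m. m \<in> M \<Longrightarrow> br m y \<in> M"
      "\<And>h. h \<in> cartan v \<Longrightarrow> gen_H h \<in> M \<Longrightarrow> h = 0"
    and u: "u \<in> skeleton s X v" and x: "x \<in> X" and sys: "system u e f" and t: "br (e x) (e x) \<in> M"
  shows "br (e x) (e x) \<in> N"
proof -
  interpret U: generated_system s "cartan v" X N gen_H e f "coroot_of u" "root_of u" "parity_of u"
    by (rule sys)
  note eM = ideal_without_generators[OF u x sys M]
  let ?t = "br (e x) (e x)"
  have scaled: "z \<in> K" if "scl c z \<in> K" "c \<noteq> 0" "free_lie.subspace K" for c z K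
    using free_lie.subspace_scale[OF that(3,1), of "inverse c"] that(2) by simp
  have double: "z + z = scl 2 z" for z :: "('u, 'x) generator free_lie"
    using free_lie.scale_left_distrib[of 1 1 z] by simp
  show ?thesis
  proof (cases "parity_of u x = 1")
    case False
    then have "of_parity 0 (e x)" using U.e_parity[OF x] by (simp add: bit_not_one_iff)
    then have "?t = - ?t" using br_skew[of 0 "e x" 0 "e x"] by (simp add: koszul_sign_def)
    then have "?t + ?t = 0" by (metis add.right_inverse)
    then have "scl 2 ?t = 0" by (simp add: double)
    then show ?thesis using U.N_zero by simp
  next
    case True
    have odd: "of_parity 1 (e x)" "of_parity 1 (f x)" using U.e_parity[OF x] U.f_parity[OF x] True by auto
    have t0: "of_parity 0 ?t" using of_parity_br[OF odd(1) odd(1)] by simp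
    have fe: "br (f x) (e x) - gen_H (coroot_of u x) \<in> N"
      using br_skew[OF odd(2,1)] U.e_f_same[OF x] by (simp add: koszul_sign_def)
    define c where "c = cartan_matrix u x x"
    have He: "br (gen_H (coroot_of u x)) (e x) - scl c (e x) \<in> N"
      unfolding c_def cartan_matrix_def by (rule U.\<eta>_e[OF U.a_in[OF x] x])
    have eH: "br (e x) (gen_H (coroot_of u x)) = - br (gen_H (coroot_of u x)) (e x)"
      using br_skew[OF odd(1) U.\<eta>_parity] by (simp add: koszul_sign_def)
    have "br (br (f x) (e x)) (e x) - scl c (e x) \<in> N"
      using U.N_trans[OF U.N_mod_br(1)[OF fe] He] .
    moreover have "br (e x) (br (f x) (e x)) - scl (- c) (e x) \<in> N"
    proof -
      have "br (e x) (gen_H (coroot_of u x)) - scl (- c) (e x) \<in> N"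
        using free_lie.subspace_neg[OF U.N He] unfolding eH by simp
      then show ?thesis using U.N_trans[OF U.N_mod_br(2)[OF fe]] by blast
    qed
    then have "scl (-1) (br (e x) (br (f x) (e x))) - scl (-1) (scl (- c) (e x)) \<in> N" by (rule U.N_mod_scale)
    ultimately have "(br (br (f x) (e x)) (e x) + scl (-1) (br (e x) (br (f x) (e x)))) -
        (scl c (e x) + scl (-1) (scl (- c) (e x))) \<in> N" by (rule U.N_mod_add)
    then have ft: "br (f x) ?t - scl 2 (scl c (e x)) \<in> N"
      using br_jacobi[OF odd(2,1), of "e x"] double[of "scl c (e x)"] by (simp add: koszul_sign_def)
    have c0: "c = 0"
    proof (rule ccontr)
      assume c: "c \<noteq> 0"
      have "br (f x) ?t - (br (f x) ?t - scl 2 (scl c (e x))) \<in> M"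
        using free_lie.subspace_diff[OF M(2) M(3)[OF t]] ft M(1) by blast
      then have "scl (2 * c) (e x) \<in> M" by simp
      then show False using scaled[OF _ _ M(2)] c eM by simp
    qed
    \<comment> \<open>With a single vertex, reflexions keep the parity and the diagonal entry, so
      \<open>v\<close> itself would be of type gl(1|1).\<close>
    have "X \<noteq> {x}"
    proof
      assume X: "X = {x}"
      have "parity_of u x = parity_of v x \<and> cartan_matrix u x x = cartan_matrix v x x" using u
      proof induction
        case (2 u z)
        then have "z = x" using X by simp
        then show ?case
          using 2 cartan_matrix_reflexion[OF vs skeleton_datum[OF 2(1)], of x x x]
          by (simp add: parity_of_reflexion[OF vs] coeff_self[OF vs])
      qed simp
      then show False using not_gl11 X True c0 c_def by simp
    qed
    then obtain y where y: "y \<in> X" "y \<noteq> x" "cartan_matrix u x y \<noteq> 0"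
      using neighbour[OF ind u x] by blast
    have yx: "cartan_matrix u y x \<noteq> 0"
      using cartan_matrix_symmetric_zero[OF u y(1) x y(2)] y(3) by blast
    define w where "w = reflexion s u x"
    have w: "w \<in> skeleton s X v" unfolding w_def by (rule refl_Sk[OF u x])
    obtain e' f' where sys': "system w e' f'" using ex_system[OF w] by blast
    interpret W: generated_system s "cartan v" X N gen_H e' f' "coroot_of w" "root_of w" "parity_of w"
      by (rule sys')
    let ?B = "br (e x) (e y)"
    have wy: "root_of w y = (\<lambda>h. root_of u x h + root_of u y h)"
      unfolding w_def root_of_reflexion[OF vs] using y c0 by (auto simp: root_coeff_def Let_def c_def fun_eq_iff)
    have wx: "(\<lambda>h. - root_of w x h) = root_of u x"
      unfolding w_def root_of_reflexion[OF vs] by (simp add: root_coeff_def fun_eq_iff)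
    \<comment> \<open>The weight spaces of the new root b(x) + b(y) and of b(x), the negative of the
      new root at \<open>x\<close>, are spanned by [e x, e y] and e x modulo \<open>N\<close>. As
      generators at \<open>w\<close> are not in \<open>N\<close>, they are nonzero multiples of
      these.\<close>
    have "U.has_weight (\<lambda>h. root_of u x h + root_of u y h) (e' y)"
      using W.\<eta>_e[OF _ y(1)] unfolding U.has_weight_def wy by blast
    then obtain k where k: "e' y - scl k ?B \<in> N"
      using U.weight_space_two[OF _ x y(1)] y(2) by metis
    have "U.has_weight (root_of u x) (f' x)"
      using W.\<eta>_f[OF _ x] unfolding U.has_weight_def wx[symmetric] by blast
    then have "U.has_weight (\<lambda>h. of_nat 1 * root_of u x h) (f' x)" by simp
    then obtain l where "f' x - scl l (nested e (replicate 1 x)) \<in> N"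
      using U.weight_space_multiple[OF _ x] by (metis zero_less_one)
    then have l: "f' x - scl l (e x) \<in> N" by simp
    have kl: "k \<noteq> 0" "l \<noteq> 0"
      using k l generators_not_in_N[OF w y(1) sys'] generators_not_in_N[OF w x sys'] by auto
    have "br (e' y) (f' x) \<in> N" by (rule W.e_f[OF y(1) x y(2)])
    moreover have "br (e' y) (f' x) - br (scl k ?B) (scl l (e x)) \<in> N"
      by (rule U.N_trans[OF U.N_mod_br(1)[OF k] U.N_mod_br(2)[OF l]])
    ultimately have "br (scl k ?B) (scl l (e x)) \<in> N" using U.N_mod by blast
    then have "scl (k * l) (br ?B (e x)) \<in> N" by (simp add: br_scale_left br_scale_right mult.commute)
    then have Be: "br ?B (e x) \<in> N" using scaled[OF _ _ U.N] kl by simp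
    have B: "of_parity (1 + parity_of u y) ?B" by (rule of_parity_br[OF odd(1) U.e_parity[OF y(1)]])
    have eB: "br (e x) ?B \<in> N"
      unfolding br_skew[OF odd(1) B] by (rule free_lie.subspace_scale[OF U.N Be])
    \<comment> \<open>Modulo \<open>N\<close> the square ?t commutes with e y by this identity, and
      with f y since e x does; hence it commutes with the coroot of \<open>y\<close>, although its
      weight there is twice the nonzero entry at y, x.\<close>
    have "br ?t (e y) = scl 2 (br (e x) ?B)"
      using br_jacobi[OF odd(1) odd(1), of "e y"] double[of "br (e x) ?B"]
      by (simp add: koszul_sign_def algebra_simps)
    then have "br ?t (e y) \<in> N" using free_lie.subspace_scale[OF U.N eB] by simp
    then have tef: "br (br ?t (e y)) (f y) \<in> N" by (rule U.N_br)
    have "br (e x) (f y) \<in> N" by (rule U.e_f[OF x y(1)]) (use y(2) in simp)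
    then have fye: "br (f y) (e x) \<in> N"
      unfolding br_skew[OF U.f_parity[OF y(1)] odd(1)] by (rule free_lie.subspace_scale[OF U.N])
    have "br (f y) ?t \<in> N"
      unfolding br_jacobi[OF U.f_parity[OF y(1)] odd(1)]
      by (intro U.N_add free_lie.subspace_scale[OF U.N] U.N_br fye)
    then have "br ?t (f y) \<in> N"
      unfolding br_skew[OF t0 U.f_parity[OF y(1)]] by (rule free_lie.subspace_scale[OF U.N])
    then have "br (e y) (br ?t (f y)) \<in> N" by (rule U.N_br)
    then have "br ?t (br (e y) (f y)) \<in> N"
      unfolding br_jacobi[OF t0 U.e_parity[OF y(1)]]
      by (intro U.N_add free_lie.subspace_scale[OF U.N] tef)
    then have "br ?t (gen_H (coroot_of u y)) \<in> N"
      using U.N_mod[OF U.N_mod_br(2)[OF U.e_f_same[OF y(1)]]] by blast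
    then have Ht: "br (gen_H (coroot_of u y)) ?t \<in> N"
      unfolding br_skew[OF U.\<eta>_parity t0] by (rule free_lie.subspace_scale[OF U.N])
    have "U.has_weight (word_weight (root_of u) [x, x]) ?t" using U.has_weight_nested[of "[x, x]"] x by simp
    then have "br (gen_H (coroot_of u y)) ?t - scl (2 * cartan_matrix u y x) ?t \<in> N"
      using U.a_in[OF y(1)] by (auto simp: U.has_weight_def word_weight_def cartan_matrix_def)
    then have "scl (2 * cartan_matrix u y x) ?t \<in> N" using Ht U.N_mod by blast
    then show ?thesis using scaled[OF _ _ U.N] yx by simp
  qed
qed

lemma root_vector_in_N:
  assumes not_gl11: "\<not> (\<exists>x. X = {x} \<and> parity_of v x = 1 \<and> cartan_matrix v x x = 0)"
    and M: "N \<subseteq> M" "free_lie.subspace M" "\<And>y m. m \<in> M \<Longrightarrow> br y m \<in> M" "\<And>y m. m \<in> M \<Longrightarrow> br m y \<in> M"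
      "\<And>h. h \<in> cartan v \<Longrightarrow> gen_H h \<in> M \<Longrightarrow> h = 0"
    and \<beta>: "\<beta> \<in> \<Delta>" and z: "weight \<beta> z" "z \<in> M"
  shows "z \<in> N"
proof -
  have "\<beta> \<noteq> 0" using \<beta> roots_iff by blast
  then obtain u x k where u: "u \<in> skeleton s X v" "x \<in> X" "k \<in> {1, 2::nat}" "\<beta> = (\<lambda>h. of_nat k * root_of u x h)"
    using root_multiple_of_real[OF \<beta>] by blast
  obtain e f where sys: "system u e f" using ex_system[OF u(1)] by blast
  interpret U: generated_system s "cartan v" X N gen_H e f "coroot_of u" "root_of u" "parity_of u"
    by (rule sys)
  have "U.has_weight (\<lambda>h. of_nat k * root_of u x h) z" using z(1) u(4) by (simp add: U.has_weight_def weight_def)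
  then obtain c where c: "z - scl c (nested e (replicate k x)) \<in> N"
    using U.weight_space_multiple[OF _ u(2)] u(3) by (metis empty_iff insert_iff zero_less_numeral zero_less_one)
  have "nested e (replicate k x) \<in> N" if "c \<noteq> 0"
  proof -
    have "z - (z - scl c (nested e (replicate k x))) \<in> M"
      using free_lie.subspace_diff[OF M(2) z(2)] c M(1) by blast
    then have m: "nested e (replicate k x) \<in> M"
      using free_lie.subspace_scale[OF M(2), of "scl c (nested e (replicate k x))" "inverse c"] that by simp
    from u(3) consider "k = 1" | "k = 2" by blast
    then show ?thesis
    proof cases
      case 1
      then show ?thesis using m ideal_without_generators(1)[OF u(1,2) sys M] by simp
    next
      case 2
      then show ?thesis using m square_in_N[OF not_gl11 M u(1,2) sys] by (simp add: numeral_2_eq_2)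
    qed
  qed
  then have "scl c (nested e (replicate k x)) \<in> N"
    using free_lie.subspace_scale[OF U.N] U.N_zero by (cases "c = 0") simp_all
  then show ?thesis using U.N_mod[OF c] by blast
qed

section \<open>Maximality among ideals avoiding the Cartan subspace\<close>

lemma word_weight_in_dual: "word_weight (root_of v) w \<in> dual_space s (cartan v)"
proof (induction w)
  case Nil
  show ?case by (simp add: word_weight_def dual_space_def)
next
  case (Cons x w)
  then show ?case using root_in_dual[OF vs rdv, of x] by (auto simp: word_weight_def dual_space_def algebra_simps)
qed

lemma weight_is_root:
  assumes "weight \<beta> z" "z \<notin> N" "\<And>h. h \<notin> cartan v \<Longrightarrow> \<beta> h = 0" "\<beta> \<noteq> 0"
  shows "\<beta> \<in> \<Delta>"
proof -
  obtain e f where sys: "system v e f" using ex_system[OF skeleton.intros(1)] by blast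
  interpret V: generated_system s "cartan v" X N gen_H e f "coroot_of v" "root_of v" "parity_of v"
    by (rule sys)
  obtain w where w: "word_weight (root_of v) w = \<beta> \<or> word_weight (root_of v) w = - \<beta>"
    using V.weight_positive[of \<beta> z] assms unfolding V.has_weight_def weight_def by blast
  have "\<beta> \<in> dual_space s (cartan v)"
    using w
  proof
    assume "word_weight (root_of v) w = - \<beta>"
    then have "\<beta> h = - word_weight (root_of v) w h" for h by simp
    then show ?thesis using word_weight_in_dual[of w] by (simp add: dual_space_def)
  qed (use word_weight_in_dual[of w] in simp)
  then show ?thesis using roots_iff assms by blast
qed

lemma cartan_free_subset:
  assumes not_gl11: "\<not> (\<exists>x. X = {x} \<and> parity_of v x = 1 \<and> cartan_matrix v x x = 0)"
    and M: "N \<subseteq> M" "free_lie.subspace M" "\<And>y m. m \<in> M \<Longrightarrow> br y m \<in> M" "\<And>y m. m \<in> M \<Longrightarrow> br m y \<in> M"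
      "\<And>h. h \<in> cartan v \<Longrightarrow> gen_H h \<in> M \<Longrightarrow> h = 0"
  shows "M \<subseteq> N"
proof
  fix z assume z: "z \<in> M"
  obtain e f where sys: "system v e f" using ex_system[OF skeleton.intros(1)] by blast
  interpret V: generated_system s "cartan v" X N gen_H e f "coroot_of v" "root_of v" "parity_of v"
    by (rule sys)
  obtain n A y where *: "n \<in> N" "finite A" "\<And>\<alpha>. V.has_weight \<alpha> (y \<alpha>)" "\<And>\<alpha>. y \<alpha> \<in> M"
    "\<And>\<alpha>. \<alpha> \<notin> A \<Longrightarrow> y \<alpha> = 0" "\<And>\<alpha> h. \<alpha> \<in> A \<Longrightarrow> h \<notin> cartan v \<Longrightarrow> \<alpha> h = 0" "z = n + (\<Sum>\<alpha>\<in>A. y \<alpha>)"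
    using V.subspace_components[OF M(2,1) M(3) z] by blast
  have "y \<alpha> \<in> N" if \<alpha>: "\<alpha> \<in> A" for \<alpha>
  proof (cases "\<alpha> = 0")
    case True
    then have "V.has_weight 0 (y \<alpha>)" using *(3) by metis
    then obtain h where h: "h \<in> cartan v" "y \<alpha> - gen_H h \<in> N" using V.weight_space_zero by blast
    have "y \<alpha> - (y \<alpha> - gen_H h) \<in> M" using free_lie.subspace_diff[OF M(2) *(4)] h(2) M(1) by blast
    then have "h = 0" using M(5)[OF h(1)] by simp
    then have "gen_H h \<in> N" using V.\<eta>_zero by simp
    then show ?thesis using V.N_mod[OF h(2)] by blast
  next
    case False
    have w: "weight \<alpha> (y \<alpha>)" using *(3) by (simp add: weight_def V.has_weight_def)
    show ?thesis
    proof (rule ccontr)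
      assume n: "y \<alpha> \<notin> N"
      then have "\<alpha> \<in> \<Delta>" using weight_is_root[OF w n] *(6)[OF \<alpha>] False by blast
      then show False using root_vector_in_N[OF not_gl11 M _ w *(4)] n by blast
    qed
  qed
  then have "(\<Sum>\<alpha>\<in>A. y \<alpha>) \<in> N" by (intro free_lie.subspace_sum[OF V.N])
  then show "z \<in> N" unfolding *(7) by (rule V.N_add[OF *(1)])
qed

text \<open>\<open>J\<close> and \<open>I v\<close> need not be comparable, but the sum of their
  preimages contains that of \<open>I v\<close> and still avoids the Cartan subspace, so
  \<open>cartan_free_subset\<close> applies to the sum.\<close>

lemma cartan_free_ideal_subset:
  assumes not_gl11: "\<not> (\<exists>x. X = {x} \<and> parity_of v x = 1 \<and> cartan_matrix v x x = 0)"
    and J: "cartan_free_ideal s X v J"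
  shows "J \<subseteq> I v"
proof -
  let ?k = "half_baked_class s X v"
  let ?Z = "{zero_el (half_baked s X v)}"
  note P = presents_half_baked[of s X v] and D = presentsD[OF presents_half_baked[of s X v]]
  have sJ: "super_ideal (half_baked s X v) J" using J by (simp add: cartan_free_ideal_def)
  have zero_parity: "?k 0 \<in> homog (half_baked s X v) i" for i
    unfolding D(6) using of_parity_zero by blast
  have sZ: "super_ideal (half_baked s X v) ?Z"
    unfolding super_ideal_def lin_subspace_def D(1,2)
    using zero_parity by (auto simp: D(3-5))
  define K where "K = ideal_kernel s X v J"
  \<comment> \<open>The kernel of the half-baked algebra itself lies in both preimages, so the
    weight decompositions for \<open>cartan_free_sum\<close> are taken modulo it.\<close>
  define N0 where "N0 = ideal_kernel s X v ?Z"
  note VJ = ideal_vimage[OF P sJ, folded ideal_kernel_def, folded K_def]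
  note VI = ideal_vimage[OF P ideal[OF v], folded ideal_kernel_def]
  have zeros: "?Z \<subseteq> J" "?Z \<subseteq> I v"
    using sJ ideal[OF v] by (auto simp: super_ideal_def lin_subspace_def)
  then have N0: "N0 \<subseteq> K" "N0 \<subseteq> N" by (auto simp: K_def N0_def ideal_kernel_def)
  interpret V: generated_system s "cartan v" X N0 gen_H "gen_E v" "gen_F v" "coroot_of v" "root_of v" "parity_of v"
    unfolding N0_def by (rule generated_system_basic[OF vs finX rdv sZ])
  define M where "M = {j + n | j n. j \<in> K \<and> n \<in> N}"
  have KM: "K \<subseteq> M"
  proof
    fix j assume "j \<in> K"
    then have "j + 0 \<in> M" unfolding M_def using free_lie.subspace_0[OF VI(1)] by blast
    then show "j \<in> M" by simp
  qed
  have NM: "N \<subseteq> M"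
  proof
    fix n assume "n \<in> N"
    then have "0 + n \<in> M" unfolding M_def using free_lie.subspace_0[OF VJ(1)] by blast
    then show "n \<in> M" by simp
  qed
  have M: "free_lie.subspace M" unfolding M_def by (rule free_lie.subspace_sums[OF VJ(1) VI(1)])
  have "M \<subseteq> N"
  proof (rule cartan_free_subset[OF not_gl11 NM M])
    show "br y m \<in> M" "br m y \<in> M" if m: "m \<in> M" for y m
    proof -
      obtain j n where jn: "m = j + n" "j \<in> K" "n \<in> N" using m by (auto simp: M_def)
      show "br y m \<in> M" "br m y \<in> M"
        unfolding M_def jn(1) br_add_left br_add_right
        using VJ(2,3)[OF jn(2), of y] VI(2,3)[OF jn(3), of y] by blast+
    qed
    fix h assume h: "h \<in> cartan v" "gen_H h \<in> M"
    then obtain j n where jn: "gen_H h = j + n" "j \<in> K" "n \<in> N" by (auto simp: M_def)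
    show "h = 0"
    proof (rule V.cartan_free_sum[OF VJ(1) N0(1) VJ(2) _ VI(1) N0(2) VI(2) cartan_N h(1) jn])
      show "h = 0" if "h \<in> cartan v" "gen_H h \<in> K" for h
        using kernel_meets_cartan[OF vs rdv J that(1)] that(2) by (simp add: K_def)
    qed
  qed
  then have "K \<subseteq> N" using KM by blast
  then have "?k ` K \<subseteq> ?k ` N" by blast
  then show ?thesis unfolding VJ(5) VI(5) .
qed

theorem root_algebra_contragredient:
  assumes "\<not> (\<exists>x. X = {x} \<and> parity_of v x = 1 \<and> cartan_matrix v x x = 0)"
  shows "root_algebra s X v (I v) = contragredient_algebra s X v"
proof -
  have "max_ideal s X v = I v"
    unfolding max_ideal_def
    by (rule Greatest_equality) (use cartan_free[OF v] cartan_free_ideal_subset[OF assms] in auto)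
  then show ?thesis by (simp add: root_algebra_def contragredient_algebra_def)
qed

text \<open>The height of the weight of a word is its length, so a bound on the heights of the roots
  bounds the words that survive modulo \<open>N\<close>.\<close>

lemma nested_nonzero_length:
  assumes w: "w \<in> lists X" and weight: "weight \<beta> z" "z \<notin> N"
    and \<beta>: "\<beta> = word_weight (root_of v) w \<or> \<beta> = - word_weight (root_of v) w" and "w \<noteq> []"
  shows "\<beta> \<in> \<Delta>" "int (length w) = \<bar>ht v \<beta>\<bar>"
proof -
  have v: "v \<in> skeleton s X v" by (rule skeleton.intros)
  have ww: "word_weight (root_of v) w \<in> lattice \<and> ht v (word_weight (root_of v) w) = int (length w)"
    using w
  proof (induction w)
    case Nil
    have "word_weight (root_of v) [] = 0" by (simp add: word_weight_def zero_fun_def)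
    moreover have "ht v 0 = 0" using ht_diff[OF v lattice_zero lattice_zero] by simp
    ultimately show ?case using lattice_zero by (simp only: list.size of_nat_0 simp_thms)
  next
    case (Cons x w)
    have x: "root_of v x \<in> lattice" using root_mem_lattice[OF root_mem[OF v]] Cons by simp
    have sum: "word_weight (root_of v) (x # w) = root_of v x + word_weight (root_of v) w"
      by (simp add: word_weight_def plus_fun_def)
    have IH: "word_weight (root_of v) w \<in> lattice" "ht v (word_weight (root_of v) w) = int (length w)"
      using Cons.IH by auto
    show ?case
      unfolding sum ht_add[OF v x IH(1)] IH(2) ht_root[OF v Cons.hyps(1)]
      by (rule conjI[OF lattice_add[OF x IH(1)]]) simp
  qed
  then show len: "int (length w) = \<bar>ht v \<beta>\<bar>" using \<beta> ht_uminus[OF v] by auto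
  have "ht v 0 = 0" using ht_diff[OF v lattice_zero lattice_zero] by simp
  then have "\<beta> \<noteq> 0" using len \<open>w \<noteq> []\<close> by auto
  moreover have "\<beta> h = 0" if "h \<notin> cartan v" for h
    using \<beta> dual_space_outside[OF vs word_weight_in_dual that] by auto
  ultimately show "\<beta> \<in> \<Delta>" using weight_is_root[OF weight] by blast
qed

theorem finite_dimensional: "finite_dim (root_algebra s X v (I v))"
proof -
  let ?L = "root_algebra s X v (I v)" and ?q = "quotient_class s X v (I v)"
  note P = presentsD[OF presents_root_algebra[OF ideal[OF v]]]
  obtain e f where sys: "system v e f" using ex_system[OF skeleton.intros(1)] by blast
  interpret V: generated_system s "cartan v" X N gen_H e f "coroot_of v" "root_of v" "parity_of v"
    by (rule sys)
  \<comment> \<open>The inserted 0 keeps \<open>Max\<close> meaningful when there are no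
    roots.\<close>
  define m where "m = Max (insert 0 ((\<lambda>\<beta>. nat \<bar>ht v \<beta>\<bar>) ` \<Delta>))"
  have m: "nat \<bar>ht v \<beta>\<bar> \<le> m" if "\<beta> \<in> \<Delta>" for \<beta>
    unfolding m_def using finite_roots[OF ind] that by (intro Max_ge) auto
  have short: "length w \<le> m" if w: "w \<in> lists X" and nz: "nested e w \<notin> N \<or> nested f w \<notin> N" for w
  proof (cases "w = []")
    case False
    have "weight (word_weight (root_of v) w) (nested e w)" "weight (- word_weight (root_of v) w) (nested f w)"
      using V.has_weight_nested[OF w] V.has_weight_nested_f[OF w]
      by (simp_all add: weight_def V.has_weight_def)
    then obtain \<beta> where "\<beta> \<in> \<Delta>" "int (length w) = \<bar>ht v \<beta>\<bar>"
      using nested_nonzero_length[OF w _ _ _ False] nz by metis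
    then show ?thesis using m[of \<beta>] by linarith
  qed simp
  obtain B where B: "finite B" "cartan v = span B" using rdv by (auto simp: is_root_datum_def)
  define W where "W = {w \<in> lists X. length w \<le> m}"
  define G where "G = gen_H ` B \<union> nested e ` W \<union> nested f ` W"
  have "finite W" unfolding W_def using finite_lists_length_le[OF finX, of m] by (simp add: lists_eq_set conj_commute)
  then have finG: "finite G" using B by (simp add: G_def)
  have "S = elems ?L" if S: "lin_subspace ?L S" and GS: "?q ` G \<subseteq> S" for S
  proof -
    define T where "T = ?q -` S"
    have T: "free_lie.subspace T"
      unfolding free_lie.subspace_def
    proof (intro conjI ballI allI)
      show "0 \<in> T" using S by (simp add: T_def lin_subspace_def P(2))
      show "x + y \<in> T" if "x \<in> T" "y \<in> T" for x y
      proof -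
        have "add_el ?L (?q x) (?q y) \<in> S" using S that by (simp add: T_def lin_subspace_def)
        then show ?thesis by (simp add: T_def P(3))
      qed
      show "scl c x \<in> T" if "x \<in> T" for c x
      proof -
        have "scale_el ?L c (?q x) \<in> S" using S that by (simp add: T_def lin_subspace_def)
        then show ?thesis by (simp add: T_def P(4))
      qed
    qed
    have modT: "x \<in> T \<longleftrightarrow> y \<in> T" if "x - y \<in> N" for x y
      using quotient_class_eq[OF ideal[OF v], of x y] that by (simp add: T_def)
    have NT: "N \<subseteq> T"
    proof
      fix n assume "n \<in> N"
      then show "n \<in> T" using modT[of n 0] free_lie.subspace_0[OF T] by simp
    qed
    have GT: "G \<subseteq> T" using GS by (auto simp: T_def)
    have "h \<in> cartan v \<and> gen_H h \<in> T" if "h \<in> span B" for h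
      using that
    proof (induction rule: span_induct_alt)
      case base
      show ?case using V.\<eta>_zero NT subspace_0[OF V.C] by blast
    next
      case (step c b h)
      have b: "b \<in> cartan v" "gen_H b \<in> T" using step span_base[OF step(1)] B(2) GT by (auto simp: G_def)
      have cb: "s c b \<in> cartan v" by (rule subspace_scale[OF V.C b(1)])
      have "gen_H (s c b) \<in> T" using modT[OF V.\<eta>_scale[OF b(1)]] free_lie.subspace_scale[OF T b(2)] by blast
      then have "gen_H (s c b) + gen_H h \<in> T" using free_lie.subspace_add[OF T] step by blast
      then show ?case using modT[OF V.\<eta>_add[OF cb]] subspace_add[OF V.C cb] step by blast
    qed
    then have "gen_H ` cartan v \<subseteq> T" using B(2) by blast
    moreover have "nested e w \<in> T" "nested f w \<in> T" if "w \<in> lists X" for w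
    proof -
      have "length w \<le> m \<or> nested e w \<in> N \<and> nested f w \<in> N" using short[OF that] by blast
      then have "w \<in> W \<or> nested e w \<in> N \<and> nested f w \<in> N" using that by (simp add: W_def)
      then show "nested e w \<in> T" "nested f w \<in> T" using NT GT by (auto simp: G_def)
    qed
    ultimately have "N \<union> gen_H ` cartan v \<union> nested e ` lists X \<union> nested f ` lists X \<subseteq> T" using NT by blast
    then have "T = UNIV" using free_lie.span_minimal[OF _ T] V.span_UNIV by blast
    then have "elems ?L \<subseteq> S" unfolding P(1) by (auto simp: T_def)
    then show ?thesis using S by (auto simp: lin_subspace_def)
  qed
  moreover have "?q ` G \<subseteq> elems ?L" unfolding P(1) by blast
  ultimately show ?thesis unfolding finite_dim_def using finG by (intro exI[of _ "?q ` G"]) auto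
qed

end

theorem lemma7p4p1:
  fixes s :: "complex \<Rightarrow> 'u::ab_group_add \<Rightarrow> 'u"
    and X :: "'x set"
    and R :: "('u, 'x) root_datum set"
    and I :: "('u, 'x) root_datum \<Rightarrow> ('u, 'x) half_baked_el set"
    and v :: "('u, 'x) root_datum"
  assumes "vector_space s"
    and "finite X"
    and "is_component s X R"
    and "admissible s X R"
    and "fully_reflectable X R"
    and "root_lie_superalgebra s X R I"
    and "v \<in> R"
    and "indecomposable X v"
    and "type_Fin s X v"
  shows "imaginary_roots s X v (I v) = {}
    \<and> (\<not> (\<exists>x. X = {x} \<and> parity_of v x = 1 \<and> cartan_matrix v x x = 0) \<longrightarrow>
         root_algebra s X v (I v) = contragredient_algebra s X v)
    \<and> finite_dim (root_algebra s X v (I v))"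
proof -
  interpret root_superalgebra_fin s X R I v
    using assms by (intro root_superalgebra_fin.intro root_superalgebra.intro root_superalgebra_fin_axioms.intro)
  show ?thesis using no_imaginary_roots root_algebra_contragredient finite_dimensional by blast
qed

end
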